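(* The $2$-functor $$\mathsf{CwA}\longrightarrow\mathsf{CAT}^{\mathbf{2}},\qquad (\mathsf{A},\mathsf{E},I)\longmapsto\left(\mathscr{N}_I:\mathsf{E}\to\widehat{\mathsf{A}}\right)$$ reflects all (weighted) limits.
   Context: For a small category $\mathsf{A}$, $\widehat{\mathsf{A}}=[\mathsf{A}^{\mathrm{op}},\mathsf{Set}]$. For $I:\mathsf{A}\to\mathsf{E}$ the nerve is $\mathscr{N}_I:\mathsf{E}\to\widehat{\mathsf{A}}$, $e\mapsto \mathsf{E}(I(-),e)$. $\mathsf{CwA}$ is the $2$-category of categories with arities. Its $0$-cells are triples $(\mathsf{A},\mathsf{E},I)$ with $\mathsf{E}$ a locally small category and $I:\mathsf{A}\hookrightarrow\mathsf{E}$ a dense, small, full subcategory. Its $1$-cells $(\mathsf{A},\mathsf{E},I)\to(\mathsf{B},\mathsf{F},J)$ ("arities-respecting functors") are functors $K:\mathsf{E}\to\mathsf{F}$ such that the square $\overline{K}\circ\mathscr{N}_I\cong\mathscr{N}_J\circ K$ pseudo-commutes (i.e. commutes up to isomorphism), where $\overline{K}=\mathrm{Lan}_{y_{\mathsf{A}}}(\mathscr{N}_J\circ K\circ I):\widehat{\mathsf{A}}\to\widehat{\mathsf{B}}$ is the left Kan extension along the Yoneda embedding $y_{\mathsf{A}}:\mathsf{A}\to\widehat{\mathsf{A}}$. Its $2$-cells are arbitrary natural transformations $K\Rightarrow L:\mathsf{E}\to\mathsf{F}$. Equivalently, $1$-cells may be taken to be co-continuous functors $\overline{K}:\widehat{\mathsf{A}}\to\widehat{\mathsf{B}}$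 that pseudo-factor through the nerves, i.e. for which there exists a functor $K:\mathsf{E}\to\mathsf{F}$ with $\overline{K}\circ\mathscr{N}_I\cong\mathscr{N}_J\circ K$, with $2$-cells the natural transformations between them. $\mathsf{CAT}$ is the $2$-category of (locally small) categories, and $\mathsf{CAT}^{\mathbf{2}}$ is the $2$-category of arrows in $\mathsf{CAT}$, a $1$-cell being a square commuting up to isomorphism. The $2$-functor sends a $1$-cell $K$ to the square formed by $K$, $\overline K$ and the two nerves. Limits are $\mathsf{Cat}$-weighted limits: for a $2$-diagram $X:J\to\mathsf{D}$ and a weight $W:J\to\mathsf{Cat}$, the limit $\varprojlim^W X$. *)

theory Defs
  imports "HOL-Library.FuncSet"
begin

unbundle cardinal_syntax

section \<open>Size\<close>

text \<open>
  The elements of a type \<open>'u\<close> serve as the elements of sets, and a collection (of elements of any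
  type) is small, i.e. a set, when its cardinality is below that of \<open>'u\<close>.
  The universe condition says that this cardinality is a regular strong limit: an inaccessible
  cardinal gives a Grothendieck universe of sets, and the countable case, which is deliberately not
  excluded, gives the universe of finite sets.
\<close>

definition small :: "'u itself \<Rightarrow> 'x set \<Rightarrow> bool" where
  "small U S \<longleftrightarrow> |S| <o |UNIV :: 'u set|"

definition universe :: "'u itself \<Rightarrow> bool" where
  "universe U \<longleftrightarrow>
     infinite (UNIV :: 'u set) \<and>
     (\<forall>S :: 'u set. small U S \<longrightarrow> small U (Pow S)) \<and>
     (\<forall>(S :: 'u set) (B :: 'u \<Rightarrow> 'u set).
        small U S \<and> (\<forall>i\<in>S. small U (B i)) \<longrightarrow> small U (\<Union>i\<in>S. B i))"


section \<open>Categories, functors, natural transformations\<close>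

text \<open>
  Hom-sets are indexed by pairs of objects and need not be disjoint; hence composition takes the
  three objects as arguments: \<open>cmp C x y z g f\<close> is the composite of \<open>f : x \<rightarrow> y\<close> and
  \<open>g : y \<rightarrow> z\<close>. All functors and transformations are extensional (\<open>undefined\<close> outside their
  domains), so that equality in HOL is equality of functors and of transformations.
\<close>

record ('o, 'm) category =
  Ob :: "'o set"
  Hom :: "'o \<Rightarrow> 'o \<Rightarrow> 'm set"
  idn :: "'o \<Rightarrow> 'm"
  cmp :: "'o \<Rightarrow> 'o \<Rightarrow> 'o \<Rightarrow> 'm \<Rightarrow> 'm \<Rightarrow> 'm"

definition category :: "('o, 'm) category \<Rightarrow> bool" where
  "category C \<longleftrightarrow>
     (\<forall>x\<in>Ob C. idn C x \<in> Hom C x x) \<and>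
     (\<forall>x\<in>Ob C. \<forall>y\<in>Ob C. \<forall>z\<in>Ob C. \<forall>f\<in>Hom C x y. \<forall>g\<in>Hom C y z.
        cmp C x y z g f \<in> Hom C x z) \<and>
     (\<forall>x\<in>Ob C. \<forall>y\<in>Ob C. \<forall>f\<in>Hom C x y.
        cmp C x y y (idn C y) f = f \<and> cmp C x x y f (idn C x) = f) \<and>
     (\<forall>w\<in>Ob C. \<forall>x\<in>Ob C. \<forall>y\<in>Ob C. \<forall>z\<in>Ob C.
        \<forall>f\<in>Hom C w x. \<forall>g\<in>Hom C x y. \<forall>h\<in>Hom C y z.
        cmp C w x z (cmp C x y z h g) f = cmp C w y z h (cmp C w x y g f))"

definition locally_small :: "'u itself \<Rightarrow> ('o, 'm) category \<Rightarrow> bool" where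
  "locally_small U C \<longleftrightarrow> (\<forall>x\<in>Ob C. \<forall>y\<in>Ob C. small U (Hom C x y))"

definition small_category :: "'u itself \<Rightarrow> ('o, 'm) category \<Rightarrow> bool" where
  "small_category U C \<longleftrightarrow> category C \<and> small U (Ob C) \<and> locally_small U C"

definition is_iso :: "('o, 'm) category \<Rightarrow> 'o \<Rightarrow> 'o \<Rightarrow> 'm \<Rightarrow> bool" where
  "is_iso C x y f \<longleftrightarrow> f \<in> Hom C x y \<and>
     (\<exists>g\<in>Hom C y x. cmp C x y x g f = idn C x \<and> cmp C y x y f g = idn C y)"

definition op_cat :: "('o, 'm) category \<Rightarrow> ('o, 'm) category" where
  "op_cat C = \<lparr>Ob = Ob C, Hom = (\<lambda>x y. Hom C y x), idn = idn C,
     cmp = (\<lambda>x y z g f. cmp C z y x f g)\<rparr>"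

record ('o, 'm, 'p, 'n) ftor =
  fo :: "'o \<Rightarrow> 'p"
  fa :: "'o \<Rightarrow> 'o \<Rightarrow> 'm \<Rightarrow> 'n"

definition mk_ftor ::
  "('o, 'm) category \<Rightarrow> ('o \<Rightarrow> 'p) \<Rightarrow> ('o \<Rightarrow> 'o \<Rightarrow> 'm \<Rightarrow> 'n) \<Rightarrow> ('o, 'm, 'p, 'n) ftor" where
  "mk_ftor C F M = \<lparr>fo = restrict F (Ob C),
     fa = (\<lambda>x y. if x \<in> Ob C \<and> y \<in> Ob C then restrict (M x y) (Hom C x y) else (\<lambda>_. undefined))\<rparr>"

definition functors ::
  "('o, 'm) category \<Rightarrow> ('p, 'n) category \<Rightarrow> ('o, 'm, 'p, 'n) ftor set" where
  "functors C D = {F.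
     F = mk_ftor C (fo F) (fa F) \<and>
     (\<forall>x\<in>Ob C. fo F x \<in> Ob D) \<and>
     (\<forall>x\<in>Ob C. \<forall>y\<in>Ob C. \<forall>f\<in>Hom C x y. fa F x y f \<in> Hom D (fo F x) (fo F y)) \<and>
     (\<forall>x\<in>Ob C. fa F x x (idn C x) = idn D (fo F x)) \<and>
     (\<forall>x\<in>Ob C. \<forall>y\<in>Ob C. \<forall>z\<in>Ob C. \<forall>f\<in>Hom C x y. \<forall>g\<in>Hom C y z.
        fa F x z (cmp C x y z g f) =
        cmp D (fo F x) (fo F y) (fo F z) (fa F y z g) (fa F x y f))}"

definition id_ftor :: "('o, 'm) category \<Rightarrow> ('o, 'm, 'o, 'm) ftor" where
  "id_ftor C = mk_ftor C (\<lambda>x. x) (\<lambda>x y f. f)"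

definition ftor_comp ::
  "('o, 'm) category \<Rightarrow> ('p, 'n, 'q, 'l) ftor \<Rightarrow> ('o, 'm, 'p, 'n) ftor \<Rightarrow> ('o, 'm, 'q, 'l) ftor"
  where
  "ftor_comp C G F = mk_ftor C (\<lambda>x. fo G (fo F x)) (\<lambda>x y f. fa G (fo F x) (fo F y) (fa F x y f))"

definition full_faithful ::
  "('o, 'm) category \<Rightarrow> ('p, 'n) category \<Rightarrow> ('o, 'm, 'p, 'n) ftor \<Rightarrow> bool" where
  "full_faithful C D F \<longleftrightarrow>
     (\<forall>x\<in>Ob C. \<forall>y\<in>Ob C. bij_betw (fa F x y) (Hom C x y) (Hom D (fo F x) (fo F y)))"

definition iso_of_categories ::
  "('o, 'm) category \<Rightarrow> ('p, 'n) category \<Rightarrow> ('o, 'm, 'p, 'n) ftor \<Rightarrow> bool" where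
  "iso_of_categories C D F \<longleftrightarrow>
     F \<in> functors C D \<and> bij_betw (fo F) (Ob C) (Ob D) \<and> full_faithful C D F"

definition nats ::
  "('o, 'm) category \<Rightarrow> ('p, 'n) category \<Rightarrow> ('o, 'm, 'p, 'n) ftor \<Rightarrow> ('o, 'm, 'p, 'n) ftor
     \<Rightarrow> ('o \<Rightarrow> 'n) set" where
  "nats C D F G = {\<alpha> \<in> extensional (Ob C).
     (\<forall>x\<in>Ob C. \<alpha> x \<in> Hom D (fo F x) (fo G x)) \<and>
     (\<forall>x\<in>Ob C. \<forall>y\<in>Ob C. \<forall>f\<in>Hom C x y.
        cmp D (fo F x) (fo F y) (fo G y) (\<alpha> y) (fa F x y f) =
        cmp D (fo F x) (fo G x) (fo G y) (fa G x y f) (\<alpha> x))}"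

definition functor_category ::
  "('o, 'm) category \<Rightarrow> ('p, 'n) category \<Rightarrow> (('o, 'm, 'p, 'n) ftor, 'o \<Rightarrow> 'n) category" where
  "functor_category C D = \<lparr>Ob = functors C D, Hom = nats C D,
     idn = (\<lambda>F. \<lambda>x\<in>Ob C. idn D (fo F x)),
     cmp = (\<lambda>F G H \<beta> \<alpha>. \<lambda>x\<in>Ob C. cmp D (fo F x) (fo G x) (fo H x) (\<beta> x) (\<alpha> x))\<rparr>"

text \<open>The horizontal composite of \<open>\<alpha> : F \<Rightarrow> F'\<close> (between functors out of \<open>C\<close>) and
  \<open>\<beta> : G \<Rightarrow> G'\<close> (between functors into \<open>E\<close>).\<close>

definition nat_hcomp ::
  "('o, 'm) category \<Rightarrow> ('q, 'l) category \<Rightarrow> ('p, 'n, 'q, 'l) ftor \<Rightarrow> ('p, 'n, 'q, 'l) ftor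
     \<Rightarrow> ('o, 'm, 'p, 'n) ftor \<Rightarrow> ('o, 'm, 'p, 'n) ftor \<Rightarrow> ('p \<Rightarrow> 'l) \<Rightarrow> ('o \<Rightarrow> 'n) \<Rightarrow> 'o \<Rightarrow> 'l" where
  "nat_hcomp C E G G' F F' \<beta> \<alpha> = (\<lambda>x\<in>Ob C.
     cmp E (fo G (fo F x)) (fo G (fo F' x)) (fo G' (fo F' x))
       (\<beta> (fo F' x)) (fa G (fo F x) (fo F' x) (\<alpha> x)))"


section \<open>Presheaves, nerves, left Kan extensions\<close>

definition SET :: "('u set, 'u \<Rightarrow> 'u) category" where
  "SET = \<lparr>Ob = {S. small TYPE('u) S}, Hom = (\<lambda>S T. S \<rightarrow>\<^sub>E T), idn = (\<lambda>S. \<lambda>x\<in>S. x),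
     cmp = (\<lambda>S T V g f. compose S g f)\<rparr>"

type_synonym ('a, 'u) presheaf = "('a, 'u, 'u set, 'u \<Rightarrow> 'u) ftor"
type_synonym ('a, 'u) presheaf_mor = "'a \<Rightarrow> 'u \<Rightarrow> 'u"

definition psh :: "('a, 'u) category \<Rightarrow> (('a, 'u) presheaf, ('a, 'u) presheaf_mor) category" where
  "psh A = functor_category (op_cat A) SET"

text \<open>The nerve sends \<open>e\<close> to the presheaf \<open>E(I(-), e)\<close>.\<close>

definition nerve ::
  "('a, 'u) category \<Rightarrow> ('o, 'u) category \<Rightarrow> ('a, 'u, 'o, 'u) ftor
     \<Rightarrow> ('o, 'u, ('a, 'u) presheaf, ('a, 'u) presheaf_mor) ftor" where
  "nerve A E I = mk_ftor E
     (\<lambda>e. mk_ftor (op_cat A) (\<lambda>a. Hom E (fo I a) e)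
            (\<lambda>a b f. \<lambda>g\<in>Hom E (fo I a) e. cmp E (fo I b) (fo I a) e g (fa I b a f)))
     (\<lambda>e e' h. \<lambda>a\<in>Ob A. \<lambda>g\<in>Hom E (fo I a) e. cmp E (fo I a) e e' h g)"

definition yoneda ::
  "('a, 'u) category \<Rightarrow> ('a, 'u, ('a, 'u) presheaf, ('a, 'u) presheaf_mor) ftor" where
  "yoneda A = nerve A A (id_ftor A)"

text \<open>\<open>\<eta> : F \<Rightarrow> G \<circ> p\<close> exhibits \<open>G : C \<rightarrow> D\<close> as a left Kan extension of \<open>F : A \<rightarrow> D\<close>
  along \<open>p : A \<rightarrow> C\<close>.\<close>

definition is_lan ::
  "('a, 'k) category \<Rightarrow> ('o, 'm) category \<Rightarrow> ('p, 'n) category \<Rightarrow> ('a, 'k, 'o, 'm) ftor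
     \<Rightarrow> ('a, 'k, 'p, 'n) ftor \<Rightarrow> ('o, 'm, 'p, 'n) ftor \<Rightarrow> ('a \<Rightarrow> 'n) \<Rightarrow> bool" where
  "is_lan A C D p F G \<eta> \<longleftrightarrow>
     G \<in> functors C D \<and> \<eta> \<in> nats A D F (ftor_comp A G p) \<and>
     (\<forall>H\<in>functors C D. \<forall>\<theta>\<in>nats A D F (ftor_comp A H p).
        \<exists>!\<sigma>. \<sigma> \<in> nats C D G H \<and>
          (\<forall>a\<in>Ob A. cmp D (fo F a) (fo G (fo p a)) (fo H (fo p a)) (\<sigma> (fo p a)) (\<eta> a) = \<theta> a))"


section \<open>2-categories and 2-functors\<close>

text \<open>
  \<open>comp1 D a b c g f\<close> is the composite of \<open>f : a \<rightarrow> b\<close> and \<open>g : b \<rightarrow> c\<close>;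
  \<open>comp2 D a b c g g' f f' \<beta> \<alpha>\<close> is the horizontal composite of \<open>\<alpha> : f \<Rightarrow> f'\<close> and
  \<open>\<beta> : g \<Rightarrow> g'\<close>. Vertical composition is composition in the hom-categories.
\<close>

record ('c, 'f, 't) two_cat =
  Ob0 :: "'c set"
  HomC :: "'c \<Rightarrow> 'c \<Rightarrow> ('f, 't) category"
  id1 :: "'c \<Rightarrow> 'f"
  comp1 :: "'c \<Rightarrow> 'c \<Rightarrow> 'c \<Rightarrow> 'f \<Rightarrow> 'f \<Rightarrow> 'f"
  comp2 :: "'c \<Rightarrow> 'c \<Rightarrow> 'c \<Rightarrow> 'f \<Rightarrow> 'f \<Rightarrow> 'f \<Rightarrow> 'f \<Rightarrow> 't \<Rightarrow> 't \<Rightarrow> 't"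

abbreviation cells1 :: "('c, 'f, 't) two_cat \<Rightarrow> 'c \<Rightarrow> 'c \<Rightarrow> 'f set" where
  "cells1 D a b \<equiv> Ob (HomC D a b)"

abbreviation cells2 :: "('c, 'f, 't) two_cat \<Rightarrow> 'c \<Rightarrow> 'c \<Rightarrow> 'f \<Rightarrow> 'f \<Rightarrow> 't set" where
  "cells2 D a b \<equiv> Hom (HomC D a b)"

abbreviation id2 :: "('c, 'f, 't) two_cat \<Rightarrow> 'c \<Rightarrow> 'c \<Rightarrow> 'f \<Rightarrow> 't" where
  "id2 D a b \<equiv> idn (HomC D a b)"

definition two_category :: "('c, 'f, 't) two_cat \<Rightarrow> bool" where
  "two_category D \<longleftrightarrow>
     (\<forall>a\<in>Ob0 D. \<forall>b\<in>Ob0 D. category (HomC D a b)) \<and>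
     (\<forall>a\<in>Ob0 D. id1 D a \<in> cells1 D a a) \<and>
     (\<forall>a\<in>Ob0 D. \<forall>b\<in>Ob0 D. \<forall>c\<in>Ob0 D. \<forall>f\<in>cells1 D a b. \<forall>g\<in>cells1 D b c.
        comp1 D a b c g f \<in> cells1 D a c \<and>
        comp2 D a b c g g f f (id2 D b c g) (id2 D a b f) = id2 D a c (comp1 D a b c g f)) \<and>
     (\<forall>a\<in>Ob0 D. \<forall>b\<in>Ob0 D. \<forall>c\<in>Ob0 D.
        \<forall>f\<in>cells1 D a b. \<forall>f'\<in>cells1 D a b. \<forall>g\<in>cells1 D b c. \<forall>g'\<in>cells1 D b c.
        \<forall>\<alpha>\<in>cells2 D a b f f'. \<forall>\<beta>\<in>cells2 D b c g g'.
        comp2 D a b c g g' f f' \<beta> \<alpha> \<in> cells2 D a c (comp1 D a b c g f) (comp1 D a b c g' f')) \<and>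
     (\<forall>a\<in>Ob0 D. \<forall>b\<in>Ob0 D. \<forall>c\<in>Ob0 D.
        \<forall>f\<in>cells1 D a b. \<forall>f'\<in>cells1 D a b. \<forall>f''\<in>cells1 D a b.
        \<forall>g\<in>cells1 D b c. \<forall>g'\<in>cells1 D b c. \<forall>g''\<in>cells1 D b c.
        \<forall>\<alpha>\<in>cells2 D a b f f'. \<forall>\<alpha>'\<in>cells2 D a b f' f''.
        \<forall>\<beta>\<in>cells2 D b c g g'. \<forall>\<beta>'\<in>cells2 D b c g' g''.
        comp2 D a b c g g'' f f''
          (cmp (HomC D b c) g g' g'' \<beta>' \<beta>) (cmp (HomC D a b) f f' f'' \<alpha>' \<alpha>) =
        cmp (HomC D a c) (comp1 D a b c g f) (comp1 D a b c g' f') (comp1 D a b c g'' f'')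
          (comp2 D a b c g' g'' f' f'' \<beta>' \<alpha>') (comp2 D a b c g g' f f' \<beta> \<alpha>)) \<and>
     (\<forall>a\<in>Ob0 D. \<forall>b\<in>Ob0 D. \<forall>f\<in>cells1 D a b.
        comp1 D a b b (id1 D b) f = f \<and> comp1 D a a b f (id1 D a) = f) \<and>
     (\<forall>a\<in>Ob0 D. \<forall>b\<in>Ob0 D. \<forall>f\<in>cells1 D a b. \<forall>f'\<in>cells1 D a b. \<forall>\<alpha>\<in>cells2 D a b f f'.
        comp2 D a b b (id1 D b) (id1 D b) f f' (id2 D b b (id1 D b)) \<alpha> = \<alpha> \<and>
        comp2 D a a b f f' (id1 D a) (id1 D a) \<alpha> (id2 D a a (id1 D a)) = \<alpha>) \<and>
     (\<forall>a\<in>Ob0 D. \<forall>b\<in>Ob0 D. \<forall>c\<in>Ob0 D. \<forall>d\<in>Ob0 D.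
        \<forall>f\<in>cells1 D a b. \<forall>g\<in>cells1 D b c. \<forall>h\<in>cells1 D c d.
        comp1 D a b d (comp1 D b c d h g) f = comp1 D a c d h (comp1 D a b c g f)) \<and>
     (\<forall>a\<in>Ob0 D. \<forall>b\<in>Ob0 D. \<forall>c\<in>Ob0 D. \<forall>d\<in>Ob0 D.
        \<forall>f\<in>cells1 D a b. \<forall>f'\<in>cells1 D a b. \<forall>g\<in>cells1 D b c. \<forall>g'\<in>cells1 D b c.
        \<forall>h\<in>cells1 D c d. \<forall>h'\<in>cells1 D c d.
        \<forall>\<alpha>\<in>cells2 D a b f f'. \<forall>\<beta>\<in>cells2 D b c g g'. \<forall>\<gamma>\<in>cells2 D c d h h'.
        comp2 D a b d (comp1 D b c d h g) (comp1 D b c d h' g') f f'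
          (comp2 D b c d h h' g g' \<gamma> \<beta>) \<alpha> =
        comp2 D a c d h h' (comp1 D a b c g f) (comp1 D a b c g' f')
          \<gamma> (comp2 D a b c g g' f f' \<beta> \<alpha>))"

record ('c, 'f, 't, 'd, 'g, 's) two_ftor =
  F0 :: "'c \<Rightarrow> 'd"
  FH :: "'c \<Rightarrow> 'c \<Rightarrow> ('f, 't, 'g, 's) ftor"

definition two_functor ::
  "('c, 'f, 't) two_cat \<Rightarrow> ('d, 'g, 's) two_cat \<Rightarrow> ('c, 'f, 't, 'd, 'g, 's) two_ftor \<Rightarrow> bool" where
  "two_functor C D T \<longleftrightarrow>
     (\<forall>a\<in>Ob0 C. F0 T a \<in> Ob0 D) \<and>
     (\<forall>a\<in>Ob0 C. \<forall>b\<in>Ob0 C. FH T a b \<in> functors (HomC C a b) (HomC D (F0 T a) (F0 T b))) \<and>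
     (\<forall>a\<in>Ob0 C. fo (FH T a a) (id1 C a) = id1 D (F0 T a)) \<and>
     (\<forall>a\<in>Ob0 C. \<forall>b\<in>Ob0 C. \<forall>c\<in>Ob0 C. \<forall>f\<in>cells1 C a b. \<forall>g\<in>cells1 C b c.
        fo (FH T a c) (comp1 C a b c g f) =
        comp1 D (F0 T a) (F0 T b) (F0 T c) (fo (FH T b c) g) (fo (FH T a b) f)) \<and>
     (\<forall>a\<in>Ob0 C. \<forall>b\<in>Ob0 C. \<forall>c\<in>Ob0 C.
        \<forall>f\<in>cells1 C a b. \<forall>f'\<in>cells1 C a b. \<forall>g\<in>cells1 C b c. \<forall>g'\<in>cells1 C b c.
        \<forall>\<alpha>\<in>cells2 C a b f f'. \<forall>\<beta>\<in>cells2 C b c g g'.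
        fa (FH T a c) (comp1 C a b c g f) (comp1 C a b c g' f') (comp2 C a b c g g' f f' \<beta> \<alpha>) =
        comp2 D (F0 T a) (F0 T b) (F0 T c)
          (fo (FH T b c) g) (fo (FH T b c) g') (fo (FH T a b) f) (fo (FH T a b) f')
          (fa (FH T b c) g g' \<beta>) (fa (FH T a b) f f' \<alpha>))"

definition two_ftor_comp ::
  "('c, 'f, 't) two_cat \<Rightarrow> ('d, 'g, 's, 'e, 'h, 'r) two_ftor
     \<Rightarrow> ('c, 'f, 't, 'd, 'g, 's) two_ftor \<Rightarrow> ('c, 'f, 't, 'e, 'h, 'r) two_ftor" where
  "two_ftor_comp C S T = \<lparr>F0 = (\<lambda>a. F0 S (F0 T a)),
     FH = (\<lambda>a b. ftor_comp (HomC C a b) (FH S (F0 T a) (F0 T b)) (FH T a b))\<rparr>"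

text \<open>The 2-category of small categories, in which weights take their values.\<close>

definition Cat :: "'u itself \<Rightarrow> (('w, 'v) category, ('w, 'v, 'w, 'v) ftor, 'w \<Rightarrow> 'v) two_cat" where
  "Cat U = \<lparr>Ob0 = {C. small_category U C}, HomC = functor_category, id1 = id_ftor,
     comp1 = (\<lambda>A B C G F. ftor_comp A G F),
     comp2 = (\<lambda>A B C G G' F F' \<beta> \<alpha>. nat_hcomp A C G G' F F' \<beta> \<alpha>)\<rparr>"


section \<open>Weighted limits\<close>

text \<open>The 2-functor \<open>D(d, X-)\<close> with values in categories. Its values need not be small and live at
  other types than those of a weight.\<close>

definition rep_ftor ::
  "('j, 'k, 'i) two_cat \<Rightarrow> ('d, 'g, 's) two_cat \<Rightarrow> ('j, 'k, 'i, 'd, 'g, 's) two_ftor \<Rightarrow> 'd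
     \<Rightarrow> ('j, 'k, 'i, ('g, 's) category, ('g, 's, 'g, 's) ftor, 'g \<Rightarrow> 's) two_ftor" where
  "rep_ftor J D X d = \<lparr>F0 = (\<lambda>j. HomC D d (F0 X j)),
     FH = (\<lambda>j k. mk_ftor (HomC J j k)
       (\<lambda>u. mk_ftor (HomC D d (F0 X j))
          (\<lambda>f. comp1 D d (F0 X j) (F0 X k) (fo (FH X j k) u) f)
          (\<lambda>f f' \<alpha>. comp2 D d (F0 X j) (F0 X k) (fo (FH X j k) u) (fo (FH X j k) u) f f'
             (id2 D (F0 X j) (F0 X k) (fo (FH X j k) u)) \<alpha>))
       (\<lambda>u v \<theta>. \<lambda>f\<in>cells1 D d (F0 X j).
          comp2 D d (F0 X j) (F0 X k) (fo (FH X j k) u) (fo (FH X j k) v) f f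
            (fa (FH X j k) u v \<theta>) (id2 D d (F0 X j) f)))\<rparr>"

text \<open>Strict 2-natural transformations \<open>W \<Rightarrow> V\<close> between category-valued 2-functors on \<open>J\<close>.\<close>

definition two_nats ::
  "('j, 'k, 'i) two_cat
     \<Rightarrow> ('j, 'k, 'i, ('w, 'v) category, ('w, 'v, 'w, 'v) ftor, 'w \<Rightarrow> 'v) two_ftor
     \<Rightarrow> ('j, 'k, 'i, ('g, 's) category, ('g, 's, 'g, 's) ftor, 'g \<Rightarrow> 's) two_ftor
     \<Rightarrow> ('j \<Rightarrow> ('w, 'v, 'g, 's) ftor) set" where
  "two_nats J W V = {\<tau> \<in> extensional (Ob0 J).
     (\<forall>j\<in>Ob0 J. \<tau> j \<in> functors (F0 W j) (F0 V j)) \<and>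
     (\<forall>j\<in>Ob0 J. \<forall>k\<in>Ob0 J. \<forall>u\<in>cells1 J j k.
        ftor_comp (F0 W j) (\<tau> k) (fo (FH W j k) u) = ftor_comp (F0 W j) (fo (FH V j k) u) (\<tau> j)) \<and>
     (\<forall>j\<in>Ob0 J. \<forall>k\<in>Ob0 J. \<forall>u\<in>cells1 J j k. \<forall>v\<in>cells1 J j k. \<forall>\<theta>\<in>cells2 J j k u v.
        \<forall>w\<in>Ob (F0 W j).
        fa (\<tau> k) (fo (fo (FH W j k) u) w) (fo (fo (FH W j k) v) w) (fa (FH W j k) u v \<theta> w) =
        fa (FH V j k) u v \<theta> (fo (\<tau> j) w))}"

definition modifications ::
  "('j, 'k, 'i) two_cat
     \<Rightarrow> ('j, 'k, 'i, ('w, 'v) category, ('w, 'v, 'w, 'v) ftor, 'w \<Rightarrow> 'v) two_ftor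
     \<Rightarrow> ('j, 'k, 'i, ('g, 's) category, ('g, 's, 'g, 's) ftor, 'g \<Rightarrow> 's) two_ftor
     \<Rightarrow> ('j \<Rightarrow> ('w, 'v, 'g, 's) ftor) \<Rightarrow> ('j \<Rightarrow> ('w, 'v, 'g, 's) ftor) \<Rightarrow> ('j \<Rightarrow> 'w \<Rightarrow> 's) set" where
  "modifications J W V \<tau> \<tau>' = {m \<in> extensional (Ob0 J).
     (\<forall>j\<in>Ob0 J. m j \<in> nats (F0 W j) (F0 V j) (\<tau> j) (\<tau>' j)) \<and>
     (\<forall>j\<in>Ob0 J. \<forall>k\<in>Ob0 J. \<forall>u\<in>cells1 J j k. \<forall>w\<in>Ob (F0 W j).
        m k (fo (fo (FH W j k) u) w) =
        fa (fo (FH V j k) u) (fo (\<tau> j) w) (fo (\<tau>' j) w) (m j w))}"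

text \<open>The category \<open>[J, Cat](W, V)\<close>.\<close>

definition two_nat_category ::
  "('j, 'k, 'i) two_cat
     \<Rightarrow> ('j, 'k, 'i, ('w, 'v) category, ('w, 'v, 'w, 'v) ftor, 'w \<Rightarrow> 'v) two_ftor
     \<Rightarrow> ('j, 'k, 'i, ('g, 's) category, ('g, 's, 'g, 's) ftor, 'g \<Rightarrow> 's) two_ftor
     \<Rightarrow> ('j \<Rightarrow> ('w, 'v, 'g, 's) ftor, 'j \<Rightarrow> 'w \<Rightarrow> 's) category" where
  "two_nat_category J W V = \<lparr>Ob = two_nats J W V, Hom = modifications J W V,
     idn = (\<lambda>\<tau>. \<lambda>j\<in>Ob0 J. idn (functor_category (F0 W j) (F0 V j)) (\<tau> j)),
     cmp = (\<lambda>\<tau> \<tau>' \<tau>'' n m. \<lambda>j\<in>Ob0 J.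
       cmp (functor_category (F0 W j) (F0 V j)) (\<tau> j) (\<tau>' j) (\<tau>'' j) (n j) (m j))\<rparr>"

definition cones ::
  "('j, 'k, 'i) two_cat
     \<Rightarrow> ('j, 'k, 'i, ('w, 'v) category, ('w, 'v, 'w, 'v) ftor, 'w \<Rightarrow> 'v) two_ftor
     \<Rightarrow> ('d, 'g, 's) two_cat \<Rightarrow> ('j, 'k, 'i, 'd, 'g, 's) two_ftor \<Rightarrow> 'd
     \<Rightarrow> ('j \<Rightarrow> ('w, 'v, 'g, 's) ftor, 'j \<Rightarrow> 'w \<Rightarrow> 's) category" where
  "cones J W D X d = two_nat_category J W (rep_ftor J D X d)"

text \<open>The comparison \<open>D(d, l) \<rightarrow> [J, Cat](W, D(d, X-))\<close> induced by a cone \<open>\<lambda> : W \<Rightarrow> D(l, X-)\<close>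
  is precomposition in \<open>\<lambda>\<close>.\<close>

definition cone_comparison ::
  "('j, 'k, 'i) two_cat
     \<Rightarrow> ('j, 'k, 'i, ('w, 'v) category, ('w, 'v, 'w, 'v) ftor, 'w \<Rightarrow> 'v) two_ftor
     \<Rightarrow> ('d, 'g, 's) two_cat \<Rightarrow> ('j, 'k, 'i, 'd, 'g, 's) two_ftor \<Rightarrow> 'd
     \<Rightarrow> ('j \<Rightarrow> ('w, 'v, 'g, 's) ftor) \<Rightarrow> 'd
     \<Rightarrow> ('g, 's, 'j \<Rightarrow> ('w, 'v, 'g, 's) ftor, 'j \<Rightarrow> 'w \<Rightarrow> 's) ftor" where
  "cone_comparison J W D X l L d = mk_ftor (HomC D d l)
     (\<lambda>h. \<lambda>j\<in>Ob0 J. mk_ftor (F0 W j)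
        (\<lambda>w. comp1 D d l (F0 X j) (fo (L j) w) h)
        (\<lambda>w w' v. comp2 D d l (F0 X j) (fo (L j) w) (fo (L j) w') h h
           (fa (L j) w w' v) (id2 D d l h)))
     (\<lambda>h h' \<alpha>. \<lambda>j\<in>Ob0 J. \<lambda>w\<in>Ob (F0 W j).
        comp2 D d l (F0 X j) (fo (L j) w) (fo (L j) w) h h'
          (id2 D l (F0 X j) (fo (L j) w)) \<alpha>)"

definition is_weighted_limit ::
  "('j, 'k, 'i) two_cat
     \<Rightarrow> ('j, 'k, 'i, ('w, 'v) category, ('w, 'v, 'w, 'v) ftor, 'w \<Rightarrow> 'v) two_ftor
     \<Rightarrow> ('d, 'g, 's) two_cat \<Rightarrow> ('j, 'k, 'i, 'd, 'g, 's) two_ftor \<Rightarrow> 'd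
     \<Rightarrow> ('j \<Rightarrow> ('w, 'v, 'g, 's) ftor) \<Rightarrow> bool" where
  "is_weighted_limit J W D X l L \<longleftrightarrow>
     l \<in> Ob0 D \<and> L \<in> Ob (cones J W D X l) \<and>
     (\<forall>d\<in>Ob0 D.
        iso_of_categories (HomC D d l) (cones J W D X d) (cone_comparison J W D X l L d))"

definition cone_image ::
  "('j, 'k, 'i) two_cat
     \<Rightarrow> ('j, 'k, 'i, ('w, 'v) category, ('w, 'v, 'w, 'v) ftor, 'w \<Rightarrow> 'v) two_ftor
     \<Rightarrow> ('j, 'k, 'i, 'c, 'f, 't) two_ftor \<Rightarrow> ('c, 'f, 't, 'd, 'g, 's) two_ftor \<Rightarrow> 'c
     \<Rightarrow> ('j \<Rightarrow> ('w, 'v, 'f, 't) ftor) \<Rightarrow> 'j \<Rightarrow> ('w, 'v, 'g, 's) ftor" where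
  "cone_image J W X \<Phi> l L = (\<lambda>j\<in>Ob0 J. ftor_comp (F0 W j) (FH \<Phi> l (F0 X j)) (L j))"

definition reflects_weighted_limits ::
  "('j, 'k, 'i) two_cat
     \<Rightarrow> ('j, 'k, 'i, ('w, 'v) category, ('w, 'v, 'w, 'v) ftor, 'w \<Rightarrow> 'v) two_ftor
     \<Rightarrow> ('c, 'f, 't) two_cat \<Rightarrow> ('d, 'g, 's) two_cat \<Rightarrow> ('c, 'f, 't, 'd, 'g, 's) two_ftor \<Rightarrow> bool"
  where
  "reflects_weighted_limits J W C D \<Phi> \<longleftrightarrow>
     (\<forall>X l L. two_functor J C X \<and> l \<in> Ob0 C \<and> L \<in> Ob (cones J W C X l) \<and>
        is_weighted_limit J W D (two_ftor_comp J \<Phi> X) (F0 \<Phi> l) (cone_image J W X \<Phi> l L)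
        \<longrightarrow> is_weighted_limit J W C X l L)"


section \<open>The 2-category of arrows in CAT\<close>

text \<open>
  A 0-cell is a functor between locally small categories. Types stand for the size of the
  collections of objects: since a category and its category of presheaves never have the
  same HOL type, the domains and the codomains of the arrows are taken from the locally small
  categories at two (independent, arbitrary) types.
\<close>

record ('o, 'm, 'p, 'n) arrow =
  adom :: "('o, 'm) category"
  acod :: "('p, 'n) category"
  afun :: "('o, 'm, 'p, 'n) ftor"

text \<open>A 1-cell from \<open>N : E \<rightarrow> P\<close> to \<open>M : F \<rightarrow> Q\<close> consists of \<open>sd : E \<rightarrow> F\<close>,
  \<open>sc : P \<rightarrow> Q\<close> and an isomorphism \<open>si : sc \<circ> N \<cong> M \<circ> sd\<close>.\<close>

record ('o, 'm, 'p, 'n) square =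
  sd :: "('o, 'm, 'o, 'm) ftor"
  sc :: "('p, 'n, 'p, 'n) ftor"
  si :: "'o \<Rightarrow> 'n"

definition squares ::
  "('o, 'm, 'p, 'n) arrow \<Rightarrow> ('o, 'm, 'p, 'n) arrow \<Rightarrow> ('o, 'm, 'p, 'n) square set" where
  "squares a b = {s. sd s \<in> functors (adom a) (adom b) \<and> sc s \<in> functors (acod a) (acod b) \<and>
     is_iso (functor_category (adom a) (acod b))
       (ftor_comp (adom a) (sc s) (afun a)) (ftor_comp (adom a) (afun b) (sd s)) (si s)}"

definition square_id :: "('o, 'm, 'p, 'n) arrow \<Rightarrow> ('o, 'm, 'p, 'n) square" where
  "square_id a = \<lparr>sd = id_ftor (adom a), sc = id_ftor (acod a),
     si = (\<lambda>x\<in>Ob (adom a). idn (acod a) (fo (afun a) x))\<rparr>"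

definition square_comp ::
  "('o, 'm, 'p, 'n) arrow \<Rightarrow> ('o, 'm, 'p, 'n) arrow \<Rightarrow> ('o, 'm, 'p, 'n) arrow
     \<Rightarrow> ('o, 'm, 'p, 'n) square \<Rightarrow> ('o, 'm, 'p, 'n) square \<Rightarrow> ('o, 'm, 'p, 'n) square" where
  "square_comp a b c t s = \<lparr>sd = ftor_comp (adom a) (sd t) (sd s), sc = ftor_comp (acod a) (sc t) (sc s),
     si = (\<lambda>x\<in>Ob (adom a).
       cmp (acod c)
         (fo (sc t) (fo (sc s) (fo (afun a) x)))
         (fo (sc t) (fo (afun b) (fo (sd s) x)))
         (fo (afun c) (fo (sd t) (fo (sd s) x)))
         (si t (fo (sd s) x))
         (fa (sc t) (fo (sc s) (fo (afun a) x)) (fo (afun b) (fo (sd s) x)) (si s x)))\<rparr>"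

definition square_2cells ::
  "('o, 'm, 'p, 'n) arrow \<Rightarrow> ('o, 'm, 'p, 'n) arrow
     \<Rightarrow> ('o, 'm, 'p, 'n) square \<Rightarrow> ('o, 'm, 'p, 'n) square \<Rightarrow> (('o \<Rightarrow> 'm) \<times> ('p \<Rightarrow> 'n)) set" where
  "square_2cells a b s t = {(\<alpha>, \<alpha>').
     \<alpha> \<in> nats (adom a) (adom b) (sd s) (sd t) \<and> \<alpha>' \<in> nats (acod a) (acod b) (sc s) (sc t) \<and>
     (\<forall>x\<in>Ob (adom a).
        cmp (acod b)
          (fo (sc s) (fo (afun a) x)) (fo (afun b) (fo (sd s) x)) (fo (afun b) (fo (sd t) x))
          (fa (afun b) (fo (sd s) x) (fo (sd t) x) (\<alpha> x)) (si s x) =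
        cmp (acod b)
          (fo (sc s) (fo (afun a) x)) (fo (sc t) (fo (afun a) x)) (fo (afun b) (fo (sd t) x))
          (si t x) (\<alpha>' (fo (afun a) x)))}"

definition CAT2 :: "'u itself \<Rightarrow>
    (('o, 'm, 'p, 'n) arrow, ('o, 'm, 'p, 'n) square, ('o \<Rightarrow> 'm) \<times> ('p \<Rightarrow> 'n)) two_cat" where
  "CAT2 U = \<lparr>
     Ob0 = {a. category (adom a) \<and> locally_small U (adom a) \<and>
               category (acod a) \<and> locally_small U (acod a) \<and> afun a \<in> functors (adom a) (acod a)},
     HomC = (\<lambda>a b. \<lparr>Ob = squares a b, Hom = square_2cells a b,
       idn = (\<lambda>s. (idn (functor_category (adom a) (adom b)) (sd s),
                   idn (functor_category (acod a) (acod b)) (sc s))),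
       cmp = (\<lambda>s t r q p.
         (cmp (functor_category (adom a) (adom b)) (sd s) (sd t) (sd r) (fst q) (fst p),
          cmp (functor_category (acod a) (acod b)) (sc s) (sc t) (sc r) (snd q) (snd p)))\<rparr>),
     id1 = square_id,
     comp1 = square_comp,
     comp2 = (\<lambda>a b c t t' s s' q p.
       (nat_hcomp (adom a) (adom c) (sd t) (sd t') (sd s) (sd s') (fst q) (fst p),
        nat_hcomp (acod a) (acod c) (sc t) (sc t') (sc s) (sc s') (snd q) (snd p)))\<rparr>"


section \<open>Categories with arities\<close>

record ('a, 'o, 'u) cwa =
  ari :: "('a, 'u) category"
  amb :: "('o, 'u) category"
  inc :: "('a, 'u, 'o, 'u) ftor"

text \<open>Being a full subcategory is expressed by the inclusion being fully faithful and injective on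
  objects; density is full faithfulness of the nerve.\<close>

definition is_cwa :: "('a, 'o, 'u) cwa \<Rightarrow> bool" where
  "is_cwa X \<longleftrightarrow>
     category (amb X) \<and> locally_small TYPE('u) (amb X) \<and>
     small_category TYPE('u) (ari X) \<and>
     inc X \<in> functors (ari X) (amb X) \<and>
     full_faithful (ari X) (amb X) (inc X) \<and> inj_on (fo (inc X)) (Ob (ari X)) \<and>
     full_faithful (amb X) (psh (ari X)) (nerve (ari X) (amb X) (inc X))"

type_synonym ('a, 'o, 'u) nerve_arrow =
  "('o, 'u, ('a, 'u) presheaf, ('a, 'u) presheaf_mor) arrow"
type_synonym ('a, 'o, 'u) nerve_square =
  "('o, 'u, ('a, 'u) presheaf, ('a, 'u) presheaf_mor) square"

definition nerve_of :: "('a, 'o, 'u) cwa \<Rightarrow> ('a, 'o, 'u) nerve_arrow" where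
  "nerve_of X = \<lparr>adom = amb X, acod = psh (ari X), afun = nerve (ari X) (amb X) (inc X)\<rparr>"

text \<open>The squares \<open>(K, Kbar, \<phi>)\<close> in which \<open>Kbar\<close> is a left Kan extension, along the Yoneda
  embedding, of \<open>K\<close> restricted to arities and followed by the nerve. Such a square is what it
  takes for \<open>K\<close> to respect arities.\<close>

definition arity_squares ::
  "('a, 'o, 'u) cwa \<Rightarrow> ('a, 'o, 'u) cwa \<Rightarrow> ('a, 'o, 'u) nerve_square set" where
  "arity_squares X Y = {s \<in> squares (nerve_of X) (nerve_of Y).
     \<exists>\<eta>. is_lan (ari X) (psh (ari X)) (psh (ari Y)) (yoneda (ari X))
       (ftor_comp (ari X) (nerve (ari Y) (amb Y) (inc Y)) (ftor_comp (ari X) (sd s) (inc X))) (sc s) \<eta>}"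

definition arities_respecting ::
  "('a, 'o, 'u) cwa \<Rightarrow> ('a, 'o, 'u) cwa \<Rightarrow> ('o, 'u, 'o, 'u) ftor set" where
  "arities_respecting X Y = {K \<in> functors (amb X) (amb Y). \<exists>s\<in>arity_squares X Y. sd s = K}"

definition CwA :: "(('a, 'o, 'u) cwa, ('o, 'u, 'o, 'u) ftor, 'o \<Rightarrow> 'u) two_cat" where
  "CwA = \<lparr>Ob0 = {X. is_cwa X},
     HomC = (\<lambda>X Y. \<lparr>Ob = arities_respecting X Y, Hom = nats (amb X) (amb Y),
       idn = idn (functor_category (amb X) (amb Y)),
       cmp = cmp (functor_category (amb X) (amb Y))\<rparr>),
     id1 = (\<lambda>X. id_ftor (amb X)),
     comp1 = (\<lambda>X Y Z L K. ftor_comp (amb X) L K),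
     comp2 = (\<lambda>X Y Z L L' K K' \<beta> \<alpha>. nat_hcomp (amb X) (amb Z) L L' K K' \<beta> \<alpha>)\<rparr>"

text \<open>
  A Kan extension and the isomorphism filling the square are determined by \<open>K\<close> only up to
  isomorphism, so sending \<open>K\<close> to its square is a strict 2-functor only relative to choices of these
  data. There are two ways to have the choices: let \<open>\<Phi>\<close> be a strict 2-functor
  on \<open>CwA\<close> that makes them (\<open>is_nerve_two_functor\<close>), or let the 1-cells carry them (\<open>CwAsq\<close>).
  In both cases the 2-cells are all natural transformations \<open>K \<Rightarrow> L\<close>.
\<close>

definition is_nerve_two_functor ::
  "(('a, 'o, 'u) cwa, ('o, 'u, 'o, 'u) ftor, 'o \<Rightarrow> 'u, ('a, 'o, 'u) nerve_arrow,
    ('a, 'o, 'u) nerve_square, ('o \<Rightarrow> 'u) \<times> (('a, 'u) presheaf \<Rightarrow> ('a, 'u) presheaf_mor)) two_ftor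
    \<Rightarrow> bool" where
  "is_nerve_two_functor \<Phi> \<longleftrightarrow> two_functor CwA (CAT2 TYPE('u)) \<Phi> \<and>
     (\<forall>X\<in>Ob0 CwA. F0 \<Phi> X = nerve_of X) \<and>
     (\<forall>X\<in>Ob0 CwA. \<forall>Y\<in>Ob0 CwA. \<forall>K\<in>cells1 CwA X Y.
        fo (FH \<Phi> X Y) K \<in> arity_squares X Y \<and> sd (fo (FH \<Phi> X Y) K) = K) \<and>
     (\<forall>X\<in>Ob0 CwA. \<forall>Y\<in>Ob0 CwA. \<forall>K\<in>cells1 CwA X Y. \<forall>L\<in>cells1 CwA X Y. \<forall>\<alpha>\<in>cells2 CwA X Y K L.
        fst (fa (FH \<Phi> X Y) K L \<alpha>) = \<alpha>)"

definition CwAsq :: "(('a, 'o, 'u) cwa, ('a, 'o, 'u) nerve_square, 'o \<Rightarrow> 'u) two_cat" where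
  "CwAsq = \<lparr>Ob0 = {X. is_cwa X},
     HomC = (\<lambda>X Y. \<lparr>Ob = arity_squares X Y, Hom = (\<lambda>s t. nats (amb X) (amb Y) (sd s) (sd t)),
       idn = (\<lambda>s. idn (functor_category (amb X) (amb Y)) (sd s)),
       cmp = (\<lambda>s t r. cmp (functor_category (amb X) (amb Y)) (sd s) (sd t) (sd r))\<rparr>),
     id1 = (\<lambda>X. square_id (nerve_of X)),
     comp1 = (\<lambda>X Y Z t s. square_comp (nerve_of X) (nerve_of Y) (nerve_of Z) t s),
     comp2 = (\<lambda>X Y Z t t' s s' \<beta> \<alpha>. nat_hcomp (amb X) (amb Z) (sd t) (sd t') (sd s) (sd s') \<beta> \<alpha>)\<rparr>"

text \<open>On 2-cells, \<open>\<alpha> : K \<Rightarrow> L\<close> is sent to \<open>\<alpha>\<close> together with the unique transformation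
  \<open>Kbar \<Rightarrow> Lbar\<close> compatible with it.\<close>

definition nerve_two_functor ::
  "(('a, 'o, 'u) cwa, ('a, 'o, 'u) nerve_square, 'o \<Rightarrow> 'u, ('a, 'o, 'u) nerve_arrow,
    ('a, 'o, 'u) nerve_square, ('o \<Rightarrow> 'u) \<times> (('a, 'u) presheaf \<Rightarrow> ('a, 'u) presheaf_mor)) two_ftor"
  where
  "nerve_two_functor = \<lparr>F0 = nerve_of,
     FH = (\<lambda>X Y. mk_ftor (HomC CwAsq X Y) (\<lambda>s. s)
       (\<lambda>s t \<alpha>. (\<alpha>, THE \<alpha>'. (\<alpha>, \<alpha>') \<in> square_2cells (nerve_of X) (nerve_of Y) s t)))\<rparr>"

end

theory Submission
  imports Defs
begin

text \<open>
  The first component of a 2-cell between squares of nerves determines the second one, because a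
  presheaf is a colimit of representables and the second components of arity squares preserve these
  colimits; so the 2-functor is fully faithful on 2-cells. It therefore reflects a limit as soon as
  a square \<open>h\<close> into the limit all of whose composites with the projections respect arities respects
  arities itself. Let \<open>G\<close> be the presheaf component of \<open>h\<close>, and let \<open>\<pi>\<close> range over those of the
  projections. The \<open>\<pi>\<close> and the \<open>\<pi> \<circ> G\<close> are cocontinuous, and the \<open>\<pi>\<close> are jointly conservative:
  test the limit against the arrow from the empty to the terminal category. Hence the comparison
  maps from the colimits defining the left Kan extension of \<open>G \<circ> y\<close> to the values of \<open>G\<close> are
  invertible, as every \<open>\<pi>\<close> makes them so, and \<open>G\<close> is cocontinuous.
\<close>

section \<open>Categories, functors, transformations\<close>

text \<open>Respecting arities is defined by the bare universal property of a Kan extension, which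
  by itself says nothing about colimits. The proof works with the colimit formula; the two agree
  because presheaf categories have the colimits in question (\<open>colim_exists\<close>), so that a
  pointwise extension exists and every other one is isomorphic to it (\<open>is_lan_ptwise\<close>).
  As \<open>y a\<close> is isomorphic to the nerve of \<open>I a\<close>, the arity condition on a
  square becomes a property of its second component alone (\<open>arity_squares_iff\<close>), one
  that composes and can be tested after projecting. The property \<open>cocont\<close> concerns only
  the canonical presentation of presheaves by representables; that other diagrams, such as
  \<open>G \<circ> y\<close>, are covered too comes from right adjoints
  (\<open>cocont_adjoint\<close>). The values of a presheaf are sets of elements of
  \<open>'u\<close>, so quotients and hom-sets of other types have to be coded into
  \<open>'u\<close>. For a 2-functor that chooses the squares, a square that respects arities need
  not be the chosen one; uniqueness of mediating 1-cells in \<open>CAT2\<close> settles this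
  (\<open>reflects_CwA\<close>).\<close>

lemma cat_id: "category C \<Longrightarrow> x \<in> Ob C \<Longrightarrow> idn C x \<in> Hom C x x"
  by (simp add: category_def)

lemma cat_cmp:
  "\<lbrakk>category C; x \<in> Ob C; y \<in> Ob C; z \<in> Ob C; f \<in> Hom C x y;
      g \<in> Hom C y z\<rbrakk> \<Longrightarrow>
      cmp C x y z g f \<in> Hom C x z"
  by (simp add: category_def)

lemma cat_idl: "\<lbrakk>category C; x \<in> Ob C; y \<in> Ob C; f \<in> Hom C x y\<rbrakk> \<Longrightarrow>
      cmp C x y y (idn C y) f = f"
  and cat_idr: "\<lbrakk>category C; x \<in> Ob C; y \<in> Ob C; f \<in> Hom C x y\<rbrakk> \<Longrightarrow>
      cmp C x x y f (idn C x) = f"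
  by (simp_all add: category_def)

lemma cat_assoc:
  "\<lbrakk>category C; w \<in> Ob C; x \<in> Ob C; y \<in> Ob C; z \<in> Ob C; f \<in> Hom C w x;
      g \<in> Hom C x y; h \<in> Hom C y z\<rbrakk> \<Longrightarrow>
      cmp C w x z (cmp C x y z h g) f = cmp C w y z h (cmp C w x y g f)"
  by (simp add: category_def)

lemma categoryI:
  assumes "\<And>x. x \<in> Ob C \<Longrightarrow> idn C x \<in> Hom C x x"
    and "\<And>x y z f g. \<lbrakk>x \<in> Ob C; y \<in> Ob C; z \<in> Ob C; f \<in> Hom C x y; g \<in> Hom C y z\<rbrakk> \<Longrightarrow>
      cmp C x y z g f \<in> Hom C x z"
    and "\<And>x y f. \<lbrakk>x \<in> Ob C; y \<in> Ob C; f \<in> Hom C x y\<rbrakk> \<Longrightarrow>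
      cmp C x y y (idn C y) f = f"
    and "\<And>x y f. \<lbrakk>x \<in> Ob C; y \<in> Ob C; f \<in> Hom C x y\<rbrakk> \<Longrightarrow>
      cmp C x x y f (idn C x) = f"
    and "\<And>w x y z f g h. \<lbrakk>w \<in> Ob C; x \<in> Ob C; y \<in> Ob C; z \<in> Ob C; f \<in> Hom C w x;
      g \<in> Hom C x y; h \<in> Hom C y z\<rbrakk> \<Longrightarrow>
      cmp C w x z (cmp C x y z h g) f = cmp C w y z h (cmp C w x y g f)"
  shows "category C"
  by (simp add: category_def assms)

section \<open>Functors as extensional records\<close>

lemma fo_mk_ftor [simp]: "x \<in> Ob C \<Longrightarrow> fo (mk_ftor C F M) x = F x"
  by (simp add: mk_ftor_def)

lemma fa_mk_ftor [simp]:
  "\<lbrakk>x \<in> Ob C; y \<in> Ob C; f \<in> Hom C x y\<rbrakk> \<Longrightarrow>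
      fa (mk_ftor C F M) x y f = M x y f"
  by (simp add: mk_ftor_def)

lemma ftor_ob: "F \<in> functors C D \<Longrightarrow> x \<in> Ob C \<Longrightarrow> fo F x \<in> Ob D"
  by (simp add: functors_def)

lemma ftor_hom: "\<lbrakk>F \<in> functors C D; x \<in> Ob C; y \<in> Ob C; f \<in> Hom C x y\<rbrakk> \<Longrightarrow>
      fa F x y f \<in> Hom D (fo F x) (fo F y)"
  by (simp add: functors_def)

lemmas ftor_rules = ftor_ob ftor_hom

lemma ftor_id: "F \<in> functors C D \<Longrightarrow> x \<in> Ob C \<Longrightarrow> fa F x x (idn C x) = idn D (fo F x)"
  by (simp add: functors_def)

lemma ftor_cmp:
  "\<lbrakk>F \<in> functors C D; x \<in> Ob C; y \<in> Ob C; z \<in> Ob C; f \<in> Hom C x y;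
      g \<in> Hom C y z\<rbrakk> \<Longrightarrow>
      fa F x z (cmp C x y z g f) = cmp D (fo F x) (fo F y) (fo F z) (fa F y z g) (fa F x y f)"
  by (simp add: functors_def)

lemma ftor_mk: "F \<in> functors C D \<Longrightarrow> F = mk_ftor C (fo F) (fa F)"
  by (simp add: functors_def)

text \<open>\<open>mk_ftor\<close> erases everything outside \<open>C\<close>, so agreement inside
  \<open>C\<close> is equality of records. Equalities between functors come down to this.\<close>

lemma mk_ftor_cong:
  assumes "\<And>x. x \<in> Ob C \<Longrightarrow> F x = F' x"
    and "\<And>x y f. \<lbrakk>x \<in> Ob C; y \<in> Ob C; f \<in> Hom C x y\<rbrakk> \<Longrightarrow>
      M x y f = M' x y f"
  shows "mk_ftor C F M = mk_ftor C F' M'"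
  using assms by (auto simp: mk_ftor_def restrict_def fun_eq_iff)

lemma mk_ftor_idem [simp]: "mk_ftor C (fo (mk_ftor C F M)) (fa (mk_ftor C F M)) = mk_ftor C F M"
  by (rule mk_ftor_cong) auto

text \<open>The codomains may differ, because the record of a functor does not mention its codomain;
  the normal form over \<open>C\<close> decides.\<close>

lemma ftor_eqI:
  assumes "F \<in> functors C D" "G \<in> functors C D'"
    and "\<And>x. x \<in> Ob C \<Longrightarrow> fo F x = fo G x"
    and "\<And>x y f. \<lbrakk>x \<in> Ob C; y \<in> Ob C; f \<in> Hom C x y\<rbrakk> \<Longrightarrow>
      fa F x y f = fa G x y f"
  shows "F = G"
  by (subst ftor_mk[OF assms(1)], subst ftor_mk[OF assms(2)], rule mk_ftor_cong) (use assms in auto)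

lemma mk_ftor_in_functors:
  assumes "category C"
    and "\<And>x. x \<in> Ob C \<Longrightarrow> F x \<in> Ob D"
    and "\<And>x y f. \<lbrakk>x \<in> Ob C; y \<in> Ob C; f \<in> Hom C x y\<rbrakk> \<Longrightarrow>
      M x y f \<in> Hom D (F x) (F y)"
    and "\<And>x. x \<in> Ob C \<Longrightarrow> M x x (idn C x) = idn D (F x)"
    and "\<And>x y z f g. \<lbrakk>x \<in> Ob C; y \<in> Ob C; z \<in> Ob C; f \<in> Hom C x y; g \<in> Hom C y z\<rbrakk> \<Longrightarrow>
      M x z (cmp C x y z g f) = cmp D (F x) (F y) (F z) (M y z g) (M x y f)"
  shows "mk_ftor C F M \<in> functors C D"
  unfolding functors_def using assms by (simp add: cat_id cat_cmp)

lemma mk_ftor_eqI: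
  assumes "G \<in> functors C D"
    and "\<And>x. x \<in> Ob C \<Longrightarrow> F x = fo G x"
    and "\<And>x y f. \<lbrakk>x \<in> Ob C; y \<in> Ob C; f \<in> Hom C x y\<rbrakk> \<Longrightarrow>
      M x y f = fa G x y f"
  shows "mk_ftor C F M = G"
  by (subst ftor_mk[OF assms(1)], rule mk_ftor_cong) (use assms in auto)

lemma fo_ftor_comp [simp]: "x \<in> Ob C \<Longrightarrow> fo (ftor_comp C G F) x = fo G (fo F x)"
  by (simp add: ftor_comp_def)

lemma fa_ftor_comp [simp]:
  "\<lbrakk>x \<in> Ob C; y \<in> Ob C; f \<in> Hom C x y\<rbrakk> \<Longrightarrow>
      fa (ftor_comp C G F) x y f = fa G (fo F x) (fo F y) (fa F x y f)"
  by (simp add: ftor_comp_def)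

lemma fo_id_ftor [simp]: "x \<in> Ob C \<Longrightarrow> fo (id_ftor C) x = x"
  by (simp add: id_ftor_def)

lemma fa_id_ftor [simp]: "\<lbrakk>x \<in> Ob C; y \<in> Ob C; f \<in> Hom C x y\<rbrakk> \<Longrightarrow>
      fa (id_ftor C) x y f = f"
  by (simp add: id_ftor_def)

lemma id_ftor_in: "category C \<Longrightarrow> id_ftor C \<in> functors C C"
  unfolding id_ftor_def by (rule mk_ftor_in_functors) (auto simp: cat_id)

lemma ftor_comp_in:
  assumes "category C" "F \<in> functors C D" "G \<in> functors D E"
  shows "ftor_comp C G F \<in> functors C E"
  unfolding ftor_comp_def
  by (rule mk_ftor_in_functors)
    (use assms in \<open>auto simp: ftor_ob[OF assms(2)] ftor_ob[OF assms(3)] ftor_hom[OF assms(2)]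
      ftor_hom[OF assms(3)] ftor_id[OF assms(2)] ftor_id[OF assms(3)] ftor_cmp[OF assms(2)]
      ftor_cmp[OF assms(3)]\<close>)

lemma ftor_comp_assoc:
  assumes "F \<in> functors C D"
  shows "ftor_comp C (ftor_comp D H G) F = ftor_comp C H (ftor_comp C G F)"
  unfolding ftor_comp_def[of C]
  by (rule mk_ftor_cong) (auto simp: ftor_rules[OF assms])

lemma ftor_comp_idl: "F \<in> functors C D \<Longrightarrow> ftor_comp C (id_ftor D) F = F"
  unfolding ftor_comp_def by (rule mk_ftor_eqI) (auto simp: ftor_ob ftor_hom)

lemma ftor_comp_idr: "F \<in> functors C D \<Longrightarrow> ftor_comp C F (id_ftor C) = F"
  unfolding ftor_comp_def by (rule mk_ftor_eqI) (auto simp: ftor_ob ftor_hom)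

section \<open>Natural transformations and functor categories\<close>

lemma nat_hom: "\<alpha> \<in> nats C D F G \<Longrightarrow> x \<in> Ob C \<Longrightarrow> \<alpha> x \<in> Hom D (fo F x) (fo G x)"
  by (simp add: nats_def)

lemma nat_natural:
  "\<lbrakk>\<alpha> \<in> nats C D F G; x \<in> Ob C; y \<in> Ob C; f \<in> Hom C x y\<rbrakk> \<Longrightarrow>
      cmp D (fo F x) (fo F y) (fo G y) (\<alpha> y) (fa F x y f) =
        cmp D (fo F x) (fo G x) (fo G y) (fa G x y f) (\<alpha> x)"
  by (simp add: nats_def)

lemma nat_ext: "\<alpha> \<in> nats C D F G \<Longrightarrow> \<alpha> \<in> extensional (Ob C)"
  by (simp add: nats_def)

lemma nat_eqI:
  "\<lbrakk>\<alpha> \<in> nats C D F G; \<beta> \<in> nats C D' F' G';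
      (\<And>x. x \<in> Ob C \<Longrightarrow> \<alpha> x = \<beta> x)\<rbrakk> \<Longrightarrow>
      \<alpha> = \<beta>"
  by (meson extensionalityI nat_ext)

lemma natsI:
  assumes "\<alpha> \<in> extensional (Ob C)"
    and "\<And>x. x \<in> Ob C \<Longrightarrow> \<alpha> x \<in> Hom D (fo F x) (fo G x)"
    and "\<And>x y f. \<lbrakk>x \<in> Ob C; y \<in> Ob C; f \<in> Hom C x y\<rbrakk> \<Longrightarrow>
      cmp D (fo F x) (fo F y) (fo G y) (\<alpha> y) (fa F x y f) =
        cmp D (fo F x) (fo G x) (fo G y) (fa G x y f) (\<alpha> x)"
  shows "\<alpha> \<in> nats C D F G"
  using assms by (simp add: nats_def)

lemma functor_category_simps [simp]:
  "Ob (functor_category C D) = functors C D"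
  "Hom (functor_category C D) = nats C D"
  "x \<in> Ob C \<Longrightarrow> idn (functor_category C D) F x = idn D (fo F x)"
  "x \<in> Ob C \<Longrightarrow> cmp (functor_category C D) F G H \<beta> \<alpha> x =
     cmp D (fo F x) (fo G x) (fo H x) (\<beta> x) (\<alpha> x)"
  by (simp_all add: functor_category_def)

lemma idn_nat:
  assumes "category D" "F \<in> functors C D"
  shows "idn (functor_category C D) F \<in> nats C D F F"
  by (rule natsI)
    (use assms in \<open>auto simp: functor_category_def cat_id cat_idl cat_idr ftor_rules[OF assms(2)]\<close>)

lemma cmp_nat:
  assumes D: "category D" and F: "F \<in> functors C D" and G: "G \<in> functors C D" and H: "H \<in> functors C D"
    and a: "\<alpha> \<in> nats C D F G" and b: "\<beta> \<in> nats C D G H"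
  shows "cmp (functor_category C D) F G H \<beta> \<alpha> \<in> nats C D F H"
proof (rule natsI)
  note [simp] = ftor_ob[OF F] ftor_ob[OF G] ftor_ob[OF H] ftor_hom[OF F] ftor_hom[OF G] ftor_hom[OF H]
    nat_hom[OF a] nat_hom[OF b] D
  show "cmp (functor_category C D) F G H \<beta> \<alpha> \<in> extensional (Ob C)"
    by (simp add: functor_category_def)
  show "cmp (functor_category C D) F G H \<beta> \<alpha> x \<in> Hom D (fo F x) (fo H x)" if "x \<in> Ob C" for x
    using that by (simp add: cat_cmp)
  fix x y f assume [simp]: "x \<in> Ob C" "y \<in> Ob C" "f \<in> Hom C x y"
  show "cmp D (fo F x) (fo F y) (fo H y) (cmp (functor_category C D) F G H \<beta> \<alpha> y) (fa F x y f) =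
        cmp D (fo F x) (fo H x) (fo H y) (fa H x y f) (cmp (functor_category C D) F G H \<beta> \<alpha> x)"
    by (simp add: cat_assoc nat_natural[OF a])
      (simp add: cat_assoc[symmetric] nat_natural[OF b])
qed

lemma category_functor_category: "category D \<Longrightarrow> category (functor_category C D)"
proof (rule categoryI, goal_cases)
  case (3 F G \<alpha>)
  then have "cmp (functor_category C D) F G G (idn (functor_category C D) G) \<alpha> \<in> nats C D F G"
    by (intro cmp_nat) (auto intro: idn_nat)
  from nat_eqI[OF this, of \<alpha>] 3 show ?case by (simp add: cat_idl ftor_ob nat_hom)
next
  case (4 F G \<alpha>)
  then have "cmp (functor_category C D) F F G \<alpha> (idn (functor_category C D) F) \<in> nats C D F G"
    by (intro cmp_nat) (auto intro: idn_nat)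
  from nat_eqI[OF this, of \<alpha>] 4 show ?case by (simp add: cat_idr ftor_ob nat_hom)
next
  case (5 F G H K \<alpha> \<beta> \<gamma>)
  note hs = 5
  let ?c = "cmp (functor_category C D)"
  have "?c F G K (?c G H K \<gamma> \<beta>) \<alpha> \<in> nats C D F K" "?c F H K \<gamma> (?c F G H \<beta> \<alpha>) \<in> nats C D F K"
    using hs by (auto intro!: cmp_nat)
  then show ?case
    by (rule nat_eqI) (use hs in \<open>simp add: cat_assoc ftor_ob nat_hom\<close>)
qed (auto intro: idn_nat cmp_nat)

subsection \<open>Isomorphisms\<close>

text \<open>Hom-sets may overlap, so the endpoints have to be arguments. In a category the inverse
  of an isomorphism is unique, and the choice has no effect.\<close>

definition cinv :: "('o, 'm) category \<Rightarrow> 'o \<Rightarrow> 'o \<Rightarrow> 'm \<Rightarrow> 'm" where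
  "cinv C x y f = (SOME g. g \<in> Hom C y x \<and> cmp C x y x g f = idn C x \<and> cmp C y x y f g = idn C y)"

lemma iso_hom: "is_iso C x y f \<Longrightarrow> f \<in> Hom C x y"
  by (simp add: is_iso_def)

lemma cinv:
  assumes "is_iso C x y f"
  shows cinv_hom: "cinv C x y f \<in> Hom C y x"
    and cinv_l: "cmp C x y x (cinv C x y f) f = idn C x"
    and cinv_r: "cmp C y x y f (cinv C x y f) = idn C y"
proof -
  have "\<exists>g. g \<in> Hom C y x \<and> cmp C x y x g f = idn C x \<and> cmp C y x y f g = idn C y"
    using assms by (auto simp: is_iso_def)
  note * = someI_ex[OF this, folded cinv_def]
  show "cinv C x y f \<in> Hom C y x"
    "cmp C x y x (cinv C x y f) f = idn C x" "cmp C y x y f (cinv C x y f) = idn C y"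
    using * by auto
qed

lemma is_isoI:
  "\<lbrakk>f \<in> Hom C x y; g \<in> Hom C y x; cmp C x y x g f = idn C x;
      cmp C y x y f g = idn C y\<rbrakk> \<Longrightarrow>
      is_iso C x y f"
  by (auto simp: is_iso_def)

lemma cinv_iso: "is_iso C x y f \<Longrightarrow> is_iso C y x (cinv C x y f)"
  by (rule is_isoI[of _ _ _ _ f]) (auto simp: cinv iso_hom)

lemma cinv_l_cancel:
  assumes "category C" "x \<in> Ob C" "y \<in> Ob C" "z \<in> Ob C" "is_iso C x y f" "g \<in> Hom C z x"
  shows "cmp C z y x (cinv C x y f) (cmp C z x y f g) = g"
proof -
  have "cmp C z y x (cinv C x y f) (cmp C z x y f g) = cmp C z x x (cmp C x y x (cinv C x y f) f) g"
    using assms by (simp add: cat_assoc iso_hom cinv_hom)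
  then show ?thesis using assms by (simp add: cinv_l cat_idl)
qed

lemma cinv_r_cancel:
  assumes "category C" "x \<in> Ob C" "y \<in> Ob C" "z \<in> Ob C" "is_iso C x y f" "g \<in> Hom C z y"
  shows "cmp C z x y f (cmp C z y x (cinv C x y f) g) = g"
proof -
  have "cmp C z x y f (cmp C z y x (cinv C x y f) g) = cmp C z y y (cmp C y x y f (cinv C x y f)) g"
    using assms by (simp add: cat_assoc iso_hom cinv_hom)
  then show ?thesis using assms by (simp add: cinv_r cat_idl)
qed

lemma iso_cancel_l:
  assumes "category C" "x \<in> Ob C" "y \<in> Ob C" "z \<in> Ob C" "is_iso C x y f" "g \<in> Hom C z x" "h \<in> Hom C z x"
    and "cmp C z x y f g = cmp C z x y f h"
  shows "g = h"
  by (metis assms cinv_l_cancel)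

lemma iso_cancel_r:
  assumes "category C" "x \<in> Ob C" "y \<in> Ob C" "z \<in> Ob C" "is_iso C x y f" "g \<in> Hom C y z" "h \<in> Hom C y z"
    and "cmp C x y z g f = cmp C x y z h f"
  shows "g = h"
proof -
  have "k = cmp C y x z (cmp C x y z k f) (cinv C x y f)" if "k \<in> Hom C y z" for k
    using assms that by (simp add: cat_assoc iso_hom cinv_hom cinv_r cat_idr)
  then show ?thesis using assms(6-8) by metis
qed

lemma idn_iso: "category C \<Longrightarrow> x \<in> Ob C \<Longrightarrow> is_iso C x x (idn C x)"
  by (rule is_isoI[of _ _ _ _ "idn C x"]) (auto simp: cat_id cat_idl)

lemma cmp_iso:
  assumes "category C" "x \<in> Ob C" "y \<in> Ob C" "z \<in> Ob C" "is_iso C x y f" "is_iso C y z g"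
  shows "is_iso C x z (cmp C x y z g f)"
  by (rule is_isoI[of _ _ _ _ "cmp C z y x (cinv C x y f) (cinv C y z g)"])
    (use assms in \<open>simp_all add: cat_cmp iso_hom cinv_hom cat_assoc cinv_l_cancel cinv_r_cancel
      cinv_l cinv_r\<close>)

lemma ftor_iso:
  assumes "F \<in> functors C D" "x \<in> Ob C" "y \<in> Ob C" "is_iso C x y f"
  shows "is_iso D (fo F x) (fo F y) (fa F x y f)"
  by (rule is_isoI[of _ _ _ _ "fa F y x (cinv C x y f)"])
    (use assms in \<open>simp_all add: ftor_hom iso_hom cinv ftor_cmp[symmetric] ftor_id\<close>)

text \<open>Precompose with \<open>\<alpha> x\<close> followed by its inverse, turn the square
  around by naturality of \<open>\<alpha>\<close>, and cancel at \<open>y\<close>.\<close>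

lemma cinv_nat:
  assumes D: "category D" and F: "F \<in> functors C D" and G: "G \<in> functors C D"
    and a: "\<alpha> \<in> nats C D F G" and i: "\<And>x. x \<in> Ob C \<Longrightarrow> is_iso D (fo F x) (fo G x) (\<alpha> x)"
  shows "(\<lambda>x\<in>Ob C. cinv D (fo F x) (fo G x) (\<alpha> x)) \<in> nats C D G F" (is "?b \<in> _")
proof (rule natsI)
  note [simp] = D ftor_ob[OF F] ftor_ob[OF G] ftor_hom[OF F] ftor_hom[OF G] nat_hom[OF a] cinv
  fix x y f assume [simp]: "x \<in> Ob C" "y \<in> Ob C" "f \<in> Hom C x y"
    have [simp]: "is_iso D (fo F x) (fo G x) (\<alpha> x)" "is_iso D (fo F y) (fo G y) (\<alpha> y)" using i by auto
    have "cmp D (fo G x) (fo G y) (fo F y) (?b y) (fa G x y f) =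
      cmp D (fo G x) (fo G y) (fo F y) (?b y)
        (cmp D (fo G x) (fo F x) (fo G y) (cmp D (fo F x) (fo G x) (fo G y) (fa G x y f) (\<alpha> x)) (?b x))"
      by (simp add: cat_assoc cat_idr)
    also have "\<dots> = cmp D (fo G x) (fo F x) (fo F y) (fa F x y f) (?b x)"
      by (simp add: nat_natural[OF a, symmetric] cat_assoc cinv_l_cancel cat_cmp)
    finally show "cmp D (fo G x) (fo G y) (fo F y) (?b y) (fa G x y f) =
      cmp D (fo G x) (fo F x) (fo F y) (fa F x y f) (?b x)" .
  qed (use i in \<open>auto simp: cinv\<close>)

text \<open>Fillers of squares are given as isomorphisms of a functor category but used
  componentwise. The way back rests on \<open>cinv_nat\<close>: the componentwise inverses form a
  transformation.\<close>

lemma nat_iso_iff: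
  assumes D: "category D" and F: "F \<in> functors C D" and G: "G \<in> functors C D"
  shows "is_iso (functor_category C D) F G \<alpha> \<longleftrightarrow>
    \<alpha> \<in> nats C D F G \<and> (\<forall>x\<in>Ob C. is_iso D (fo F x) (fo G x) (\<alpha> x))"
proof safe
  assume i: "is_iso (functor_category C D) F G \<alpha>"
  then show a: "\<alpha> \<in> nats C D F G" by (auto dest: iso_hom)
  fix x assume x: "x \<in> Ob C"
  let ?b = "cinv (functor_category C D) F G \<alpha>"
  have b: "?b \<in> nats C D G F" using cinv_hom[OF i] by simp
  show "is_iso D (fo F x) (fo G x) (\<alpha> x)"
    using x a b cinv_l[OF i, THEN fun_cong, of x] cinv_r[OF i, THEN fun_cong, of x]
    by (intro is_isoI[of _ _ _ _ "?b x"]) (auto simp: nat_hom)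
next
  assume a: "\<alpha> \<in> nats C D F G" and i: "\<forall>x\<in>Ob C. is_iso D (fo F x) (fo G x) (\<alpha> x)"
  let ?b = "\<lambda>x\<in>Ob C. cinv D (fo F x) (fo G x) (\<alpha> x)"
  note [simp] = D ftor_ob[OF F] ftor_ob[OF G] ftor_hom[OF F] ftor_hom[OF G] nat_hom[OF a] cinv
  have b: "?b \<in> nats C D G F" by (rule cinv_nat) (use D F G a i in auto)
  let ?c = "functor_category C D"
  have "cmp ?c F G F ?b \<alpha> = idn ?c F"
    by (rule nat_eqI[OF cmp_nat[OF D F G F a b] idn_nat[OF D F]]) (use i in simp)
  moreover have "cmp ?c G F G \<alpha> ?b = idn ?c G"
    by (rule nat_eqI[OF cmp_nat[OF D G F G b a] idn_nat[OF D G]]) (use i in simp)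
  ultimately show "is_iso ?c F G \<alpha>"
    using a b by (auto intro!: is_isoI)
qed


subsection \<open>Horizontal composition\<close>

lemma nat_hcomp_simp [simp]: "x \<in> Ob C \<Longrightarrow> nat_hcomp C E G G' F F' \<beta> \<alpha> x =
    cmp E (fo G (fo F x)) (fo G (fo F' x)) (fo G' (fo F' x))
       (\<beta> (fo F' x)) (fa G (fo F x) (fo F' x) (\<alpha> x))"
  by (simp add: nat_hcomp_def)

lemma nat_hcomp_ext [simp]: "nat_hcomp C E G G' F F' \<beta> \<alpha> \<in> extensional (Ob C)"
  by (simp add: nat_hcomp_def)

lemma hcomp_nat:
  assumes C: "category C" and E: "category E"
    and F: "F \<in> functors C D" "F' \<in> functors C D" and G: "G \<in> functors D E" "G' \<in> functors D E"
    and a: "\<alpha> \<in> nats C D F F'" and b: "\<beta> \<in> nats D E G G'"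
  shows "nat_hcomp C E G G' F F' \<beta> \<alpha> \<in> nats C E (ftor_comp C G F) (ftor_comp C G' F')"
proof (rule natsI)
  note [simp] = E F[THEN ftor_ob] F[THEN ftor_hom] G[THEN ftor_ob] G[THEN ftor_hom]
    nat_hom[OF a] nat_hom[OF b]
  show "nat_hcomp C E G G' F F' \<beta> \<alpha> x \<in> Hom E (fo (ftor_comp C G F) x) (fo (ftor_comp C G' F') x)"
    if [simp]: "x \<in> Ob C" for x
    by (simp add: cat_cmp)
  fix x y f assume [simp]: "x \<in> Ob C" "y \<in> Ob C" "f \<in> Hom C x y"
  show "cmp E (fo (ftor_comp C G F) x) (fo (ftor_comp C G F) y) (fo (ftor_comp C G' F') y)
            (nat_hcomp C E G G' F F' \<beta> \<alpha> y) (fa (ftor_comp C G F) x y f) =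
           cmp E (fo (ftor_comp C G F) x) (fo (ftor_comp C G' F') x) (fo (ftor_comp C G' F') y)
            (fa (ftor_comp C G' F') x y f) (nat_hcomp C E G G' F F' \<beta> \<alpha> x)"
    by (simp add: cat_assoc ftor_cmp[OF G(1), symmetric] nat_natural[OF a])
      (simp add: cat_assoc[symmetric] ftor_cmp[OF G(1)] nat_natural[OF b, of "fo F' x" "fo F' y" "fa F' x y f"])
qed simp

lemma hcomp_idn:
  assumes C: "category C" and E: "category E"
    and F: "F \<in> functors C D" and G: "G \<in> functors D E"
  shows "nat_hcomp C E G G F F (idn (functor_category D E) G) (idn (functor_category C D) F) =
    idn (functor_category C E) (ftor_comp C G F)"
  by (rule extensionalityI[of _ "Ob C"])
    (use assms in \<open>auto simp: functor_category_def ftor_ob[OF F] ftor_ob[OF G] cat_idl cat_id ftor_id[OF G]\<close>)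

lemma hcomp_interchange:
  assumes C: "category C" and D: "category D" and E: "category E"
    and F: "F \<in> functors C D" "F' \<in> functors C D" "F'' \<in> functors C D"
    and G: "G \<in> functors D E" "G' \<in> functors D E" "G'' \<in> functors D E"
    and a: "\<alpha> \<in> nats C D F F'" "\<alpha>' \<in> nats C D F' F''" and b: "\<beta> \<in> nats D E G G'" "\<beta>' \<in> nats D E G' G''"
  shows "nat_hcomp C E G G'' F F''
      (cmp (functor_category D E) G G' G'' \<beta>' \<beta>) (cmp (functor_category C D) F F' F'' \<alpha>' \<alpha>) =
    cmp (functor_category C E) (ftor_comp C G F) (ftor_comp C G' F') (ftor_comp C G'' F'')
      (nat_hcomp C E G' G'' F' F'' \<beta>' \<alpha>') (nat_hcomp C E G G' F F' \<beta> \<alpha>)"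
proof (rule extensionalityI[of _ "Ob C"])
  note [simp] = C D E F[THEN ftor_ob] F[THEN ftor_hom] G[THEN ftor_ob] G[THEN ftor_hom]
    a[THEN nat_hom] b[THEN nat_hom]
  fix x assume [simp]: "x \<in> Ob C"
  \<comment> \<open>The interchange law comes down to this: \<open>\<beta>\<close> slides past
    \<open>\<alpha>'\<close> by naturality. Fact \<open>2\<close> is the same with a further factor
    \<open>h\<close>, as it occurs in composites associated to the right.\<close>
  have 1: "cmp E (fo G (fo F' x)) (fo G' (fo F' x)) (fo G' (fo F'' x)) (fa G' (fo F' x) (fo F'' x) (\<alpha>' x)) (\<beta> (fo F' x))
    = cmp E (fo G (fo F' x)) (fo G (fo F'' x)) (fo G' (fo F'' x)) (\<beta> (fo F'' x)) (fa G (fo F' x) (fo F'' x) (\<alpha>' x))"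
    by (simp add: nat_natural[OF b(1)])
  have 2: "cmp E (fo G (fo F x)) (fo G' (fo F' x)) (fo G' (fo F'' x)) (fa G' (fo F' x) (fo F'' x) (\<alpha>' x))
     (cmp E (fo G (fo F x)) (fo G (fo F' x)) (fo G' (fo F' x)) (\<beta> (fo F' x)) h)
    = cmp E (fo G (fo F x)) (fo G (fo F'' x)) (fo G' (fo F'' x)) (\<beta> (fo F'' x))
       (cmp E (fo G (fo F x)) (fo G (fo F' x)) (fo G (fo F'' x)) (fa G (fo F' x) (fo F'' x) (\<alpha>' x)) h)"
    if "h \<in> Hom E (fo G (fo F x)) (fo G (fo F' x))" for h
    using that by (simp add: cat_assoc[symmetric] 1)
  show "nat_hcomp C E G G'' F F''
      (cmp (functor_category D E) G G' G'' \<beta>' \<beta>) (cmp (functor_category C D) F F' F'' \<alpha>' \<alpha>) x =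
    cmp (functor_category C E) (ftor_comp C G F) (ftor_comp C G' F') (ftor_comp C G'' F'')
      (nat_hcomp C E G' G'' F' F'' \<beta>' \<alpha>') (nat_hcomp C E G G' F F' \<beta> \<alpha>) x"
    by (simp add: cat_assoc ftor_cmp[OF G(1)] cat_cmp 2)
qed (auto simp: functor_category_def)

lemma hcomp_idl:
  assumes D: "category D" and F: "F \<in> functors C D" "F' \<in> functors C D" and a: "\<alpha> \<in> nats C D F F'"
  shows "nat_hcomp C D (id_ftor D) (id_ftor D) F F' (idn (functor_category D D) (id_ftor D)) \<alpha> = \<alpha>"
  by (rule extensionalityI[of _ "Ob C"])
    (use assms nat_ext[OF a] in \<open>auto simp: F[THEN ftor_ob] nat_hom[OF a] cat_idl\<close>)

lemma hcomp_idr: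
  assumes C: "category C" and D: "category D" and F: "F \<in> functors C D" "F' \<in> functors C D" and a: "\<alpha> \<in> nats C D F F'"
  shows "nat_hcomp C D F F' (id_ftor C) (id_ftor C) \<alpha> (idn (functor_category C C) (id_ftor C)) = \<alpha>"
  by (rule extensionalityI[of _ "Ob C"])
    (use assms nat_ext[OF a] in \<open>auto simp: F[THEN ftor_ob] nat_hom[OF a] cat_idr cat_id F[THEN ftor_id]\<close>)

lemma hcomp_assoc:
  assumes C: "category C" and D: "category D" and E: "category E" and K: "category K"
    and F: "F \<in> functors C D" "F' \<in> functors C D"
    and G: "G \<in> functors D E" "G' \<in> functors D E"
    and H: "H \<in> functors E K" "H' \<in> functors E K"
    and a: "\<alpha> \<in> nats C D F F'" and b: "\<beta> \<in> nats D E G G'" and c: "\<gamma> \<in> nats E K H H'"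
  shows "nat_hcomp C K (ftor_comp D H G) (ftor_comp D H' G') F F' (nat_hcomp D K H H' G G' \<gamma> \<beta>) \<alpha> =
    nat_hcomp C K H H' (ftor_comp C G F) (ftor_comp C G' F') \<gamma> (nat_hcomp C E G G' F F' \<beta> \<alpha>)"
proof (rule extensionalityI[of _ "Ob C"])
  note [simp] = C D E K F[THEN ftor_ob] F[THEN ftor_hom] G[THEN ftor_ob] G[THEN ftor_hom] H[THEN ftor_ob] H[THEN ftor_hom]
    a[THEN nat_hom] b[THEN nat_hom] c[THEN nat_hom]
  fix x assume [simp]: "x \<in> Ob C"
  show "nat_hcomp C K (ftor_comp D H G) (ftor_comp D H' G') F F' (nat_hcomp D K H H' G G' \<gamma> \<beta>) \<alpha> x =
    nat_hcomp C K H H' (ftor_comp C G F) (ftor_comp C G' F') \<gamma> (nat_hcomp C E G G' F F' \<beta> \<alpha>) x"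
    by (simp add: cat_assoc ftor_cmp[OF H(1)])
qed auto

text \<open>The simplifier associates composites to the right, and there the left side of
  \<open>cmp C x y z g f = r\<close> is no longer a subterm once something precedes
  \<open>f\<close>. Used as \<open>[THEN cat_reassoc]\<close>, the lemma supplies the equation with
  that extra factor \<open>h\<close>.\<close>

lemma cat_reassoc:
  assumes "cmp C x y z g f = r"
    and "category C" "w \<in> Ob C" "x \<in> Ob C" "y \<in> Ob C" "z \<in> Ob C"
    and "h \<in> Hom C w x" "f \<in> Hom C x y" "g \<in> Hom C y z"
  shows "cmp C w y z g (cmp C w x y f h) = cmp C w x z r h"
  using assms by (simp flip: cat_assoc)

section \<open>2-categories\<close>

lemmas two_category_conjs = two_category_def[THEN iffD1, THEN conjunct1]
  two_category_def[THEN iffD1, THEN conjunct2]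

lemmas tc_cat = two_category_conjs(1)[rule_format]
  and tc_id1 = two_category_conjs(2)[THEN conjunct1, rule_format]
  and tc_comp1 = two_category_conjs(2)[THEN conjunct2, THEN conjunct1, rule_format, THEN conjunct1]
  and tc_comp2_id = two_category_conjs(2)[THEN conjunct2, THEN conjunct1, rule_format, THEN conjunct2]
  and tc_comp2 = two_category_conjs(2)[THEN conjunct2, THEN conjunct2, THEN conjunct1, rule_format]
  and tc_interchange =
    two_category_conjs(2)[THEN conjunct2, THEN conjunct2, THEN conjunct2, THEN conjunct1, rule_format]
  and tc_assoc1 = two_category_conjs(2)[THEN conjunct2, THEN conjunct2, THEN conjunct2, THEN conjunct2,
    THEN conjunct2, THEN conjunct2, THEN conjunct1, rule_format]
  and tc_assoc2 = two_category_conjs(2)[THEN conjunct2, THEN conjunct2, THEN conjunct2, THEN conjunct2,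
    THEN conjunct2, THEN conjunct2, THEN conjunct2, rule_format]

lemmas tf_ob = two_functor_def[THEN iffD1, THEN conjunct1, rule_format]
  and tf_ftor = two_functor_def[THEN iffD1, THEN conjunct2, THEN conjunct1, rule_format]
  and tf_id1 = two_functor_def[THEN iffD1, THEN conjunct2, THEN conjunct2, THEN conjunct1, rule_format]
  and tf_comp1 = two_functor_def[THEN iffD1, THEN conjunct2, THEN conjunct2, THEN conjunct2, THEN conjunct1,
    rule_format]
  and tf_comp2 = two_functor_def[THEN iffD1, THEN conjunct2, THEN conjunct2, THEN conjunct2, THEN conjunct2,
    rule_format]

lemma two_functor_comp:
  assumes J: "two_category J" and T: "two_functor J C T" and S: "two_functor C D S"
  shows "two_functor J D (two_ftor_comp J S T)"
  unfolding two_functor_def[of J D]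
  by (intro conjI ballI)
    (simp_all add: two_ftor_comp_def tf_ob[OF S] tf_ob[OF T] ftor_comp_in[OF tc_cat[OF J] tf_ftor[OF T] tf_ftor[OF S]]
      tc_id1[OF J] tc_comp1[OF J] tc_comp2[OF J] tf_id1[OF S] tf_id1[OF T] tf_comp1[OF T] tf_comp1[OF S]
      tf_comp2[OF T] tf_comp2[OF S] ftor_rules[OF tf_ftor[OF T]])

section \<open>The 2-category of arrows\<close>

text \<open>A 0-cell of \<open>CAT2\<close> without the size conditions, so that the calculus of
  squares can be developed without a universe.\<close>

definition arrow_ok :: "('o, 'm, 'p, 'n) arrow \<Rightarrow> bool" where
  "arrow_ok a \<longleftrightarrow> category (adom a) \<and> category (acod a) \<and> afun a \<in> functors (adom a) (acod a)"

lemma arrow_okD: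
  assumes "arrow_ok a"
  shows "category (adom a)" "category (acod a)" "afun a \<in> functors (adom a) (acod a)"
  using assms by (simp_all add: arrow_ok_def)

lemma squares_iff:
  assumes "arrow_ok a" "arrow_ok b"
  shows "s \<in> squares a b \<longleftrightarrow> sd s \<in> functors (adom a) (adom b) \<and> sc s \<in> functors (acod a) (acod b) \<and>
    si s \<in> nats (adom a) (acod b) (ftor_comp (adom a) (sc s) (afun a)) (ftor_comp (adom a) (afun b) (sd s)) \<and>
    (\<forall>x\<in>Ob (adom a). is_iso (acod b) (fo (sc s) (fo (afun a) x)) (fo (afun b) (fo (sd s) x)) (si s x))"
  (is "?l \<longleftrightarrow> ?r")
proof (cases "sd s \<in> functors (adom a) (adom b) \<and> sc s \<in> functors (acod a) (acod b)")
  case True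
  then have "ftor_comp (adom a) (sc s) (afun a) \<in> functors (adom a) (acod b)"
    "ftor_comp (adom a) (afun b) (sd s) \<in> functors (adom a) (acod b)"
    using assms by (auto intro!: ftor_comp_in simp: arrow_ok_def)
  from nat_iso_iff[OF _ this, of "si s"] True assms show ?thesis
    by (simp add: squares_def arrow_ok_def)
qed (auto simp: squares_def)

lemma squaresD:
  assumes "arrow_ok a" "arrow_ok b" "s \<in> squares a b"
  shows sq_sd: "sd s \<in> functors (adom a) (adom b)"
    and sq_sc: "sc s \<in> functors (acod a) (acod b)"
    and sq_si: "si s \<in> nats (adom a) (acod b) (ftor_comp (adom a) (sc s) (afun a)) (ftor_comp (adom a) (afun b) (sd s))"
    and sq_iso: "x \<in> Ob (adom a) \<Longrightarrow>
      is_iso (acod b) (fo (sc s) (fo (afun a) x)) (fo (afun b) (fo (sd s) x)) (si s x)"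
  using assms by (simp_all add: squares_iff)

lemma sq_si_hom:
  assumes "arrow_ok a" "arrow_ok b" "s \<in> squares a b" "x \<in> Ob (adom a)"
  shows "si s x \<in> Hom (acod b) (fo (sc s) (fo (afun a) x)) (fo (afun b) (fo (sd s) x))"
  using iso_hom[OF sq_iso[OF assms]] .

lemmas arrow_rules = arrow_okD arrow_okD(3)[THEN ftor_ob] arrow_okD(3)[THEN ftor_hom]
lemmas sq_rules = sq_sd[THEN ftor_ob] sq_sd[THEN ftor_hom] sq_sc[THEN ftor_ob] sq_sc[THEN ftor_hom] sq_si_hom

lemma sq_natural:
  assumes "arrow_ok a" "arrow_ok b" "s \<in> squares a b" "x \<in> Ob (adom a)" "y \<in> Ob (adom a)" "f \<in> Hom (adom a) x y"
  shows "cmp (acod b) (fo (sc s) (fo (afun a) x)) (fo (sc s) (fo (afun a) y)) (fo (afun b) (fo (sd s) y))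
      (si s y) (fa (sc s) (fo (afun a) x) (fo (afun a) y) (fa (afun a) x y f)) =
    cmp (acod b) (fo (sc s) (fo (afun a) x)) (fo (afun b) (fo (sd s) x)) (fo (afun b) (fo (sd s) y))
      (fa (afun b) (fo (sd s) x) (fo (sd s) y) (fa (sd s) x y f)) (si s x)"
  using nat_natural[OF sq_si[OF assms(1-3)] assms(4-6)] assms(4-6) by simp

lemma squaresI:
  assumes a: "arrow_ok a" and b: "arrow_ok b"
    and sd: "sd s \<in> functors (adom a) (adom b)" and sc: "sc s \<in> functors (acod a) (acod b)"
    and ext: "si s \<in> extensional (Ob (adom a))"
    and iso: "\<And>x. x \<in> Ob (adom a) \<Longrightarrow>
      is_iso (acod b) (fo (sc s) (fo (afun a) x)) (fo (afun b) (fo (sd s) x)) (si s x)"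
    and nat: "\<And>x y f. \<lbrakk>x \<in> Ob (adom a); y \<in> Ob (adom a); f \<in> Hom (adom a) x y\<rbrakk> \<Longrightarrow>
      cmp (acod b) (fo (sc s) (fo (afun a) x)) (fo (sc s) (fo (afun a) y)) (fo (afun b) (fo (sd s) y))
      (si s y) (fa (sc s) (fo (afun a) x) (fo (afun a) y) (fa (afun a) x y f)) =
    cmp (acod b) (fo (sc s) (fo (afun a) x)) (fo (afun b) (fo (sd s) x)) (fo (afun b) (fo (sd s) y))
      (fa (afun b) (fo (sd s) x) (fo (sd s) y) (fa (sd s) x y f)) (si s x)"
  shows "s \<in> squares a b"
  unfolding squares_iff[OF a b] using assms by (auto intro!: natsI iso_hom)

lemma square_id_in:
  assumes a: "arrow_ok a"
  shows "square_id a \<in> squares a a"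
  by (rule squaresI[OF a a])
    (use arrow_okD[OF a] in \<open>auto simp: square_id_def id_ftor_in idn_iso ftor_ob ftor_hom cat_idl cat_idr\<close>)

lemma square_comp_in:
  assumes a: "arrow_ok a" and b: "arrow_ok b" and c: "arrow_ok c"
    and s: "s \<in> squares a b" and t: "t \<in> squares b c"
  shows "square_comp a b c t s \<in> squares a c"
proof (rule squaresI[OF a c], goal_cases)
  note [simp] = arrow_rules[OF a] arrow_rules[OF b] arrow_rules[OF c] sq_rules[OF a b s]
    sq_rules[OF b c t] sq_iso[OF a b s] sq_iso[OF b c t]
  {
    case 1 show ?case by (simp add: square_comp_def ftor_comp_in[OF _ sq_sd[OF a b s] sq_sd[OF b c t]])
  next
    case 2 show ?case by (simp add: square_comp_def ftor_comp_in[OF _ sq_sc[OF a b s] sq_sc[OF b c t]])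
  next
    case 3 show ?case by (simp add: square_comp_def)
  next
    case (4 x)
    then show ?case
      by (auto simp: square_comp_def intro!: cmp_iso ftor_iso[OF sq_sc[OF b c t]])
  next
    case (5 x y f)
    note [simp] = 5
    show ?case
      \<comment> \<open>Naturality of the filler of \<open>s\<close> is applied inside
        \<open>sc t\<close>, then naturality of the filler of \<open>t\<close> at the arrow
        \<open>fa (sd s) x y f\<close>.\<close>
      by (simp add: square_comp_def cat_assoc ftor_cmp[OF sq_sc[OF b c t], symmetric] sq_natural[OF a b s])
        (simp add: ftor_cmp[OF sq_sc[OF b c t]] sq_natural[OF b c t, THEN cat_reassoc] cat_assoc)
  }
qed

lemma square_comp_idl:
  assumes a: "arrow_ok a" and b: "arrow_ok b" and s: "s \<in> squares a b"
  shows "square_comp a b b (square_id b) s = s"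
proof -
  note [simp] = arrow_rules[OF a] arrow_rules[OF b] sq_rules[OF a b s]
  have "si (square_comp a b b (square_id b) s) = si s"
    by (rule extensionalityI[of _ "Ob (adom a)"])
      (auto simp: square_comp_def square_id_def cat_idl nat_ext[OF sq_si[OF a b s]])
  then show ?thesis
    by (intro square.equality)
      (auto simp: square_comp_def square_id_def ftor_comp_idl[OF sq_sd[OF a b s]] ftor_comp_idl[OF sq_sc[OF a b s]])
qed

lemma square_comp_idr:
  assumes a: "arrow_ok a" and b: "arrow_ok b" and s: "s \<in> squares a b"
  shows "square_comp a a b s (square_id a) = s"
proof -
  note [simp] = arrow_rules[OF a] arrow_rules[OF b] sq_rules[OF a b s]
  have "si (square_comp a a b s (square_id a)) = si s"
    by (rule extensionalityI[of _ "Ob (adom a)"])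
      (auto simp: square_comp_def square_id_def cat_idr nat_ext[OF sq_si[OF a b s]] ftor_id[OF sq_sc[OF a b s]])
  then show ?thesis
    by (intro square.equality)
      (auto simp: square_comp_def square_id_def ftor_comp_idr[OF sq_sd[OF a b s]] ftor_comp_idr[OF sq_sc[OF a b s]])
qed

lemma square_comp_assoc:
  assumes a: "arrow_ok a" and b: "arrow_ok b" and c: "arrow_ok c" and d: "arrow_ok d"
    and s: "s \<in> squares a b" and t: "t \<in> squares b c" and u: "u \<in> squares c d"
  shows "square_comp a b d (square_comp b c d u t) s = square_comp a c d u (square_comp a b c t s)"
proof -
  note [simp] = arrow_rules[OF a] arrow_rules[OF b] arrow_rules[OF c] arrow_rules[OF d]
    sq_rules[OF a b s] sq_rules[OF b c t] sq_rules[OF c d u]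
  have "si (square_comp a b d (square_comp b c d u t) s) = si (square_comp a c d u (square_comp a b c t s))"
    by (rule extensionalityI[of _ "Ob (adom a)"])
      (auto simp: square_comp_def cat_assoc ftor_cmp[OF sq_sc[OF c d u]])
  then show ?thesis
    by (intro square.equality)
      (auto simp: square_comp_def ftor_comp_assoc[OF sq_sd[OF a b s]] ftor_comp_assoc[OF sq_sc[OF a b s]])
qed

lemma square_2cells_iff:
  "p \<in> square_2cells a b s t \<longleftrightarrow>
     fst p \<in> nats (adom a) (adom b) (sd s) (sd t) \<and> snd p \<in> nats (acod a) (acod b) (sc s) (sc t) \<and>
     (\<forall>x\<in>Ob (adom a).
        cmp (acod b)
          (fo (sc s) (fo (afun a) x)) (fo (afun b) (fo (sd s) x)) (fo (afun b) (fo (sd t) x))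
          (fa (afun b) (fo (sd s) x) (fo (sd t) x) (fst p x)) (si s x) =
        cmp (acod b)
          (fo (sc s) (fo (afun a) x)) (fo (sc t) (fo (afun a) x)) (fo (afun b) (fo (sd t) x))
          (si t x) (snd p (fo (afun a) x)))"
  by (cases p) (simp add: square_2cells_def)

lemma square_2cellsD:
  assumes "p \<in> square_2cells a b s t"
  shows s2_fst: "fst p \<in> nats (adom a) (adom b) (sd s) (sd t)"
    and s2_snd: "snd p \<in> nats (acod a) (acod b) (sc s) (sc t)"
    and s2_eq: "x \<in> Ob (adom a) \<Longrightarrow>
      cmp (acod b)
          (fo (sc s) (fo (afun a) x)) (fo (afun b) (fo (sd s) x)) (fo (afun b) (fo (sd t) x))
          (fa (afun b) (fo (sd s) x) (fo (sd t) x) (fst p x)) (si s x) =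
        cmp (acod b)
          (fo (sc s) (fo (afun a) x)) (fo (sc t) (fo (afun a) x)) (fo (afun b) (fo (sd t) x))
          (si t x) (snd p (fo (afun a) x))"
  using assms by (simp_all add: square_2cells_iff)

lemmas s2_rules = s2_fst s2_snd s2_fst[THEN nat_hom] s2_snd[THEN nat_hom]

lemma square_2cells_idn:
  assumes a: "arrow_ok a" and b: "arrow_ok b" and s: "s \<in> squares a b"
  shows "(idn (functor_category (adom a) (adom b)) (sd s), idn (functor_category (acod a) (acod b)) (sc s))
     \<in> square_2cells a b s s"
  unfolding square_2cells_iff
  using arrow_okD[OF a] arrow_okD[OF b] sq_sd[OF a b s] sq_sc[OF a b s] sq_si_hom[OF a b s]
  by (auto simp: idn_nat ftor_ob ftor_hom ftor_id cat_idl cat_idr)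

lemma square_2cells_cmp:
  assumes a: "arrow_ok a" and b: "arrow_ok b"
    and s: "s \<in> squares a b" and t: "t \<in> squares a b" and r: "r \<in> squares a b"
    and p: "p \<in> square_2cells a b s t" and q: "q \<in> square_2cells a b t r"
  shows "(cmp (functor_category (adom a) (adom b)) (sd s) (sd t) (sd r) (fst q) (fst p),
          cmp (functor_category (acod a) (acod b)) (sc s) (sc t) (sc r) (snd q) (snd p))
     \<in> square_2cells a b s r"
proof -
  note [simp] = arrow_rules[OF a] arrow_rules[OF b] sq_rules[OF a b s] sq_rules[OF a b t]
    sq_rules[OF a b r] s2_rules[OF p] s2_rules[OF q]
  show ?thesis
    unfolding square_2cells_iff
    by (auto simp: cmp_nat sq_sd[OF a b] sq_sc[OF a b] s t r cat_assoc ftor_cmp[OF arrow_okD(3)[OF b]]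
        s2_eq[OF p] s2_eq[OF q, THEN cat_reassoc])
qed

lemma square_2cells_hcomp:
  assumes a: "arrow_ok a" and b: "arrow_ok b" and c: "arrow_ok c"
    and s: "s \<in> squares a b" and s': "s' \<in> squares a b" and t: "t \<in> squares b c" and t': "t' \<in> squares b c"
    and p: "p \<in> square_2cells a b s s'" and q: "q \<in> square_2cells b c t t'"
  shows "(nat_hcomp (adom a) (adom c) (sd t) (sd t') (sd s) (sd s') (fst q) (fst p),
        nat_hcomp (acod a) (acod c) (sc t) (sc t') (sc s) (sc s') (snd q) (snd p))
     \<in> square_2cells a c (square_comp a b c t s) (square_comp a b c t' s')"
proof -
  note [simp] = arrow_rules[OF a] arrow_rules[OF b] arrow_rules[OF c] sq_rules[OF a b s]
    sq_rules[OF a b s'] sq_rules[OF b c t] sq_rules[OF b c t'] s2_rules[OF p] s2_rules[OF q]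
  have 1: "nat_hcomp (adom a) (adom c) (sd t) (sd t') (sd s) (sd s') (fst q) (fst p) \<in>
     nats (adom a) (adom c) (ftor_comp (adom a) (sd t) (sd s)) (ftor_comp (adom a) (sd t') (sd s'))"
    by (rule hcomp_nat) (use s s' t t' in \<open>auto intro: sq_sd[OF a b] sq_sd[OF b c]\<close>)
  have 2: "nat_hcomp (acod a) (acod c) (sc t) (sc t') (sc s) (sc s') (snd q) (snd p) \<in>
     nats (acod a) (acod c) (ftor_comp (acod a) (sc t) (sc s)) (ftor_comp (acod a) (sc t') (sc s'))"
    by (rule hcomp_nat) (use s s' t t' in \<open>auto intro: sq_sc[OF a b] sq_sc[OF b c]\<close>)
  \<comment> \<open>The compatibility of \<open>p\<close>, carried over by the functor
    \<open>sc t\<close>. What remains for the pasted cell is naturality of the filler of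
    \<open>t\<close>, the compatibility of \<open>q\<close>, and naturality of the second component
    of \<open>q\<close> at the filler of \<open>s'\<close>.\<close>
  have 3: "cmp (acod c) (fo (sc t) (fo (sc s) (fo (afun a) x))) (fo (sc t) (fo (afun b) (fo (sd s) x)))
      (fo (sc t) (fo (afun b) (fo (sd s') x)))
      (fa (sc t) (fo (afun b) (fo (sd s) x)) (fo (afun b) (fo (sd s') x))
        (fa (afun b) (fo (sd s) x) (fo (sd s') x) (fst p x)))
      (fa (sc t) (fo (sc s) (fo (afun a) x)) (fo (afun b) (fo (sd s) x)) (si s x)) =
    cmp (acod c) (fo (sc t) (fo (sc s) (fo (afun a) x))) (fo (sc t) (fo (sc s') (fo (afun a) x)))
      (fo (sc t) (fo (afun b) (fo (sd s') x)))
      (fa (sc t) (fo (sc s') (fo (afun a) x)) (fo (afun b) (fo (sd s') x)) (si s' x))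
      (fa (sc t) (fo (sc s) (fo (afun a) x)) (fo (sc s') (fo (afun a) x)) (snd p (fo (afun a) x)))"
    if "x \<in> Ob (adom a)" for x
    using that by (simp add: ftor_cmp[OF sq_sc[OF b c t], symmetric] s2_eq[OF p])
  show ?thesis
    unfolding square_2cells_iff
    using 1 2 by (simp add: square_comp_def cat_assoc cat_cmp ftor_cmp[OF arrow_okD(3)[OF c]]
        sq_natural[OF b c t, symmetric, THEN cat_reassoc] 3 s2_eq[OF q, THEN cat_reassoc]
        nat_natural[OF s2_snd[OF q], of _ _ "si s' _", THEN cat_reassoc])
qed

lemma CAT2_simps [simp]:
  "HomC (CAT2 U) a b = \<lparr>Ob = squares a b, Hom = square_2cells a b,
       idn = (\<lambda>s. (idn (functor_category (adom a) (adom b)) (sd s),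
                   idn (functor_category (acod a) (acod b)) (sc s))),
       cmp = (\<lambda>s t r q p.
         (cmp (functor_category (adom a) (adom b)) (sd s) (sd t) (sd r) (fst q) (fst p),
          cmp (functor_category (acod a) (acod b)) (sc s) (sc t) (sc r) (snd q) (snd p)))\<rparr>"
  "id1 (CAT2 U) = square_id" "comp1 (CAT2 U) = square_comp"
  "comp2 (CAT2 U) a b c t t' s s' q p =
       (nat_hcomp (adom a) (adom c) (sd t) (sd t') (sd s) (sd s') (fst q) (fst p),
        nat_hcomp (acod a) (acod c) (sc t) (sc t') (sc s) (sc s') (snd q) (snd p))"
  by (simp_all add: CAT2_def)

lemma Ob0_CAT2: "a \<in> Ob0 (CAT2 U) \<longleftrightarrow> arrow_ok a \<and> locally_small U (adom a) \<and> locally_small U (acod a)"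
  by (auto simp: CAT2_def arrow_ok_def)

lemma square_comp_simps [simp]:
  "sd (square_comp a b c t s) = ftor_comp (adom a) (sd t) (sd s)"
  "sc (square_comp a b c t s) = ftor_comp (acod a) (sc t) (sc s)"
  by (simp_all add: square_comp_def)

lemma square_id_simps [simp]:
  "sd (square_id a) = id_ftor (adom a)" "sc (square_id a) = id_ftor (acod a)"
  by (simp_all add: square_id_def)

text \<open>The laws are strict although squares commute only up to isomorphism: the fillers are
  data of the 1-cells, and pasting them is strictly associative and unital.\<close>

lemma two_category_CAT2: "two_category (CAT2 U)"
proof (unfold two_category_def, intro conjI ballI, goal_cases)
  case (1 a b)
  then have a: "arrow_ok a" and b: "arrow_ok b" by (auto simp: Ob0_CAT2)
  note [simp] = sq_sd[OF a b] sq_sc[OF a b]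
  have c1: "category (functor_category (adom a) (adom b))" and c2: "category (functor_category (acod a) (acod b))"
    using a b by (auto intro: category_functor_category simp: arrow_ok_def)
  show ?case
  proof (rule categoryI, goal_cases)
    case (3 s t p)
    then show ?case using cat_idl[OF c1, of "sd s" "sd t" "fst p"] cat_idl[OF c2, of "sc s" "sc t" "snd p"]
      by (simp add: square_2cells_iff)
  next
    case (4 s t p)
    then show ?case using cat_idr[OF c1, of "sd s" "sd t" "fst p"] cat_idr[OF c2, of "sc s" "sc t" "snd p"]
      by (simp add: square_2cells_iff)
  next
    case (5 s t u v p q r)
    then show ?case
      using cat_assoc[OF c1, of "sd s" "sd t" "sd u" "sd v" "fst p" "fst q" "fst r"]
        cat_assoc[OF c2, of "sc s" "sc t" "sc u" "sc v" "snd p" "snd q" "snd r"]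
      by (simp add: square_2cells_iff)
  qed (auto intro: square_2cells_idn[OF a b] square_2cells_cmp[OF a b])
next
  case (4 a b c f g)
  then have a: "arrow_ok a" and b: "arrow_ok b" and c: "arrow_ok c" by (auto simp: Ob0_CAT2)
  show ?case using 4 arrow_okD[OF a] arrow_okD[OF c] sq_sd[OF a b] sq_sd[OF b c] sq_sc[OF a b] sq_sc[OF b c]
    by (simp add: hcomp_idn)
next
  case (5 a b c f f' g g' \<alpha> \<beta>)
  then show ?case using square_2cells_hcomp[of a b c f f' g g' \<alpha> \<beta>] by (simp add: Ob0_CAT2)
next
  case (6 a b c f f' f'' g g' g'' \<alpha> \<alpha>' \<beta> \<beta>')
  then have a: "arrow_ok a" and b: "arrow_ok b" and c: "arrow_ok c" by (auto simp: Ob0_CAT2)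
  show ?case using 6 arrow_okD[OF a] arrow_okD[OF b] arrow_okD[OF c]
    hcomp_interchange[OF _ _ _ sq_sd[OF a b, of f] sq_sd[OF a b, of f'] sq_sd[OF a b, of f'']
      sq_sd[OF b c, of g] sq_sd[OF b c, of g'] sq_sd[OF b c, of g''] s2_fst s2_fst s2_fst s2_fst, of \<alpha> \<alpha>' \<beta> \<beta>']
    hcomp_interchange[OF _ _ _ sq_sc[OF a b, of f] sq_sc[OF a b, of f'] sq_sc[OF a b, of f'']
      sq_sc[OF b c, of g] sq_sc[OF b c, of g'] sq_sc[OF b c, of g''] s2_snd s2_snd s2_snd s2_snd, of \<alpha> \<alpha>' \<beta> \<beta>']
    by simp
next
  case (9 a b f f' \<alpha>)
  then have a: "arrow_ok a" and b: "arrow_ok b" by (auto simp: Ob0_CAT2)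
  show ?case using 9 arrow_okD[OF a] arrow_okD[OF b]
      hcomp_idl[OF _ sq_sd[OF a b, of f] sq_sd[OF a b, of f'] s2_fst, of \<alpha>]
      hcomp_idl[OF _ sq_sc[OF a b, of f] sq_sc[OF a b, of f'] s2_snd, of \<alpha>]
    by simp
next
  case (10 a b f f' \<alpha>)
  then have a: "arrow_ok a" and b: "arrow_ok b" by (auto simp: Ob0_CAT2)
  show ?case using 10 arrow_okD[OF a] arrow_okD[OF b]
      hcomp_idr[OF _ _ sq_sd[OF a b, of f] sq_sd[OF a b, of f'] s2_fst, of \<alpha>]
      hcomp_idr[OF _ _ sq_sc[OF a b, of f] sq_sc[OF a b, of f'] s2_snd, of \<alpha>]
    by simp
next
  case (12 a b c d f f' g g' h h' \<alpha> \<beta> \<gamma>)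
  then have a: "arrow_ok a" and b: "arrow_ok b" and c: "arrow_ok c" and d: "arrow_ok d" by (auto simp: Ob0_CAT2)
  show ?case using 12 arrow_okD[OF a] arrow_okD[OF b] arrow_okD[OF c] arrow_okD[OF d]
    hcomp_assoc[OF _ _ _ _ sq_sd[OF a b, of f] sq_sd[OF a b, of f'] sq_sd[OF b c, of g] sq_sd[OF b c, of g']
      sq_sd[OF c d, of h] sq_sd[OF c d, of h'] s2_fst s2_fst s2_fst, of \<alpha> \<beta> \<gamma>]
    hcomp_assoc[OF _ _ _ _ sq_sc[OF a b, of f] sq_sc[OF a b, of f'] sq_sc[OF b c, of g] sq_sc[OF b c, of g']
      sq_sc[OF c d, of h] sq_sc[OF c d, of h'] s2_snd s2_snd s2_snd, of \<alpha> \<beta> \<gamma>]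
    by simp
qed (auto simp: Ob0_CAT2 square_id_in square_comp_in square_comp_idl square_comp_idr square_comp_assoc)

section \<open>Functors and isomorphisms; whiskering\<close>

lemma ftor_cinv:
  assumes F: "F \<in> functors C D" and D: "category D" and x: "x \<in> Ob C" and y: "y \<in> Ob C" and f: "is_iso C x y f"
  shows "fa F y x (cinv C x y f) = cinv D (fo F x) (fo F y) (fa F x y f)"
proof (rule iso_cancel_l[of D "fo F x" "fo F y" "fo F y" "fa F x y f"])
  note i = ftor_iso[OF F x y f]
  show "is_iso D (fo F x) (fo F y) (fa F x y f)" by (rule i)
  show "cmp D (fo F y) (fo F x) (fo F y) (fa F x y f) (fa F y x (cinv C x y f)) =
    cmp D (fo F y) (fo F x) (fo F y) (fa F x y f) (cinv D (fo F x) (fo F y) (fa F x y f))"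
    using F x y f by (simp add: cinv_r[OF i] ftor_cmp[OF F, symmetric] cinv iso_hom ftor_id)
qed (use assms in \<open>simp_all add: ftor_ob ftor_hom cinv ftor_iso[OF F]\<close>)

text \<open>Fullness gives a preimage of the inverse, and faithfulness pulls back both inverse
  laws.\<close>

lemma full_faithful_reflects_iso:
  assumes C: "category C" and F: "F \<in> functors C D" and ff: "full_faithful C D F"
    and x: "x \<in> Ob C" and y: "y \<in> Ob C" and f: "f \<in> Hom C x y" and i: "is_iso D (fo F x) (fo F y) (fa F x y f)"
  shows "is_iso C x y f"
proof -
  have b: "bij_betw (fa F u v) (Hom C u v) (Hom D (fo F u) (fo F v))" if "u \<in> Ob C" "v \<in> Ob C" for u v
    using ff that by (simp add: full_faithful_def)
  obtain g where g: "g \<in> Hom C y x" "fa F y x g = cinv D (fo F x) (fo F y) (fa F x y f)"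
    using b[OF y x] cinv_hom[OF i] unfolding bij_betw_def by (metis imageE)
  have "cmp C x y x g f = idn C x"
    by (rule inj_onD[OF bij_betw_imp_inj_on[OF b[OF x x]]])
      (use C F x y f g in \<open>simp_all add: cat_cmp cat_id ftor_cmp[OF F] ftor_id[OF F] cinv_l[OF i]\<close>)
  moreover have "cmp C y x y f g = idn C y"
    by (rule inj_onD[OF bij_betw_imp_inj_on[OF b[OF y y]]])
      (use C F x y f g in \<open>simp_all add: cat_cmp cat_id ftor_cmp[OF F] ftor_id[OF F] cinv_r[OF i]\<close>)
  ultimately show ?thesis using f g by (auto intro: is_isoI)
qed

text \<open>The two ways of splitting the horizontal composite of \<open>\<beta>\<close> and
  \<open>\<alpha>\<close> by interchange with identities. It yields naturality, in the weight, of
  the modification that a 2-cell between 1-cells into the vertex induces.\<close>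

lemma tc_whisker:
  assumes D: "two_category D" and ob: "a \<in> Ob0 D" "b \<in> Ob0 D" "c \<in> Ob0 D"
    "f \<in> cells1 D a b" "f' \<in> cells1 D a b" "g \<in> cells1 D b c" "g' \<in> cells1 D b c"
    "\<alpha> \<in> cells2 D a b f f'" "\<beta> \<in> cells2 D b c g g'"
  shows "cmp (HomC D a c) (comp1 D a b c g f) (comp1 D a b c g f') (comp1 D a b c g' f')
      (comp2 D a b c g g' f' f' \<beta> (id2 D a b f')) (comp2 D a b c g g f f' (id2 D b c g) \<alpha>) =
    cmp (HomC D a c) (comp1 D a b c g f) (comp1 D a b c g' f) (comp1 D a b c g' f')
      (comp2 D a b c g' g' f f' (id2 D b c g') \<alpha>) (comp2 D a b c g g' f f \<beta> (id2 D a b f))"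
  using ob tc_interchange[OF D ob(1-3), of f f' f' g g g' \<alpha> "id2 D a b f'" "id2 D b c g" \<beta>, symmetric]
    tc_interchange[OF D ob(1-3), of f f f' g g' g' "id2 D a b f" \<alpha> \<beta> "id2 D b c g'", symmetric]
  by (simp add: cat_id tc_cat[OF D] cat_idl cat_idr)

section \<open>Weighted cones\<close>

lemma Cat_simps [simp]:
  "Ob0 (Cat U) = {C. small_category U C}" "HomC (Cat U) = functor_category"
  by (simp_all add: Cat_def)

lemma rep_ftor_simps [simp]:
  "F0 (rep_ftor J D X d) j = HomC D d (F0 X j)"
  "u \<in> cells1 J j k \<Longrightarrow> fo (FH (rep_ftor J D X d) j k) u =
     mk_ftor (HomC D d (F0 X j))
          (\<lambda>f. comp1 D d (F0 X j) (F0 X k) (fo (FH X j k) u) f)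
          (\<lambda>f f' \<alpha>. comp2 D d (F0 X j) (F0 X k) (fo (FH X j k) u) (fo (FH X j k) u) f f'
             (id2 D (F0 X j) (F0 X k) (fo (FH X j k) u)) \<alpha>)"
  "\<lbrakk>u \<in> cells1 J j k; v \<in> cells1 J j k; \<theta> \<in> cells2 J j k u v;
      f \<in> cells1 D d (F0 X j)\<rbrakk> \<Longrightarrow>
      fa (FH (rep_ftor J D X d) j k) u v \<theta> f =
       comp2 D d (F0 X j) (F0 X k) (fo (FH X j k) u) (fo (FH X j k) v) f f
            (fa (FH X j k) u v \<theta>) (id2 D (d) (F0 X j) f)"
  by (simp_all add: rep_ftor_def)

lemma rep_ftor_functor:
  assumes D: "two_category D" and X: "two_functor J D X" and d: "d \<in> Ob0 D"
    and j: "j \<in> Ob0 J" and k: "k \<in> Ob0 J" and u: "u \<in> cells1 J j k"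
  shows "fo (FH (rep_ftor J D X d) j k) u \<in> functors (HomC D d (F0 X j)) (HomC D d (F0 X k))"
proof -
  note [simp] = d j k u tf_ob[OF X] ftor_ob[OF tf_ftor[OF X]] tc_cat[OF D] cat_id
  show ?thesis
  proof (simp, rule mk_ftor_in_functors, goal_cases)
    case (5 f f' f'' \<alpha> \<beta>)
    then show ?case
      using tc_interchange[OF D, of d "F0 X j" "F0 X k" f f' f'' "fo (FH X j k) u" "fo (FH X j k) u" "fo (FH X j k) u" \<alpha> \<beta>
          "id2 D (F0 X j) (F0 X k) (fo (FH X j k) u)" "id2 D (F0 X j) (F0 X k) (fo (FH X j k) u)"]
      by (simp add: cat_idl)
  qed (simp_all add: tc_comp1[OF D] tc_comp2[OF D] tc_comp2_id[OF D])
qed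

locale weight =
  fixes J :: "('j, 'k, 'i) two_cat"
    and W :: "('j, 'k, 'i, ('w, 'v) category, ('w, 'v, 'w, 'v) ftor, 'w \<Rightarrow> 'v) two_ftor"
    and U :: "'u itself"
  assumes J: "two_category J" and W: "two_functor J (Cat U) W"
begin

lemma W_cat: "j \<in> Ob0 J \<Longrightarrow> category (F0 W j)"
  using tf_ob[OF W] by (auto simp: small_category_def)

lemma W_ftor: "\<lbrakk>j \<in> Ob0 J; k \<in> Ob0 J; u \<in> cells1 J j k\<rbrakk> \<Longrightarrow>
      fo (FH W j k) u \<in> functors (F0 W j) (F0 W k)"
  using ftor_ob[OF tf_ftor[OF W]] by simp

lemma W_nat: "\<lbrakk>j \<in> Ob0 J; k \<in> Ob0 J; u \<in> cells1 J j k; v \<in> cells1 J j k;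
      \<theta> \<in> cells2 J j k u v\<rbrakk> \<Longrightarrow>
      fa (FH W j k) u v \<theta> \<in> nats (F0 W j) (F0 W k) (fo (FH W j k) u) (fo (FH W j k) v)"
  using ftor_hom[OF tf_ftor[OF W]] by simp

text \<open>Splits the equations between functors into values on objects and on arrows and unfolds
  the representable 2-functor, so that a cone can be checked cell by cell. Functoriality of the legs
  comes first, because \<open>rep_ftor\<close> can be evaluated on their values only when these are
  known to be cells.\<close>

lemma two_nats_iff:
  assumes D: "two_category D" and X: "two_functor J D X" and d: "d \<in> Ob0 D"
  shows "L \<in> two_nats J W (rep_ftor J D X d) \<longleftrightarrow>
    L \<in> extensional (Ob0 J) \<and>
    (\<forall>j\<in>Ob0 J. L j \<in> functors (F0 W j) (HomC D d (F0 X j))) \<and>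
    (\<forall>j\<in>Ob0 J. \<forall>k\<in>Ob0 J. \<forall>u\<in>cells1 J j k. \<forall>w\<in>Ob (F0 W j).
       fo (L k) (fo (fo (FH W j k) u) w) = comp1 D d (F0 X j) (F0 X k) (fo (FH X j k) u) (fo (L j) w)) \<and>
    (\<forall>j\<in>Ob0 J. \<forall>k\<in>Ob0 J. \<forall>u\<in>cells1 J j k. \<forall>w\<in>Ob (F0 W j). \<forall>w'\<in>Ob (F0 W j). \<forall>v\<in>Hom (F0 W j) w w'.
       fa (L k) (fo (fo (FH W j k) u) w) (fo (fo (FH W j k) u) w') (fa (fo (FH W j k) u) w w' v) =
       comp2 D d (F0 X j) (F0 X k) (fo (FH X j k) u) (fo (FH X j k) u) (fo (L j) w) (fo (L j) w')
         (id2 D (F0 X j) (F0 X k) (fo (FH X j k) u)) (fa (L j) w w' v)) \<and>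
    (\<forall>j\<in>Ob0 J. \<forall>k\<in>Ob0 J. \<forall>u\<in>cells1 J j k. \<forall>v\<in>cells1 J j k. \<forall>\<theta>\<in>cells2 J j k u v. \<forall>w\<in>Ob (F0 W j).
       fa (L k) (fo (fo (FH W j k) u) w) (fo (fo (FH W j k) v) w) (fa (FH W j k) u v \<theta> w) =
       comp2 D d (F0 X j) (F0 X k) (fo (FH X j k) u) (fo (FH X j k) v) (fo (L j) w) (fo (L j) w)
         (fa (FH X j k) u v \<theta>) (id2 D d (F0 X j) (fo (L j) w)))"
proof (cases "\<forall>j\<in>Ob0 J. L j \<in> functors (F0 W j) (HomC D d (F0 X j))")
  case True
  then have L: "L j \<in> functors (F0 W j) (HomC D d (F0 X j))" if "j \<in> Ob0 J" for j using that by blast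
  note [simp] = d tf_ob[OF X] ftor_ob[OF tf_ftor[OF X]] tc_cat[OF D] cat_id W_cat
    ftor_rules[OF L] ftor_rules[OF W_ftor]
  have "ftor_comp (F0 W j) (L k) (fo (FH W j k) u) =
      ftor_comp (F0 W j) (fo (FH (rep_ftor J D X d) j k) u) (L j) \<longleftrightarrow>
    (\<forall>w\<in>Ob (F0 W j).
       fo (L k) (fo (fo (FH W j k) u) w) = comp1 D d (F0 X j) (F0 X k) (fo (FH X j k) u) (fo (L j) w)) \<and>
    (\<forall>w\<in>Ob (F0 W j). \<forall>w'\<in>Ob (F0 W j). \<forall>v\<in>Hom (F0 W j) w w'.
       fa (L k) (fo (fo (FH W j k) u) w) (fo (fo (FH W j k) u) w') (fa (fo (FH W j k) u) w w' v) =
       comp2 D d (F0 X j) (F0 X k) (fo (FH X j k) u) (fo (FH X j k) u) (fo (L j) w) (fo (L j) w')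
         (id2 D (F0 X j) (F0 X k) (fo (FH X j k) u)) (fa (L j) w w' v))" (is "?F = ?G \<longleftrightarrow> ?P")
    if [simp]: "j \<in> Ob0 J" "k \<in> Ob0 J" "u \<in> cells1 J j k" for j k u
  proof
    assume e: "?F = ?G"
    show ?P
    proof (intro conjI ballI)
      fix w assume "w \<in> Ob (F0 W j)"
      then show "fo (L k) (fo (fo (FH W j k) u) w) = comp1 D d (F0 X j) (F0 X k) (fo (FH X j k) u) (fo (L j) w)"
        using e[THEN arg_cong[of _ _ "\<lambda>F. fo F w"]] by simp
    next
      fix w w' v assume "w \<in> Ob (F0 W j)" "w' \<in> Ob (F0 W j)" "v \<in> Hom (F0 W j) w w'"
      then show "fa (L k) (fo (fo (FH W j k) u) w) (fo (fo (FH W j k) u) w') (fa (fo (FH W j k) u) w w' v) =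
       comp2 D d (F0 X j) (F0 X k) (fo (FH X j k) u) (fo (FH X j k) u) (fo (L j) w) (fo (L j) w')
         (id2 D (F0 X j) (F0 X k) (fo (FH X j k) u)) (fa (L j) w w' v)"
        using e[THEN arg_cong[of _ _ "\<lambda>F. fa F w w' v"]] by simp
    qed
  next
    assume ?P
    then show "?F = ?G"
      by (intro ftor_eqI[OF ftor_comp_in[OF _ W_ftor L] ftor_comp_in[OF _ L rep_ftor_functor[OF D X]]]) auto
  qed
  then show ?thesis using True unfolding two_nats_def by auto
qed (auto simp: two_nats_def)

lemmas cone_ext = two_nats_iff[THEN iffD1, THEN conjunct1]
  and cone_ftor = two_nats_iff[THEN iffD1, THEN conjunct2, THEN conjunct1, rule_format]
  and cone_ob = two_nats_iff[THEN iffD1, THEN conjunct2, THEN conjunct2, THEN conjunct1, rule_format]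
  and cone_ar = two_nats_iff[THEN iffD1, THEN conjunct2, THEN conjunct2, THEN conjunct2, THEN conjunct1, rule_format]
  and cone_2 = two_nats_iff[THEN iffD1, THEN conjunct2, THEN conjunct2, THEN conjunct2, THEN conjunct2, rule_format]

lemma modifications_iff:
  assumes D: "two_category D" and X: "two_functor J D X" and d: "d \<in> Ob0 D"
    and M: "M \<in> two_nats J W (rep_ftor J D X d)" and M': "M' \<in> two_nats J W (rep_ftor J D X d)"
  shows "m \<in> modifications J W (rep_ftor J D X d) M M' \<longleftrightarrow>
    m \<in> extensional (Ob0 J) \<and>
     (\<forall>j\<in>Ob0 J. m j \<in> nats (F0 W j) (HomC D d (F0 X j)) (M j) (M' j)) \<and>
     (\<forall>j\<in>Ob0 J. \<forall>k\<in>Ob0 J. \<forall>u\<in>cells1 J j k. \<forall>w\<in>Ob (F0 W j).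
        m k (fo (fo (FH W j k) u) w) =
        comp2 D d (F0 X j) (F0 X k) (fo (FH X j k) u) (fo (FH X j k) u) (fo (M j) w) (fo (M' j) w)
          (id2 D (F0 X j) (F0 X k) (fo (FH X j k) u)) (m j w))"
  unfolding modifications_def
  by (auto simp: nat_hom cone_ftor[OF D X d M, THEN ftor_ob] cone_ftor[OF D X d M', THEN ftor_ob])

lemmas mod_ext = modifications_iff[THEN iffD1, THEN conjunct1]
  and mod_nat = modifications_iff[THEN iffD1, THEN conjunct2, THEN conjunct1, rule_format]
  and mod_eq = modifications_iff[THEN iffD1, THEN conjunct2, THEN conjunct2, rule_format]

lemma cones_simps [simp]:
  "Ob (cones J W D X d) = two_nats J W (rep_ftor J D X d)"
  "Hom (cones J W D X d) = modifications J W (rep_ftor J D X d)"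
  "j \<in> Ob0 J \<Longrightarrow> w \<in> Ob (F0 W j) \<Longrightarrow> idn (cones J W D X d) M j w = idn (HomC D d (F0 X j)) (fo (M j) w)"
  "j \<in> Ob0 J \<Longrightarrow> w \<in> Ob (F0 W j) \<Longrightarrow> cmp (cones J W D X d) M M' M'' n m j w =
     cmp (HomC D d (F0 X j)) (fo (M j) w) (fo (M' j) w) (fo (M'' j) w) (n j w) (m j w)"
  "idn (cones J W D X d) M \<in> extensional (Ob0 J)"
  "cmp (cones J W D X d) M M' M'' n m \<in> extensional (Ob0 J)"
  "j \<in> Ob0 J \<Longrightarrow> idn (cones J W D X d) M j \<in> extensional (Ob (F0 W j))"
  "j \<in> Ob0 J \<Longrightarrow> cmp (cones J W D X d) M M' M'' n m j \<in> extensional (Ob (F0 W j))"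
  by (simp_all add: cones_def two_nat_category_def functor_category_def)

lemma family_eqI:
  assumes "m \<in> extensional (Ob0 J)" "n \<in> extensional (Ob0 J)"
    and "\<And>j. j \<in> Ob0 J \<Longrightarrow> m j \<in> extensional (Ob (F0 W j))" "\<And>j. j \<in> Ob0 J \<Longrightarrow> n j \<in> extensional (Ob (F0 W j))"
    and "\<And>j w. j \<in> Ob0 J \<Longrightarrow> w \<in> Ob (F0 W j) \<Longrightarrow> m j w = n j w"
  shows "m = n"
proof (rule extensionalityI[OF assms(1,2)])
  fix j assume j: "j \<in> Ob0 J"
  show "m j = n j"
    by (rule extensionalityI[OF assms(3,4)[OF j]]) (rule assms(5)[OF j])
qed

lemma cone_comparison_simps [simp]:
  "h \<in> cells1 D d l \<Longrightarrow> fo (cone_comparison J W D X l L d) h \<in> extensional (Ob0 J)"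
  "h \<in> cells1 D d l \<Longrightarrow> j \<in> Ob0 J \<Longrightarrow> fo (cone_comparison J W D X l L d) h j =
     mk_ftor (F0 W j)
        (\<lambda>w. comp1 D d l (F0 X j) (fo (L j) w) h)
        (\<lambda>w w' v. comp2 D d l (F0 X j) (fo (L j) w) (fo (L j) w') h h
           (fa (L j) w w' v) (id2 D d l h))"
  "\<lbrakk>h \<in> cells1 D d l; h' \<in> cells1 D d l; \<alpha> \<in> cells2 D d l h h'\<rbrakk> \<Longrightarrow>
      fa (cone_comparison J W D X l L d) h h' \<alpha> \<in> extensional (Ob0 J)"
  "\<lbrakk>h \<in> cells1 D d l; h' \<in> cells1 D d l; \<alpha> \<in> cells2 D d l h h';
      j \<in> Ob0 J\<rbrakk> \<Longrightarrow>
      fa (cone_comparison J W D X l L d) h h' \<alpha> j \<in> extensional (Ob (F0 W j))"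
  "\<lbrakk>h \<in> cells1 D d l; h' \<in> cells1 D d l; \<alpha> \<in> cells2 D d l h h';
      j \<in> Ob0 J; w \<in> Ob (F0 W j)\<rbrakk> \<Longrightarrow>
      fa (cone_comparison J W D X l L d) h h' \<alpha> j w =
       comp2 D d l (F0 X j) (fo (L j) w) (fo (L j) w) h h' (id2 D l (F0 X j) (fo (L j) w)) \<alpha>"
  by (simp_all add: cone_comparison_def)

text \<open>\<open>iso_of_categories\<close> includes functoriality, so this is owed for every
  limit. It holds for any cone: precomposition with \<open>h\<close> keeps the strict equations of
  \<open>L\<close> by associativity of 1-cells and of horizontal composition.\<close>

lemma cone_comparison_functor:
  assumes D: "two_category D" and X: "two_functor J D X" and d: "d \<in> Ob0 D" and l: "l \<in> Ob0 D"
    and L: "L \<in> two_nats J W (rep_ftor J D X l)"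
  shows "cone_comparison J W D X l L d \<in> functors (HomC D d l) (cones J W D X d)"
proof -
  note Lf = cone_ftor[OF D X l L]
  note [simp] = d l tf_ob[OF X] ftor_rules[OF tf_ftor[OF X]] tc_cat[OF D] cat_id W_cat
    ftor_rules[OF Lf] ftor_rules[OF W_ftor] nat_hom[OF W_nat]
    tc_comp1[OF D] tc_comp2[OF D]
  let ?K = "cone_comparison J W D X l L d"
  have ob: "fo ?K h \<in> two_nats J W (rep_ftor J D X d)" if [simp]: "h \<in> cells1 D d l" for h
    unfolding two_nats_iff[OF D X d]
  proof (intro conjI ballI, goal_cases)
    case (2 j)
    then show ?case
    proof (simp, intro mk_ftor_in_functors, goal_cases)
      case (5 w w' w'' v v')
      then show ?case
        using tc_interchange[OF D, of d l "F0 X j" h h h "fo (L j) w" "fo (L j) w'" "fo (L j) w''" "id2 D d l h" "id2 D d l h"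
            "fa (L j) w w' v" "fa (L j) w' w'' v'"]
        by (simp add: cat_idl ftor_cmp[OF Lf])
    qed (simp_all add: ftor_id[OF Lf] tc_comp2_id[OF D])
  next
    case (3 j k u w)
    then show ?case by (simp add: cone_ob[OF D X l L] tc_assoc1[OF D])
  next
    case (4 j k u w w' v)
    then show ?case by (simp add: cone_ob[OF D X l L] cone_ar[OF D X l L] tc_assoc2[OF D])
  next
    case (5 j k u v \<theta> w)
    then show ?case by (simp add: cone_ob[OF D X l L] cone_2[OF D X l L] tc_assoc2[OF D] tc_comp2_id[OF D])
  qed simp_all
  have ar: "fa ?K h h' \<alpha> \<in> modifications J W (rep_ftor J D X d) (fo ?K h) (fo ?K h')"
    if [simp]: "h \<in> cells1 D d l" "h' \<in> cells1 D d l" "\<alpha> \<in> cells2 D d l h h'" for h h' \<alpha>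
    unfolding modifications_iff[OF D X d ob[OF that(1)] ob[OF that(2)]]
  proof (intro conjI ballI)
    fix j assume [simp]: "j \<in> Ob0 J"
    show "fa ?K h h' \<alpha> j \<in> nats (F0 W j) (HomC D d (F0 X j)) (fo ?K h j) (fo ?K h' j)"
      by (rule natsI) (simp_all add: tc_whisker[OF D])
  next
    fix j k u w assume [simp]: "j \<in> Ob0 J" "k \<in> Ob0 J" "u \<in> cells1 J j k" "w \<in> Ob (F0 W j)"
    show "fa ?K h h' \<alpha> k (fo (fo (FH W j k) u) w) =
        comp2 D d (F0 X j) (F0 X k) (fo (FH X j k) u) (fo (FH X j k) u) (fo (fo ?K h j) w) (fo (fo ?K h' j) w)
          (id2 D (F0 X j) (F0 X k) (fo (FH X j k) u)) (fa ?K h h' \<alpha> j w)"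
      by (simp add: cone_ob[OF D X l L] tc_comp2_id[OF D, symmetric] tc_assoc2[OF D])
  qed simp
  have id: "fa ?K h h (id2 D d l h) = idn (cones J W D X d) (fo ?K h)" if [simp]: "h \<in> cells1 D d l" for h
    by (rule family_eqI) (simp_all add: tc_comp2_id[OF D])
  have comp: "fa ?K h h'' (cmp (HomC D d l) h h' h'' \<beta> \<alpha>) =
      cmp (cones J W D X d) (fo ?K h) (fo ?K h') (fo ?K h'') (fa ?K h' h'' \<beta>) (fa ?K h h' \<alpha>)"
    if [simp]: "h \<in> cells1 D d l" "h' \<in> cells1 D d l" "h'' \<in> cells1 D d l"
      "\<alpha> \<in> cells2 D d l h h'" "\<beta> \<in> cells2 D d l h' h''" for h h' h'' \<alpha> \<beta>
  proof (rule family_eqI)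
    fix j w assume [simp]: "j \<in> Ob0 J" "w \<in> Ob (F0 W j)"
    show "fa ?K h h'' (cmp (HomC D d l) h h' h'' \<beta> \<alpha>) j w =
      cmp (cones J W D X d) (fo ?K h) (fo ?K h') (fo ?K h'') (fa ?K h' h'' \<beta>) (fa ?K h h' \<alpha>) j w"
      using tc_interchange[OF D, of d l "F0 X j" h h' h'' "fo (L j) w" "fo (L j) w" "fo (L j) w" \<alpha> \<beta>
          "id2 D l (F0 X j) (fo (L j) w)" "id2 D l (F0 X j) (fo (L j) w)"]
      by (simp add: cat_cmp cat_idl)
  qed (simp_all add: cat_cmp)
  have "?K = mk_ftor (HomC D d l) (fo ?K) (fa ?K)"
    unfolding cone_comparison_def by simp
  also have "\<dots> \<in> functors (HomC D d l) (cones J W D X d)"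
    by (rule mk_ftor_in_functors) (simp_all only: cones_simps ob ar id comp tc_cat[OF D d l])
  finally show ?thesis .
qed

lemma cones_iso:
  assumes D: "two_category D" and X: "two_functor J D X" and d: "d \<in> Ob0 D"
    and M: "M \<in> two_nats J W (rep_ftor J D X d)" and M': "M' \<in> two_nats J W (rep_ftor J D X d)"
    and m: "m \<in> modifications J W (rep_ftor J D X d) M M'"
    and i: "\<And>j w. j \<in> Ob0 J \<Longrightarrow> w \<in> Ob (F0 W j) \<Longrightarrow>
      is_iso (HomC D d (F0 X j)) (fo (M j) w) (fo (M' j) w) (m j w)"
  shows "is_iso (cones J W D X d) M M' m"
proof -
  note [simp] = d tf_ob[OF X] ftor_ob[OF tf_ftor[OF X]] tc_cat[OF D] cat_id W_cat
    ftor_ob[OF W_ftor] cone_ftor[OF D X d M, THEN ftor_ob] cone_ftor[OF D X d M', THEN ftor_ob]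
    mod_nat[OF D X d M M' m] mod_nat[OF D X d M M' m, THEN nat_hom] cinv[OF i] i
  let ?n = "\<lambda>j\<in>Ob0 J. \<lambda>w\<in>Ob (F0 W j). cinv (HomC D d (F0 X j)) (fo (M j) w) (fo (M' j) w) (m j w)"
  have n: "?n \<in> modifications J W (rep_ftor J D X d) M' M"
    unfolding modifications_iff[OF D X d M' M]
  proof (intro conjI ballI)
    fix j assume "j \<in> Ob0 J"
    then show "?n j \<in> nats (F0 W j) (HomC D d (F0 X j)) (M' j) (M j)"
      using cinv_nat[OF _ cone_ftor[OF D X d M] cone_ftor[OF D X d M'], of j "m j"] by simp
  next
    fix j k u w assume [simp]: "j \<in> Ob0 J" "k \<in> Ob0 J" "u \<in> cells1 J j k" "w \<in> Ob (F0 W j)"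
    \<comment> \<open>At \<open>fo (fo (FH W j k) u) w\<close> the modification is
      \<open>m j w\<close> whiskered with \<open>u\<close>. Whiskering is a functor, so it carries
      the inverse at \<open>w\<close> to the inverse there.\<close>
    have R: "fo (FH (rep_ftor J D X d) j k) u \<in> functors (HomC D d (F0 X j)) (HomC D d (F0 X k))"
      by (rule rep_ftor_functor[OF D X]) simp_all
    show "?n k (fo (fo (FH W j k) u) w) =
        comp2 D d (F0 X j) (F0 X k) (fo (FH X j k) u) (fo (FH X j k) u) (fo (M' j) w) (fo (M j) w)
          (id2 D (F0 X j) (F0 X k) (fo (FH X j k) u)) (?n j w)"
      using ftor_cinv[OF R, of "fo (M j) w" "fo (M' j) w" "m j w"]
      by (simp add: mod_eq[OF D X d M M' m] cone_ob[OF D X d M] cone_ob[OF D X d M'])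
  qed simp
  show ?thesis
    by (rule is_isoI[of _ _ _ _ ?n]; (rule family_eqI)?) (use n m in simp_all)
qed

text \<open>The projections of a limit are jointly conservative on 2-cells: the comparison is fully
  faithful, and a modification is invertible once all its components are.\<close>

lemma limit_reflects_iso:
  assumes D: "two_category D" and X: "two_functor J D X" and lim: "is_weighted_limit J W D X l L"
    and d: "d \<in> Ob0 D" and h: "h \<in> cells1 D d l" "h' \<in> cells1 D d l" and a: "\<alpha> \<in> cells2 D d l h h'"
    and iso: "\<And>j w. j \<in> Ob0 J \<Longrightarrow> w \<in> Ob (F0 W j) \<Longrightarrow>
      is_iso (HomC D d (F0 X j)) (comp1 D d l (F0 X j) (fo (L j) w) h) (comp1 D d l (F0 X j) (fo (L j) w) h')
       (comp2 D d l (F0 X j) (fo (L j) w) (fo (L j) w) h h' (id2 D l (F0 X j) (fo (L j) w)) \<alpha>)"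
  shows "is_iso (HomC D d l) h h' \<alpha>"
proof -
  let ?K = "cone_comparison J W D X l L d"
  have l: "l \<in> Ob0 D" and Kf: "?K \<in> functors (HomC D d l) (cones J W D X d)"
    and Kff: "full_faithful (HomC D d l) (cones J W D X d) ?K"
    using lim d by (simp_all add: is_weighted_limit_def iso_of_categories_def)
  have "is_iso (cones J W D X d) (fo ?K h) (fo ?K h') (fa ?K h h' \<alpha>)"
    by (rule cones_iso[OF D X d])
      (use ftor_ob[OF Kf h(1)] ftor_ob[OF Kf h(2)] ftor_hom[OF Kf h a] iso h a W_cat in simp_all)
  then show ?thesis
    using full_faithful_reflects_iso[OF tc_cat[OF D d l] Kf Kff h a] by simp
qed

end

section \<open>Reflection of limits along a 2-functor that is locally fully faithful and injective
  on 1-cells\<close>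

context weight
begin

context
  fixes C :: "('c, 'f, 't) two_cat" and D :: "('d, 'g, 's) two_cat"
    and \<Phi> :: "('c, 'f, 't, 'd, 'g, 's) two_ftor"
    and X :: "('j, 'k, 'i, 'c, 'f, 't) two_ftor"
  assumes C: "two_category C" and D: "two_category D" and P: "two_functor C D \<Phi>"
    and X: "two_functor J C X"
    and ff: "\<And>a b. a \<in> Ob0 C \<Longrightarrow> b \<in> Ob0 C \<Longrightarrow>
      full_faithful (HomC C a b) (HomC D (F0 \<Phi> a) (F0 \<Phi> b)) (FH \<Phi> a b)"
    and inj: "\<And>a b. a \<in> Ob0 C \<Longrightarrow> b \<in> Ob0 C \<Longrightarrow> inj_on (fo (FH \<Phi> a b)) (cells1 C a b)"
begin

private lemma PX: "two_functor J D (two_ftor_comp J \<Phi> X)"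
  by (rule two_functor_comp[OF J X P])

private lemma PX_simps [simp]:
  "F0 (two_ftor_comp J \<Phi> X) j = F0 \<Phi> (F0 X j)"
  "u \<in> cells1 J j k \<Longrightarrow> fo (FH (two_ftor_comp J \<Phi> X) j k) u = fo (FH \<Phi> (F0 X j) (F0 X k)) (fo (FH X j k) u)"
  "\<lbrakk>u \<in> cells1 J j k; u' \<in> cells1 J j k; \<theta> \<in> cells2 J j k u u'\<rbrakk> \<Longrightarrow>
      fa (FH (two_ftor_comp J \<Phi> X) j k) u u' \<theta> =
    fa (FH \<Phi> (F0 X j) (F0 X k)) (fo (FH X j k) u) (fo (FH X j k) u') (fa (FH X j k) u u' \<theta>)"
  by (simp_all add: two_ftor_comp_def)

lemma cone_image_simps [simp]:
  "cone_image J W X \<Phi> d M \<in> extensional (Ob0 J)"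
  "j \<in> Ob0 J \<Longrightarrow> w \<in> Ob (F0 W j) \<Longrightarrow> fo (cone_image J W X \<Phi> d M j) w = fo (FH \<Phi> d (F0 X j)) (fo (M j) w)"
  "\<lbrakk>j \<in> Ob0 J; w \<in> Ob (F0 W j); w' \<in> Ob (F0 W j); v \<in> Hom (F0 W j) w w'\<rbrakk> \<Longrightarrow>
      fa (cone_image J W X \<Phi> d M j) w w' v = fa (FH \<Phi> d (F0 X j)) (fo (M j) w) (fo (M j) w') (fa (M j) w w' v)"
  by (simp_all add: cone_image_def)

private lemma P_id2: "\<lbrakk>a \<in> Ob0 C; b \<in> Ob0 C; f \<in> cells1 C a b\<rbrakk> \<Longrightarrow>
      id2 D (F0 \<Phi> a) (F0 \<Phi> b) (fo (FH \<Phi> a b) f) = fa (FH \<Phi> a b) f f (id2 C a b f)"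
  by (simp add: ftor_id[OF tf_ftor[OF P]])

private lemma P_bij: "\<lbrakk>a \<in> Ob0 C; b \<in> Ob0 C; f \<in> cells1 C a b; g \<in> cells1 C a b\<rbrakk> \<Longrightarrow>
      bij_betw (fa (FH \<Phi> a b) f g) (cells2 C a b f g) (cells2 D (F0 \<Phi> a) (F0 \<Phi> b) (fo (FH \<Phi> a b) f) (fo (FH \<Phi> a b) g))"
  using ff[of a b] by (simp add: full_faithful_def)

private lemma P_inj2: "\<lbrakk>a \<in> Ob0 C; b \<in> Ob0 C; f \<in> cells1 C a b; g \<in> cells1 C a b;
      \<alpha> \<in> cells2 C a b f g; \<beta> \<in> cells2 C a b f g;
      fa (FH \<Phi> a b) f g \<alpha> = fa (FH \<Phi> a b) f g \<beta>\<rbrakk> \<Longrightarrow>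
      \<alpha> = \<beta>"
  using P_bij by (meson bij_betw_imp_inj_on inj_onD)

lemma cone_image_in:
  assumes d: "d \<in> Ob0 C" and M: "M \<in> two_nats J W (rep_ftor J C X d)"
  shows "cone_image J W X \<Phi> d M \<in> two_nats J W (rep_ftor J D (two_ftor_comp J \<Phi> X) (F0 \<Phi> d))"
proof -
  note Mf = cone_ftor[OF C X d M]
  note [simp] = d tf_ob[OF X] ftor_rules[OF tf_ftor[OF X]] tf_ob[OF P] tc_cat[OF C] cat_id
    W_cat ftor_rules[OF W_ftor] nat_hom[OF W_nat] ftor_rules[OF Mf]
  show ?thesis
    unfolding two_nats_iff[OF D PX tf_ob[OF P d]]
  proof (intro conjI ballI)
    fix j assume "j \<in> Ob0 J"
    then show "cone_image J W X \<Phi> d M j \<in> functors (F0 W j) (HomC D (F0 \<Phi> d) (F0 (two_ftor_comp J \<Phi> X) j))"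
      by (simp add: cone_image_def ftor_comp_in[OF _ Mf tf_ftor[OF P]])
  qed (simp_all add: cone_ob[OF C X d M] cone_ar[OF C X d M] cone_2[OF C X d M] tf_comp1[OF P] tf_comp2[OF P] P_id2)
qed

text \<open>A leg consists of 1-cells at the objects of the weight and of 2-cells at its arrows:
  injectivity of \<open>\<Phi>\<close> on 1-cells handles the former, local faithfulness the
  latter.\<close>

lemma cone_image_inj:
  assumes d: "d \<in> Ob0 C" and M: "M \<in> two_nats J W (rep_ftor J C X d)" and M': "M' \<in> two_nats J W (rep_ftor J C X d)"
    and e: "cone_image J W X \<Phi> d M = cone_image J W X \<Phi> d M'"
  shows "M = M'"
proof (rule extensionalityI[OF cone_ext[OF C X d M] cone_ext[OF C X d M']])
  fix j assume j [simp]: "j \<in> Ob0 J"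
  note Mf = cone_ftor[OF C X d M j] and Mf' = cone_ftor[OF C X d M' j]
  note [simp] = d tf_ob[OF X] ftor_rules[OF Mf] ftor_rules[OF Mf']
  have o: "fo (M j) w = fo (M' j) w" if "w \<in> Ob (F0 W j)" for w
    using e[THEN fun_cong, of j, THEN arg_cong[of _ _ "\<lambda>F. fo F w"]] that
    by (simp add: inj_on_eq_iff[OF inj])
  show "M j = M' j"
  proof (rule ftor_eqI[OF Mf Mf' o])
    fix w w' v assume [simp]: "w \<in> Ob (F0 W j)" "w' \<in> Ob (F0 W j)" "v \<in> Hom (F0 W j) w w'"
    show "fa (M j) w w' v = fa (M' j) w w' v"
      using e[THEN fun_cong, of j, THEN arg_cong[of _ _ "\<lambda>F. fa F w w' v"]] ftor_hom[OF Mf, of w w' v] ftor_hom[OF Mf', of w w' v]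
      by (intro P_inj2[of d "F0 X j" "fo (M j) w" "fo (M j) w'"]) (simp_all add: o)
  qed
qed

text \<open>\<open>\<Phi>\<close> is strict, so it commutes with precomposition on the nose.\<close>

lemma cone_image_comparison:
  assumes d: "d \<in> Ob0 C" and l: "l \<in> Ob0 C" and L: "L \<in> two_nats J W (rep_ftor J C X l)" and K: "K \<in> cells1 C d l"
  shows "cone_image J W X \<Phi> d (fo (cone_comparison J W C X l L d) K) =
    fo (cone_comparison J W D (two_ftor_comp J \<Phi> X) (F0 \<Phi> l) (cone_image J W X \<Phi> l L) (F0 \<Phi> d)) (fo (FH \<Phi> d l) K)"
proof -
  note Lf = cone_ftor[OF C X l L]
  note [simp] = d l K tf_ob[OF X] tf_ob[OF P] ftor_ob[OF tf_ftor[OF P]] tc_cat[OF C] cat_id ftor_rules[OF Lf]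
  show ?thesis
    by (rule extensionalityI[of _ "Ob0 J"])
      (simp_all add: cone_image_def ftor_comp_def tf_comp1[OF P] tf_comp2[OF P] P_id2 cong: mk_ftor_cong)
qed

text \<open>Local full faithfulness passes from 2-cells to modifications. Preimages are taken in
  each component, and the equations for them hold because they hold after applying
  \<open>\<Phi>\<close>, which is injective on parallel 2-cells.\<close>

lemma modification_image_bij:
  assumes d: "d \<in> Ob0 C" and M: "M \<in> two_nats J W (rep_ftor J C X d)" and M': "M' \<in> two_nats J W (rep_ftor J C X d)"
  shows "bij_betw (\<lambda>m. \<lambda>j\<in>Ob0 J. \<lambda>w\<in>Ob (F0 W j). fa (FH \<Phi> d (F0 X j)) (fo (M j) w) (fo (M' j) w) (m j w))
    (modifications J W (rep_ftor J C X d) M M')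
    (modifications J W (rep_ftor J D (two_ftor_comp J \<Phi> X) (F0 \<Phi> d)) (cone_image J W X \<Phi> d M) (cone_image J W X \<Phi> d M'))"
  (is "bij_betw ?I ?A ?B")
proof -
  note Mf = cone_ftor[OF C X d M] and Mf' = cone_ftor[OF C X d M']
  note [simp] = d tf_ob[OF X] ftor_rules[OF tf_ftor[OF X]] tf_ob[OF P] tc_cat[OF C] cat_id cat_cmp
    W_cat ftor_rules[OF W_ftor] nat_hom[OF W_nat] ftor_rules[OF Mf] ftor_rules[OF Mf']
    ftor_hom[OF tf_ftor[OF P]] tc_comp1[OF C] tc_comp2[OF C]
  note i1 = modifications_iff[OF C X d M M']
  note i2 = modifications_iff[OF D PX tf_ob[OF P d] cone_image_in[OF d M] cone_image_in[OF d M']]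
  show ?thesis
    unfolding bij_betw_def
  proof (intro conjI inj_onI equalityI subsetI)
    fix m n assume m: "m \<in> ?A" and n: "n \<in> ?A" and e: "?I m = ?I n"
    note [simp] = mod_nat[OF C X d M M' m, THEN nat_hom] mod_nat[OF C X d M M' n, THEN nat_hom]
    show "m = n"
    proof (rule family_eqI)
      fix j w assume [simp]: "j \<in> Ob0 J" "w \<in> Ob (F0 W j)"
      show "m j w = n j w"
        using e[THEN fun_cong, of j, THEN fun_cong, of w]
        by (intro P_inj2[of d "F0 X j" "fo (M j) w" "fo (M' j) w"]) simp_all
    qed (use mod_nat[OF C X d M M'] mod_ext[OF C X d M M'] m n nat_ext in blast)+
  next
    fix p assume "p \<in> ?I ` ?A"
    then obtain m where m: "m \<in> ?A" and p: "p = ?I m" by blast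
    note [simp] = mod_nat[OF C X d M M' m, THEN nat_hom]
    show "p \<in> ?B"
      unfolding i2 p
    proof (intro conjI ballI)
      fix j assume [simp]: "j \<in> Ob0 J"
      show "?I m j \<in> nats (F0 W j) (HomC D (F0 \<Phi> d) (F0 (two_ftor_comp J \<Phi> X) j)) (cone_image J W X \<Phi> d M j) (cone_image J W X \<Phi> d M' j)"
        by (rule natsI)
          (simp_all add: ftor_cmp[OF tf_ftor[OF P], symmetric] nat_natural[OF mod_nat[OF C X d M M' m]])
    qed (simp_all add: mod_eq[OF C X d M M' m] tf_comp2[OF P] P_id2 cone_ob[OF C X d M] cone_ob[OF C X d M'])
  next
    fix p assume p: "p \<in> ?B"
    note pn = mod_nat[OF D PX tf_ob[OF P d] cone_image_in[OF d M] cone_image_in[OF d M'] p]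
    note pe = mod_eq[OF D PX tf_ob[OF P d] cone_image_in[OF d M] cone_image_in[OF d M'] p]
    let ?m = "\<lambda>j\<in>Ob0 J. \<lambda>w\<in>Ob (F0 W j). inv_into (cells2 C d (F0 X j) (fo (M j) w) (fo (M' j) w))
        (fa (FH \<Phi> d (F0 X j)) (fo (M j) w) (fo (M' j) w)) (p j w)"
    have m: "?m j w \<in> cells2 C d (F0 X j) (fo (M j) w) (fo (M' j) w)"
      and mp: "fa (FH \<Phi> d (F0 X j)) (fo (M j) w) (fo (M' j) w) (?m j w) = p j w"
      if "j \<in> Ob0 J" "w \<in> Ob (F0 W j)" for j w
    proof -
      have "p j w \<in> fa (FH \<Phi> d (F0 X j)) (fo (M j) w) (fo (M' j) w) ` cells2 C d (F0 X j) (fo (M j) w) (fo (M' j) w)"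
        using nat_hom[OF pn[OF that(1)] that(2)] that P_bij[of d "F0 X j" "fo (M j) w" "fo (M' j) w"]
        by (simp add: bij_betw_def)
      from inv_into_into[OF this] f_inv_into_f[OF this] that
      show "?m j w \<in> cells2 C d (F0 X j) (fo (M j) w) (fo (M' j) w)"
        "fa (FH \<Phi> d (F0 X j)) (fo (M j) w) (fo (M' j) w) (?m j w) = p j w" by simp_all
    qed
    define m where "m = ?m"
    note m = m[folded m_def] and mp = mp[folded m_def]
    have ext: "m \<in> extensional (Ob0 J)" "\<And>j. j \<in> Ob0 J \<Longrightarrow> m j \<in> extensional (Ob (F0 W j))"
      by (simp_all add: m_def)
    have "m \<in> ?A"
      unfolding i1
    proof (intro conjI ballI)
      fix j assume j [simp]: "j \<in> Ob0 J"
      show "m j \<in> nats (F0 W j) (HomC C d (F0 X j)) (M j) (M' j)"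
      proof (rule natsI)
        fix w w' v assume [simp]: "w \<in> Ob (F0 W j)" "w' \<in> Ob (F0 W j)" "v \<in> Hom (F0 W j) w w'"
        show "cmp (HomC C d (F0 X j)) (fo (M j) w) (fo (M j) w') (fo (M' j) w') (m j w') (fa (M j) w w' v) =
          cmp (HomC C d (F0 X j)) (fo (M j) w) (fo (M' j) w) (fo (M' j) w') (fa (M' j) w w' v) (m j w)"
          using nat_natural[OF pn[OF j], of w w' v]
          by (intro P_inj2[of d "F0 X j" "fo (M j) w" "fo (M' j) w'"])
            (simp_all add: m ftor_cmp[OF tf_ftor[OF P]] mp)
      qed (simp_all add: m ext)
    next
      fix j k u w assume [simp]: "j \<in> Ob0 J" "k \<in> Ob0 J" "u \<in> cells1 J j k" "w \<in> Ob (F0 W j)"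
      have k: "fo (fo (FH W j k) u) w \<in> Ob (F0 W k)" by simp
      \<comment> \<open>The preimage at \<open>fo (fo (FH W j k) u) w\<close> lies between the legs
        of \<open>M\<close> and \<open>M'\<close> at that object. The cone equations rewrite these
        legs as composites with \<open>u\<close>; only then are both sides seen to be parallel
        2-cells.\<close>
      have ok: "fo (M k) (fo (fo (FH W j k) u) w) = comp1 C d (F0 X j) (F0 X k) (fo (FH X j k) u) (fo (M j) w)"
        "fo (M' k) (fo (fo (FH W j k) u) w) = comp1 C d (F0 X j) (F0 X k) (fo (FH X j k) u) (fo (M' j) w)"
        by (simp_all add: cone_ob[OF C X d M] cone_ob[OF C X d M'])
      show "m k (fo (fo (FH W j k) u) w) =
          comp2 C d (F0 X j) (F0 X k) (fo (FH X j k) u) (fo (FH X j k) u) (fo (M j) w) (fo (M' j) w)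
          (id2 C (F0 X j) (F0 X k) (fo (FH X j k) u)) (m j w)"
        using m[of k, OF _ k] mp[of k, OF _ k] pe[of j k u w]
        by (intro P_inj2[of d "F0 X k" "comp1 C d (F0 X j) (F0 X k) (fo (FH X j k) u) (fo (M j) w)"
              "comp1 C d (F0 X j) (F0 X k) (fo (FH X j k) u) (fo (M' j) w)"])
          (simp_all add: m ok tf_comp2[OF P] P_id2 mp)
    qed (rule ext)
    moreover have "?I m = p"
      by (rule family_eqI)
        (simp_all add: mp nat_ext[OF pn] mod_ext[OF D PX tf_ob[OF P d] cone_image_in[OF d M] cone_image_in[OF d M'] p])
    ultimately show "p \<in> ?I ` ?A" by blast
  qed
qed

text \<open>On 2-cells the claim is formal. On 1-cells, the 1-cell \<open>h\<close> that mediates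
  the image of a cone \<open>M\<close> is at first one of \<open>D\<close> only, and
  \<open>lift\<close> brings it back to \<open>C\<close>. Its premise is met because composing
  \<open>h\<close> with the projections gives the legs of the image of \<open>M\<close>. Injectivity
  on 1-cells then makes the lift mediate \<open>M\<close> itself, and uniquely.\<close>

theorem reflects_limit:
  assumes l: "l \<in> Ob0 C" and L: "L \<in> two_nats J W (rep_ftor J C X l)"
    and lim: "is_weighted_limit J W D (two_ftor_comp J \<Phi> X) (F0 \<Phi> l) (cone_image J W X \<Phi> l L)"
    and lift: "\<And>d h. \<lbrakk>d \<in> Ob0 C; h \<in> cells1 D (F0 \<Phi> d) (F0 \<Phi> l);
      (\<And>j w. j \<in> Ob0 J \<Longrightarrow> w \<in> Ob (F0 W j) \<Longrightarrow> comp1 D (F0 \<Phi> d) (F0 \<Phi> l) (F0 \<Phi> (F0 X j)) (fo (FH \<Phi> l (F0 X j)) (fo (L j) w)) h \<in> fo (FH \<Phi> d (F0 X j)) ` cells1 C d (F0 X j))\<rbrakk> \<Longrightarrow>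
      h \<in> fo (FH \<Phi> d l) ` cells1 C d l"
  shows "is_weighted_limit J W C X l L"
  unfolding is_weighted_limit_def
proof (intro conjI ballI)
  show "L \<in> Ob (cones J W C X l)" using L by simp
  fix d assume d: "d \<in> Ob0 C"
  note dD = tf_ob[OF P d]
  let ?X = "two_ftor_comp J \<Phi> X" and ?I = "cone_image J W X \<Phi> d"
  let ?K = "cone_comparison J W C X l L d"
  let ?K' = "cone_comparison J W D ?X (F0 \<Phi> l) (cone_image J W X \<Phi> l L) (F0 \<Phi> d)"
  have K: "?K \<in> functors (HomC C d l) (cones J W C X d)"
    by (rule cone_comparison_functor[OF C X d l L])
  have K': "?K' \<in> functors (HomC D (F0 \<Phi> d) (F0 \<Phi> l)) (cones J W D ?X (F0 \<Phi> d))"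
    and K'b: "bij_betw (fo ?K') (cells1 D (F0 \<Phi> d) (F0 \<Phi> l)) (two_nats J W (rep_ftor J D ?X (F0 \<Phi> d)))"
    and K'ff: "full_faithful (HomC D (F0 \<Phi> d) (F0 \<Phi> l)) (cones J W D ?X (F0 \<Phi> d)) ?K'"
    using lim dD by (auto simp: is_weighted_limit_def iso_of_categories_def)
  note Lf = cone_ftor[OF C X l L]
  note [simp] = d l tf_ob[OF X] ftor_ob[OF tf_ftor[OF X]] tf_ob[OF P] ftor_rules[OF tf_ftor[OF P]]
    tc_cat[OF C] cat_id W_cat ftor_rules[OF Lf]
  have Kob: "fo ?K g \<in> two_nats J W (rep_ftor J C X d)" if "g \<in> cells1 C d l" for g
    using ftor_ob[OF K that] by simp
  note com = cone_image_comparison[OF d l L]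
  have "bij_betw (fo ?K) (cells1 C d l) (two_nats J W (rep_ftor J C X d))"
    unfolding bij_betw_def
  proof (intro conjI inj_onI equalityI subsetI)
    fix g g' assume g: "g \<in> cells1 C d l" "g' \<in> cells1 C d l" "fo ?K g = fo ?K g'"
    then have "fo ?K' (fo (FH \<Phi> d l) g) = fo ?K' (fo (FH \<Phi> d l) g')"
      using com[OF g(1)] com[OF g(2)] by simp
    then have "fo (FH \<Phi> d l) g = fo (FH \<Phi> d l) g'"
      by (rule inj_onD[OF bij_betw_imp_inj_on[OF K'b]]) (use g in simp_all)
    then show "g = g'" using inj[OF d l] g by (simp add: inj_on_eq_iff)
  next
    fix M assume M: "M \<in> two_nats J W (rep_ftor J C X d)"
    note Mf = cone_ftor[OF C X d M]
    have "?I M \<in> two_nats J W (rep_ftor J D ?X (F0 \<Phi> d))" by (rule cone_image_in[OF d M])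
    then have "?I M \<in> fo ?K' ` cells1 D (F0 \<Phi> d) (F0 \<Phi> l)"
      unfolding bij_betw_imp_surj_on[OF K'b] .
    then obtain h where h: "h \<in> cells1 D (F0 \<Phi> d) (F0 \<Phi> l)" "fo ?K' h = ?I M"
      by (elim imageE) simp
    have "h \<in> fo (FH \<Phi> d l) ` cells1 C d l"
    proof (rule lift[OF d h(1)])
      fix j w assume [simp]: "j \<in> Ob0 J" "w \<in> Ob (F0 W j)"
      have "comp1 D (F0 \<Phi> d) (F0 \<Phi> l) (F0 \<Phi> (F0 X j)) (fo (FH \<Phi> l (F0 X j)) (fo (L j) w)) h = fo (fo ?K' h j) w"
        using h(1) by simp
      also have "\<dots> = fo (FH \<Phi> d (F0 X j)) (fo (M j) w)"
        unfolding h(2) by simp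
      finally show "comp1 D (F0 \<Phi> d) (F0 \<Phi> l) (F0 \<Phi> (F0 X j)) (fo (FH \<Phi> l (F0 X j)) (fo (L j) w)) h
          \<in> fo (FH \<Phi> d (F0 X j)) ` cells1 C d (F0 X j)"
        using ftor_ob[OF Mf] by simp
    qed
    then obtain g where g: "g \<in> cells1 C d l" "h = fo (FH \<Phi> d l) g" by blast
    have "fo ?K g = M"
      by (rule cone_image_inj[OF d Kob[OF g(1)] M]) (use com[OF g(1)] h(2) g(2) in simp)
    then show "M \<in> fo ?K ` cells1 C d l" using g(1) by blast
  qed (auto simp: Kob)
  moreover have "full_faithful (HomC C d l) (cones J W C X d) ?K"
    unfolding full_faithful_def
  proof (intro ballI)
    fix g g' assume g [simp]: "g \<in> cells1 C d l" "g' \<in> cells1 C d l"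
    let ?J = "\<lambda>m. \<lambda>j\<in>Ob0 J. \<lambda>w\<in>Ob (F0 W j).
      fa (FH \<Phi> d (F0 X j)) (fo (fo ?K g j) w) (fo (fo ?K g' j) w) (m j w)"
    let ?A = "cells2 C d l g g'" and ?B = "modifications J W (rep_ftor J C X d) (fo ?K g) (fo ?K g')"
    let ?C = "modifications J W (rep_ftor J D ?X (F0 \<Phi> d)) (?I (fo ?K g)) (?I (fo ?K g'))"
    \<comment> \<open>Two out of three: the square formed by the two comparisons, by
      \<open>\<Phi>\<close> on 2-cells and by its action \<open>?J\<close> on modifications
      commutes, and its sides other than \<open>fa ?K g g'\<close> are bijections.\<close>
    have b1: "bij_betw ?J ?B ?C" by (rule modification_image_bij[OF d Kob Kob]) (rule g)+
    have "bij_betw (fa ?K' (fo (FH \<Phi> d l) g) (fo (FH \<Phi> d l) g') \<circ> fa (FH \<Phi> d l) g g') ?A ?C"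
      using K'ff by (intro bij_betw_trans[OF P_bij[OF d l g]]) (simp add: full_faithful_def com)
    moreover have "(?J \<circ> fa ?K g g') \<alpha> = (fa ?K' (fo (FH \<Phi> d l) g) (fo (FH \<Phi> d l) g') \<circ> fa (FH \<Phi> d l) g g') \<alpha>"
      if a: "\<alpha> \<in> ?A" for \<alpha>
      unfolding comp_apply
      by (rule family_eqI) (use a in \<open>simp_all add: tf_comp2[OF P] P_id2\<close>)
    ultimately have b2: "bij_betw (?J \<circ> fa ?K g g') ?A ?C"
      using bij_betw_cong by blast
    have "fa ?K g g' ` ?A \<subseteq> ?B" using ftor_hom[OF K g] by auto
    with b1 b2 show "bij_betw (fa ?K g g') ?A (Hom (cones J W C X d) (fo ?K g) (fo ?K g'))"
      using bij_betw_comp_iff2[OF b1, of "fa ?K g g'" ?A] by simp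
  qed
  ultimately show "iso_of_categories (HomC C d l) (cones J W C X d) ?K"
    using K by (simp add: iso_of_categories_def)
qed (use l in simp_all)

end

end

section \<open>Small sets\<close>

lemma small_inj:
  assumes "small U T" "inj_on f S" "f ` S \<subseteq> T"
  shows "small U S"
  using assms unfolding small_def by (meson card_of_ordLeq ordLeq_ordLess_trans)

lemma small_image: "small U S \<Longrightarrow> small U (f ` S)"
  unfolding small_def by (meson card_of_image ordLeq_ordLess_trans)

lemma small_subset: "small U T \<Longrightarrow> S \<subseteq> T \<Longrightarrow> small U S"
  by (rule small_inj[of U T "\<lambda>x. x"]) auto

text \<open>The closure conditions of \<open>universe\<close> concern sets of elements of
  \<open>'u\<close>. Codings carry them over to small sets of any type.\<close>

lemma small_code:
  assumes "small TYPE('u) S"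
  obtains e :: "'x \<Rightarrow> 'u" where "inj_on e S"
  using assms unfolding small_def by (meson card_of_ordLeq ordLess_imp_ordLeq)

lemma small_Pow:
  assumes "universe TYPE('u)" "small TYPE('u) S"
  shows "small TYPE('u) (Pow S)"
proof -
  obtain e :: "'a \<Rightarrow> 'u" where e: "inj_on e S" using assms(2) by (rule small_code)
  have "small TYPE('u) (Pow (e ` S))"
    using assms small_image unfolding universe_def by blast
  then show ?thesis
    by (rule small_inj[where f = "image e"]) (use e in \<open>auto intro: inj_on_image_Pow\<close>)
qed

text \<open>The union condition asks for index and members in \<open>'u\<close>, so the index set
  and every fibre are coded. The codes of pairs stay apart thanks to an injection \<open>q\<close>
  of \<open>'u \<times> 'u\<close> into \<open>'u\<close>, which exists since \<open>'u\<close> is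
  infinite.\<close>

lemma small_Sigma:
  assumes U: "universe TYPE('u)" and S: "small TYPE('u) S" and B: "\<And>i. i \<in> S \<Longrightarrow> small TYPE('u) (B i)"
  shows "small TYPE('u) (Sigma S B)"
proof -
  obtain e :: "'a \<Rightarrow> 'u" where e: "inj_on e S" using S by (rule small_code)
  have "\<forall>i\<in>S. \<exists>g :: 'b \<Rightarrow> 'u. inj_on g (B i)" using B by (meson small_code)
  then obtain g :: "'a \<Rightarrow> 'b \<Rightarrow> 'u" where g: "\<And>i. i \<in> S \<Longrightarrow> inj_on (g i) (B i)" by metis
  have "infinite (UNIV :: 'u set)" using U by (simp add: universe_def)
  from card_of_Times_same_infinite[OF this] obtain q :: "'u \<times> 'u \<Rightarrow> 'u" where q: "inj q"
    by (auto simp: card_of_ordIso[symmetric] bij_betw_def)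
  let ?h = "\<lambda>(i, x). q (e i, g i x)"
  have "small TYPE('u) (\<Union>j\<in>e ` S. (\<lambda>y. q (j, y)) ` g (inv_into S e j) ` B (inv_into S e j))"
    by (rule U[unfolded universe_def, THEN conjunct2, THEN conjunct2, rule_format])
      (use S B e in \<open>auto simp: small_image\<close>)
  moreover have "inj_on ?h (Sigma S B)"
  proof (rule inj_onI, clarify)
    fix i x i' x' assume i: "i \<in> S" "i' \<in> S" and x: "x \<in> B i" "x' \<in> B i'" and "q (e i, g i x) = q (e i', g i' x')"
    then have eq: "e i = e i'" "g i x = g i' x'" by (simp_all add: inj_eq[OF q])
    from inj_onD[OF e eq(1)] i have [simp]: "i' = i" by simp
    from inj_onD[OF g[OF i(1)], of x x'] eq x show "i = i' \<and> x = x'" by simp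
  qed
  moreover have "?h ` Sigma S B \<subseteq> (\<Union>j\<in>e ` S. (\<lambda>y. q (j, y)) ` g (inv_into S e j) ` B (inv_into S e j))"
  proof
    fix z assume "z \<in> ?h ` Sigma S B"
    then obtain i x where ix: "i \<in> S" "x \<in> B i" "z = q (e i, g i x)" by auto
    then show "z \<in> (\<Union>j\<in>e ` S. (\<lambda>y. q (j, y)) ` g (inv_into S e j) ` B (inv_into S e j))"
      by (intro UN_I[of "e i"]) (simp_all add: inv_into_f_f[OF e])
  qed
  ultimately show ?thesis by (rule small_inj)
qed

text \<open>A function is coded by its graph, a subset of \<open>Sigma S B\<close>; since it is
  extensional outside \<open>S\<close>, the graph determines it.\<close>

lemma small_PiE:
  assumes U: "universe TYPE('u)" and S: "small TYPE('u) S" and B: "\<And>i. i \<in> S \<Longrightarrow> small TYPE('u) (B i)"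
  shows "small TYPE('u) (PiE S B)"
proof (rule small_inj[where f = "\<lambda>f. (\<lambda>i. (i, f i)) ` S"])
  show "small TYPE('u) (Pow (Sigma S B))" by (intro small_Pow small_Sigma assms)
  show "inj_on (\<lambda>f. (\<lambda>i. (i, f i)) ` S) (PiE S B)"
    by (intro inj_onI PiE_ext) auto
qed auto

section \<open>Presheaves\<close>

lemma op_cat_simps [simp]:
  "Ob (op_cat A) = Ob A" "Hom (op_cat A) x y = Hom A y x" "idn (op_cat A) = idn A"
  "cmp (op_cat A) x y z g f = cmp A z y x f g"
  by (simp_all add: op_cat_def)

lemma category_op: "category A \<Longrightarrow> category (op_cat A)"
  by (rule categoryI) (simp_all add: cat_id cat_cmp cat_idl cat_idr cat_assoc)

lemma SET_simps [simp]:
  "Ob (SET :: ('u set, 'u \<Rightarrow> 'u) category) = {S. small TYPE('u) S}" "Hom SET S T = (S \<rightarrow>\<^sub>E T)"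
  "idn SET S = (\<lambda>x\<in>S. x)" "cmp SET S T V g f = compose S g f"
  by (simp_all add: SET_def)

lemma category_SET: "category SET"
proof (rule categoryI)
  fix f :: "'u \<Rightarrow> 'u" and S T assume "f \<in> Hom SET S T"
  then have "f \<in> S \<rightarrow>\<^sub>E T" by simp
  then show "cmp SET S T T (idn SET T) f = f" "cmp SET S S T f (idn SET S) = f"
    by (auto simp: compose_def restrict_def fun_eq_iff PiE_def extensional_def Pi_def)
qed (auto simp: compose_def restrict_def fun_eq_iff PiE_def extensional_def)

lemma category_psh: "category (psh A)"
  unfolding psh_def by (rule category_functor_category[OF category_SET])

lemma psh_simps [simp]:
  "Ob (psh A) = functors (op_cat A) SET" "Hom (psh A) = nats (op_cat A) SET"
  by (simp_all add: psh_def)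

lemma psh_cmp_app [simp]:
  "a \<in> Ob A \<Longrightarrow> p \<in> fo P a \<Longrightarrow> cmp (psh A) P Q R n m a p = n a (m a p)"
  by (simp add: psh_def compose_def)

lemma psh_idn_app [simp]: "a \<in> Ob A \<Longrightarrow> p \<in> fo P a \<Longrightarrow> idn (psh A) P a p = p"
  by (simp add: psh_def)

context
  fixes A :: "('a, 'u) category" and P :: "('a, 'u) presheaf"
  assumes P: "P \<in> functors (op_cat A) SET"
begin

lemma psh_small: "a \<in> Ob A \<Longrightarrow> small TYPE('u) (fo P a)"
  using ftor_ob[OF P] by simp

lemma psh_act: "\<lbrakk>a \<in> Ob A; b \<in> Ob A; f \<in> Hom A b a; p \<in> fo P a\<rbrakk> \<Longrightarrow>
      fa P a b f p \<in> fo P b"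
  using ftor_hom[OF P, of a b f] by auto

lemma psh_id: "a \<in> Ob A \<Longrightarrow> p \<in> fo P a \<Longrightarrow> fa P a a (idn A a) p = p"
  using ftor_id[OF P, of a] by simp

lemma psh_cmp: "\<lbrakk>a \<in> Ob A; b \<in> Ob A; c \<in> Ob A; f \<in> Hom A b a; g \<in> Hom A c b;
      p \<in> fo P a\<rbrakk> \<Longrightarrow>
      fa P a c (cmp A c b a f g) p = fa P b c g (fa P a b f p)"
  using ftor_cmp[OF P, of a b c f g] by (simp add: compose_def)

end

lemma mk_psh:
  fixes S :: "'a \<Rightarrow> 'u set" and A :: "('a, 'u) category"
  assumes A: "category A" and "\<And>a. a \<in> Ob A \<Longrightarrow> small TYPE('u) (S a)"
    and act: "\<And>a b f p. \<lbrakk>a \<in> Ob A; b \<in> Ob A; f \<in> Hom A b a; p \<in> S a\<rbrakk> \<Longrightarrow>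
      M a b f p \<in> S b"
    and id: "\<And>a p. a \<in> Ob A \<Longrightarrow> p \<in> S a \<Longrightarrow> M a a (idn A a) p = p"
    and cmp: "\<And>a b c f g p. \<lbrakk>a \<in> Ob A; b \<in> Ob A; c \<in> Ob A; f \<in> Hom A b a; g \<in> Hom A c b;
      p \<in> S a\<rbrakk> \<Longrightarrow>
      M a c (cmp A c b a f g) p = M b c g (M a b f p)"
  shows "mk_ftor (op_cat A) S (\<lambda>a b f. \<lambda>p\<in>S a. M a b f p) \<in> functors (op_cat A) SET"
  by (rule mk_ftor_in_functors[OF category_op[OF A]])
    (use assms in \<open>auto simp: compose_def restrict_def fun_eq_iff\<close>)

lemma pm_app: "\<lbrakk>m \<in> nats (op_cat A) SET P Q; a \<in> Ob A; p \<in> fo P a\<rbrakk> \<Longrightarrow>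
      m a p \<in> fo Q a"
  using nat_hom[of m "op_cat A" SET P Q a] by auto

lemma pm_nat:
  "\<lbrakk>m \<in> nats (op_cat A) SET P Q; a \<in> Ob A; b \<in> Ob A; f \<in> Hom A b a;
      p \<in> fo P a\<rbrakk> \<Longrightarrow>
      m b (fa P a b f p) = fa Q a b f (m a p)"
  using nat_natural[of m "op_cat A" SET P Q a b f] by (auto simp: compose_def restrict_def dest!: fun_cong[of _ _ p])

lemma pmI:
  assumes P: "P \<in> functors (op_cat A) SET" and Q: "Q \<in> functors (op_cat A) SET"
    and "m \<in> extensional (Ob A)" "\<And>a. a \<in> Ob A \<Longrightarrow> m a \<in> extensional (fo P a)"
    and "\<And>a p. a \<in> Ob A \<Longrightarrow> p \<in> fo P a \<Longrightarrow> m a p \<in> fo Q a"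
    and nat: "\<And>a b f p. \<lbrakk>a \<in> Ob A; b \<in> Ob A; f \<in> Hom A b a; p \<in> fo P a\<rbrakk> \<Longrightarrow>
      m b (fa P a b f p) = fa Q a b f (m a p)"
  shows "m \<in> nats (op_cat A) SET P Q"
  by (rule natsI) (use assms in \<open>auto simp: compose_def restrict_def fun_eq_iff PiE_def\<close>)

lemma pm_eqI:
  assumes m: "m \<in> nats (op_cat A) SET P Q" and n: "n \<in> nats (op_cat A) SET P Q'"
    and "\<And>a p. a \<in> Ob A \<Longrightarrow> p \<in> fo P a \<Longrightarrow> m a p = n a p"
  shows "m = n"
proof (rule nat_eqI[OF m n])
  fix a assume "a \<in> Ob (op_cat A)"
  then show "m a = n a"
    using nat_hom[OF m, of a] nat_hom[OF n, of a] assms(3) by (intro extensionalityI[of _ "fo P a"]) (auto simp: PiE_def)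
qed

lemma pm_isoI:
  assumes P: "P \<in> functors (op_cat A) SET" and Q: "Q \<in> functors (op_cat A) SET"
    and m: "m \<in> nats (op_cat A) SET P Q" and b: "\<And>a. a \<in> Ob A \<Longrightarrow> bij_betw (m a) (fo P a) (fo Q a)"
  shows "is_iso (psh A) P Q m"
  unfolding psh_def nat_iso_iff[OF category_SET P Q]
proof (intro conjI ballI m)
  fix a assume "a \<in> Ob (op_cat A)"
  then have a: "a \<in> Ob A" by simp
  let ?g = "\<lambda>y\<in>fo Q a. inv_into (fo P a) (m a) y"
  note i = bij_betw_imp_inj_on[OF b[OF a]] and s = bij_betw_imp_surj_on[OF b[OF a]]
  show "is_iso SET (fo P a) (fo Q a) (m a)"
  proof (rule is_isoI[of _ _ _ _ ?g])
    show "m a \<in> Hom SET (fo P a) (fo Q a)" using nat_hom[OF m] a by simp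
    show "?g \<in> Hom SET (fo Q a) (fo P a)" using s by (auto intro: inv_into_into)
    show "cmp SET (fo P a) (fo Q a) (fo P a) ?g (m a) = idn SET (fo P a)"
      using i s by (auto simp: compose_def fun_eq_iff restrict_def)
    show "cmp SET (fo Q a) (fo P a) (fo Q a) (m a) ?g = idn SET (fo Q a)"
      using i s by (auto simp: compose_def fun_eq_iff restrict_def f_inv_into_f)
  qed
qed

lemma small_pm:
  assumes U: "universe TYPE('u)" and A: "small TYPE('u) (Ob A)"
    and P: "P \<in> functors (op_cat A) SET" and Q: "Q \<in> functors (op_cat A) SET"
  shows "small TYPE('u) (nats (op_cat A) SET P (Q :: ('a, 'u) presheaf))"
proof (rule small_subset)
  show "small TYPE('u) (PiE (Ob A) (\<lambda>a. fo P a \<rightarrow>\<^sub>E fo Q a))"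
    by (intro small_PiE U A psh_small[OF P] psh_small[OF Q])
  show "nats (op_cat A) SET P Q \<subseteq> PiE (Ob A) (\<lambda>a. fo P a \<rightarrow>\<^sub>E fo Q a)"
  proof
    fix m assume "m \<in> nats (op_cat A) SET P Q"
    from nat_hom[OF this] nat_ext[OF this] show "m \<in> PiE (Ob A) (\<lambda>a. fo P a \<rightarrow>\<^sub>E fo Q a)"
      by (simp add: PiE_iff)
  qed
qed

text \<open>This is what places nerves in \<open>CAT2\<close>. A morphism of presheaves has a
  component at every object of \<open>A\<close>, whence the condition on
  \<open>Ob A\<close>.\<close>

lemma locally_small_psh:
  assumes "universe TYPE('u)" "small TYPE('u) (Ob A)"
  shows "locally_small TYPE('u) (psh (A :: ('a, 'u) category))"
  using small_pm[OF assms] by (auto simp: locally_small_def)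

subsection \<open>Nerves and the Yoneda lemma\<close>

context
  fixes A :: "('a, 'u) category" and E :: "('o, 'u) category" and I
  assumes A: "category A" and E: "category E" and lE: "locally_small TYPE('u) E" and I: "I \<in> functors A E"
begin

lemma nerve_ob [simp]:
  "e \<in> Ob E \<Longrightarrow> a \<in> Ob A \<Longrightarrow> fo (fo (nerve A E I) e) a = Hom E (fo I a) e"
  by (simp add: nerve_def)

lemma nerve_act [simp]:
  "\<lbrakk>e \<in> Ob E; a \<in> Ob A; b \<in> Ob A; f \<in> Hom A b a;
      g \<in> Hom E (fo I a) e\<rbrakk> \<Longrightarrow>
      fa (fo (nerve A E I) e) a b f g = cmp E (fo I b) (fo I a) e g (fa I b a f)"
  by (simp add: nerve_def)

lemma nerve_ar [simp]:
  "\<lbrakk>e \<in> Ob E; e' \<in> Ob E; h \<in> Hom E e e'; a \<in> Ob A;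
      g \<in> Hom E (fo I a) e\<rbrakk> \<Longrightarrow>
      fa (nerve A E I) e e' h a g = cmp E (fo I a) e e' h g"
  by (simp add: nerve_def)

lemma nerve_psh: 
  assumes e: "e \<in> Ob E"
  shows "fo (nerve A E I) e \<in> functors (op_cat A) SET"
proof -
  note [simp] = ftor_rules[OF I] ftor_id[OF I] ftor_cmp[OF I] A E e
  have "mk_ftor (op_cat A) (\<lambda>a. Hom E (fo I a) e)
            (\<lambda>a b f. \<lambda>g\<in>Hom E (fo I a) e. cmp E (fo I b) (fo I a) e g (fa I b a f)) \<in> functors (op_cat A) SET"
    by (rule mk_psh) (use lE in \<open>simp_all add: locally_small_def cat_cmp cat_idr cat_assoc\<close>)
  then show ?thesis by (simp add: nerve_def)
qed

lemma nerve_functor: "nerve A E I \<in> functors E (psh A)"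
proof -
  note [simp] = ftor_rules[OF I] ftor_id[OF I] ftor_cmp[OF I] A E nerve_psh cat_cmp
  let ?N = "nerve A E I"
  have h: "fa ?N e e' h \<in> nats (op_cat A) SET (fo ?N e) (fo ?N e')"
    if [simp]: "e \<in> Ob E" "e' \<in> Ob E" "h \<in> Hom E e e'" for e e' h
    by (rule pmI) (simp_all add: cat_assoc, simp_all add: nerve_def)
  have "mk_ftor E (fo ?N) (fa ?N) \<in> functors E (psh A)"
  proof (rule mk_ftor_in_functors[OF E])
    fix e assume [simp]: "e \<in> Ob E"
    show "fa ?N e e (idn E e) = idn (psh A) (fo ?N e)"
      by (rule pm_eqI[OF h cat_id[OF category_psh, simplified]]) (simp_all add: cat_id cat_idl)
  next
    fix e e' e'' h h' assume [simp]: "e \<in> Ob E" "e' \<in> Ob E" "e'' \<in> Ob E" "h \<in> Hom E e e'" "h' \<in> Hom E e' e''"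
    show "fa ?N e e'' (cmp E e e' e'' h' h) = cmp (psh A) (fo ?N e) (fo ?N e') (fo ?N e'') (fa ?N e' e'' h') (fa ?N e e' h)"
      by (rule pm_eqI[OF h cat_cmp[OF category_psh, simplified]]) (simp_all add: h cat_assoc)
  qed (simp_all add: h)
  then show ?thesis by (simp add: nerve_def)
qed

end

text \<open>The morphism from the representable at \<open>a\<close> to \<open>P\<close> that
  corresponds to the element \<open>p\<close> under the Yoneda lemma.\<close>

definition hat :: "('a, 'u) category \<Rightarrow> ('a, 'u) presheaf \<Rightarrow> 'a \<Rightarrow> 'u \<Rightarrow> ('a, 'u) presheaf_mor" where
  "hat A P a p = (\<lambda>b\<in>Ob A. \<lambda>f\<in>Hom A b a. fa P a b f p)"

context
  fixes A :: "('a, 'u) category"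
  assumes A: "category A" and lA: "locally_small TYPE('u) A"
begin

lemmas yoneda_functor = nerve_functor[OF A A lA id_ftor_in[OF A], folded yoneda_def]
  and yoneda_psh = nerve_psh[OF A A lA id_ftor_in[OF A], folded yoneda_def]

lemma yoneda_ob [simp]: "b \<in> Ob A \<Longrightarrow> a \<in> Ob A \<Longrightarrow> fo (fo (yoneda A) b) a = Hom A a b"
  using nerve_ob[OF A A lA id_ftor_in[OF A]] by (simp add: yoneda_def)

lemma yoneda_act [simp]:
  "\<lbrakk>c \<in> Ob A; a \<in> Ob A; b \<in> Ob A; f \<in> Hom A b a; g \<in> Hom A a c\<rbrakk> \<Longrightarrow>
      fa (fo (yoneda A) c) a b f g = cmp A b a c g f"
  using nerve_act[OF A A lA id_ftor_in[OF A]] by (simp add: yoneda_def)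

lemma yoneda_ar [simp]:
  "\<lbrakk>c \<in> Ob A; c' \<in> Ob A; h \<in> Hom A c c'; a \<in> Ob A; g \<in> Hom A a c\<rbrakk> \<Longrightarrow>
      fa (yoneda A) c c' h a g = cmp A a c c' h g"
  using nerve_ar[OF A A lA id_ftor_in[OF A]] by (simp add: yoneda_def)

lemma hat_app [simp]: "b \<in> Ob A \<Longrightarrow> f \<in> Hom A b a \<Longrightarrow> hat A P a p b f = fa P a b f p"
  by (simp add: hat_def)

lemma hat_in:
  assumes P: "P \<in> functors (op_cat A) SET" and a: "a \<in> Ob A" and p: "p \<in> fo P a"
  shows "hat A P a p \<in> nats (op_cat A) SET (fo (yoneda A) a) P"
  by (rule pmI[OF yoneda_psh P]) (use a p A in \<open>simp_all add: hat_def psh_act[OF P] psh_cmp[OF P] cat_cmp\<close>)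

text \<open>With \<open>hat_eq\<close> this is the Yoneda lemma: evaluation at the identity is
  inverse to \<open>hat\<close>.\<close>

lemma hat_id: "\<lbrakk>P \<in> functors (op_cat A) SET; a \<in> Ob A; p \<in> fo P a\<rbrakk> \<Longrightarrow>
      hat A P a p a (idn A a) = p"
  by (simp add: cat_id[OF A] psh_id)

lemma hat_eq:
  assumes P: "P \<in> functors (op_cat A) SET" and a: "a \<in> Ob A" and m: "m \<in> nats (op_cat A) SET (fo (yoneda A) a) P"
  shows "hat A P a (m a (idn A a)) = m"
proof (rule pm_eqI[OF hat_in[OF P a] m])
  show 1: "m a (idn A a) \<in> fo P a" using a by (simp add: pm_app[OF m] cat_id[OF A])
  fix b f assume "b \<in> Ob A" "f \<in> fo (fo (yoneda A) a) b"
  then show "hat A P a (m a (idn A a)) b f = m b f"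
    using a pm_nat[OF m, of a b f "idn A a"] by (simp add: cat_id[OF A] cat_idl[OF A])
qed

lemma hat_cmp:
  assumes P: "P \<in> functors (op_cat A) SET" and Q: "Q \<in> functors (op_cat A) SET"
    and a: "a \<in> Ob A" and p: "p \<in> fo P a" and m: "m \<in> nats (op_cat A) SET P Q"
  shows "cmp (psh A) (fo (yoneda A) a) P Q m (hat A P a p) = hat A Q a (m a p)"
  by (rule pm_eqI[OF cat_cmp[OF category_psh, simplified] hat_in])
    (use assms in \<open>simp_all add: yoneda_psh hat_in pm_app pm_nat[OF m]\<close>)

text \<open>Naturality of the Yoneda correspondence in the object; it makes the morphisms
  \<open>hat A P a p\<close> a cocone over the elements of \<open>P\<close>.\<close>

lemma hat_act:
  assumes P: "P \<in> functors (op_cat A) SET" and a: "a \<in> Ob A" and b: "b \<in> Ob A" and f: "f \<in> Hom A b a" and p: "p \<in> fo P a"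
  shows "hat A P b (fa P a b f p) =
    cmp (psh A) (fo (yoneda A) b) (fo (yoneda A) a) P (hat A P a p) (fa (yoneda A) b a f)"
proof (rule pm_eqI[OF hat_in cat_cmp[OF category_psh, simplified]])
  show "fa (yoneda A) b a f \<in> nats (op_cat A) SET (fo (yoneda A) b) (fo (yoneda A) a)"
    using ftor_hom[OF yoneda_functor b a f] by simp
qed (use assms A in \<open>simp_all add: yoneda_psh hat_in psh_act[OF P] psh_cmp[OF P] cat_cmp\<close>)

lemma hat_yoneda: "\<lbrakk>a \<in> Ob A; b \<in> Ob A; f \<in> Hom A a b\<rbrakk> \<Longrightarrow>
      hat A (fo (yoneda A) b) a f = fa (yoneda A) a b f"
  using hat_eq[OF yoneda_psh, of b a "fa (yoneda A) a b f"] ftor_hom[OF yoneda_functor, of a b f] A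
  by (simp add: cat_id cat_idr)

end

section \<open>Colimits weighted by presheaves\<close>

text \<open>A colimit of \<open>F : A \<rightarrow> D\<close> weighted by the presheaf \<open>P\<close>, i.e. of \<open>F\<close> over the category of
  elements \<open>(a, p \<in> P a)\<close>.\<close>

definition cocone ::
  "('a, 'u) category \<Rightarrow> ('p, 'n) category \<Rightarrow> ('a, 'u, 'p, 'n) ftor \<Rightarrow> ('a, 'u) presheaf \<Rightarrow> 'p
     \<Rightarrow> ('a \<Rightarrow> 'u \<Rightarrow> 'n) \<Rightarrow> bool" where
  "cocone A D F P Q k \<longleftrightarrow>
     (\<forall>a\<in>Ob A. \<forall>p\<in>fo P a. k a p \<in> Hom D (fo F a) Q) \<and>
     (\<forall>a\<in>Ob A. \<forall>a'\<in>Ob A. \<forall>f\<in>Hom A a a'. \<forall>p\<in>fo P a'.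
        k a (fa P a' a f p) = cmp D (fo F a) (fo F a') Q (k a' p) (fa F a a' f))"

definition colim ::
  "('a, 'u) category \<Rightarrow> ('p, 'n) category \<Rightarrow> ('a, 'u, 'p, 'n) ftor \<Rightarrow> ('a, 'u) presheaf \<Rightarrow> 'p
     \<Rightarrow> ('a \<Rightarrow> 'u \<Rightarrow> 'n) \<Rightarrow> bool" where
  "colim A D F P C c \<longleftrightarrow> C \<in> Ob D \<and> cocone A D F P C c \<and>
     (\<forall>Q\<in>Ob D. \<forall>k. cocone A D F P Q k \<longrightarrow>
        (\<exists>m\<in>Hom D C Q. \<forall>a\<in>Ob A. \<forall>p\<in>fo P a. cmp D (fo F a) C Q m (c a p) = k a p)) \<and>
     (\<forall>Q\<in>Ob D. \<forall>m\<in>Hom D C Q. \<forall>m'\<in>Hom D C Q.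
        (\<forall>a\<in>Ob A. \<forall>p\<in>fo P a. cmp D (fo F a) C Q m (c a p) = cmp D (fo F a) C Q m' (c a p)) \<longrightarrow> m = m')"

lemma cocone_hom: "\<lbrakk>cocone A D F P Q k; a \<in> Ob A; p \<in> fo P a\<rbrakk> \<Longrightarrow>
      k a p \<in> Hom D (fo F a) Q"
  by (simp add: cocone_def)

lemma cocone_nat: "\<lbrakk>cocone A D F P Q k; a \<in> Ob A; a' \<in> Ob A; f \<in> Hom A a a';
      p \<in> fo P a'\<rbrakk> \<Longrightarrow>
      k a (fa P a' a f p) = cmp D (fo F a) (fo F a') Q (k a' p) (fa F a a' f)"
  by (simp add: cocone_def)

lemma cocone_cmp:
  assumes D: "category D" and F: "F \<in> functors A D" and k: "cocone A D F P Q k" and Q: "Q \<in> Ob D" "Q' \<in> Ob D"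
    and m: "m \<in> Hom D Q Q'"
  shows "cocone A D F P Q' (\<lambda>a p. cmp D (fo F a) Q Q' m (k a p))"
  unfolding cocone_def
  using assms by (auto simp: cocone_hom[OF k] cocone_nat[OF k] ftor_rules[OF F] cat_cmp cat_assoc)

lemma colimD:
  assumes "colim A D F P C c"
  shows colim_ob: "C \<in> Ob D" and colim_cocone: "cocone A D F P C c"
  using assms by (simp_all add: colim_def)

lemma colim_ex:
  assumes "colim A D F P C c" "Q \<in> Ob D" "cocone A D F P Q k"
  obtains m where "m \<in> Hom D C Q" "\<And>a p. a \<in> Ob A \<Longrightarrow> p \<in> fo P a \<Longrightarrow> cmp D (fo F a) C Q m (c a p) = k a p"
  using assms unfolding colim_def by blast

lemma colim_eq:
  assumes "colim A D F P C c" "Q \<in> Ob D" "m \<in> Hom D C Q" "m' \<in> Hom D C Q"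
    "\<And>a p. a \<in> Ob A \<Longrightarrow> p \<in> fo P a \<Longrightarrow> cmp D (fo F a) C Q m (c a p) = cmp D (fo F a) C Q m' (c a p)"
  shows "m = m'"
  using assms unfolding colim_def by blast

lemma colimI:
  assumes "C \<in> Ob D" "cocone A D F P C c"
    and "\<And>Q k. Q \<in> Ob D \<Longrightarrow> cocone A D F P Q k \<Longrightarrow>
        \<exists>m\<in>Hom D C Q. \<forall>a\<in>Ob A. \<forall>p\<in>fo P a. cmp D (fo F a) C Q m (c a p) = k a p"
    and "\<And>Q m m'. \<lbrakk>Q \<in> Ob D; m\<in>Hom D C Q; m'\<in>Hom D C Q;
      (\<And>a p. a\<in>Ob A \<Longrightarrow> p\<in>fo P a \<Longrightarrow> cmp D (fo F a) C Q m (c a p) = cmp D (fo F a) C Q m' (c a p))\<rbrakk> \<Longrightarrow>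
      m = m'"
  shows "colim A D F P C c"
  unfolding colim_def using assms(1,2) by (auto intro: assms(3,4))

text \<open>\<open>P\<close> has to be a presheaf, because the cocone equations read legs at
  \<open>fa P a' a f p\<close>, and the two families are known to agree only at elements of
  \<open>P\<close>.\<close>

lemma colim_cong:
  assumes "colim A D F P C c" "\<And>a p. a \<in> Ob A \<Longrightarrow> p \<in> fo P a \<Longrightarrow> c a p = c' a p"
    and "P \<in> functors (op_cat A) SET"
  shows "colim A D F P C c'"
  using assms(1) unfolding colim_def cocone_def by (simp add: assms(2) psh_act[OF assms(3)])

lemma colim_iso:
  assumes D: "category D" and F: "F \<in> functors A D"
    and C: "colim A D F P C c" and C': "colim A D F P C' c'" and m: "m \<in> Hom D C C'"
    and e: "\<And>a p. a \<in> Ob A \<Longrightarrow> p \<in> fo P a \<Longrightarrow> cmp D (fo F a) C C' m (c a p) = c' a p"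
  shows "is_iso D C C' m"
proof -
  note [simp] = D colim_ob[OF C] colim_ob[OF C'] m ftor_ob[OF F] cocone_hom[OF colim_cocone[OF C]]
    cocone_hom[OF colim_cocone[OF C']] cat_cmp cat_id
  obtain n where n: "n \<in> Hom D C' C" and ne: "\<And>a p. a \<in> Ob A \<Longrightarrow> p \<in> fo P a \<Longrightarrow> cmp D (fo F a) C' C n (c' a p) = c a p"
    using colim_ex[OF C' colim_ob[OF C] colim_cocone[OF C]] by blast
  have "cmp D C C' C n m = idn D C"
    by (rule colim_eq[OF C colim_ob[OF C]]) (use n in \<open>simp_all add: cat_assoc e ne cat_idl\<close>)
  moreover have "cmp D C' C C' m n = idn D C'"
    by (rule colim_eq[OF C' colim_ob[OF C']]) (use n in \<open>simp_all add: cat_assoc e ne cat_idl\<close>)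
  ultimately show ?thesis using m n by (intro is_isoI)
qed

lemma colim_transport:
  assumes D: "category D" and F: "F \<in> functors A D"
    and C: "colim A D F P C c" and C': "C' \<in> Ob D" and m: "is_iso D C C' m"
  shows "colim A D F P C' (\<lambda>a p. cmp D (fo F a) C C' m (c a p))"
proof -
  note [simp] = D colim_ob[OF C] C' iso_hom[OF m] cinv_hom[OF m] ftor_ob[OF F] cocone_hom[OF colim_cocone[OF C]]
  show ?thesis
  proof (rule colimI)
    show "cocone A D F P C' (\<lambda>a p. cmp D (fo F a) C C' m (c a p))"
      by (rule cocone_cmp[OF D F colim_cocone[OF C]]) simp_all
    fix Q assume Q [simp]: "Q \<in> Ob D"
    {
      fix k assume "cocone A D F P Q k"
      then obtain n where n: "n \<in> Hom D C Q" "\<And>a p. a \<in> Ob A \<Longrightarrow> p \<in> fo P a \<Longrightarrow> cmp D (fo F a) C Q n (c a p) = k a p"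
        using colim_ex[OF C Q] by blast
      then show "\<exists>m'\<in>Hom D C' Q. \<forall>a\<in>Ob A. \<forall>p\<in>fo P a. cmp D (fo F a) C' Q m' (cmp D (fo F a) C C' m (c a p)) = k a p"
        by (intro bexI[of _ "cmp D C' C Q n (cinv D C C' m)"])
          (use m in \<open>simp_all add: cat_cmp cat_assoc cinv_l_cancel\<close>)
    next
      fix n n' assume n [simp]: "n \<in> Hom D C' Q" "n' \<in> Hom D C' Q"
        and e: "\<And>a p. a \<in> Ob A \<Longrightarrow> p \<in> fo P a \<Longrightarrow> cmp D (fo F a) C' Q n (cmp D (fo F a) C C' m (c a p)) =
          cmp D (fo F a) C' Q n' (cmp D (fo F a) C C' m (c a p))"
      have "cmp D C C' Q n m = cmp D C C' Q n' m"
        by (rule colim_eq[OF C Q]) (simp_all add: cat_cmp cat_assoc e)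
      then show "n = n'" by - (rule iso_cancel_r[OF D _ _ Q m], simp_all)
    }
  qed simp
qed

text \<open>Composition with \<open>\<eta>\<close> and with its pointwise inverse translates between
  cocones on \<open>F'\<close> and cocones on \<open>F\<close>.\<close>

lemma colim_reindex:
  assumes D: "category D" and A: "category A" and F: "F \<in> functors A D" and F': "F' \<in> functors A D"
    and P: "P \<in> functors (op_cat A) SET"
    and C: "colim A D F' P C c" and n: "\<eta> \<in> nats A D F F'" and i: "\<And>a. a \<in> Ob A \<Longrightarrow> is_iso D (fo F a) (fo F' a) (\<eta> a)"
  shows "colim A D F P C (\<lambda>a p. cmp D (fo F a) (fo F' a) C (c a p) (\<eta> a))"
proof -
  note [simp] = D colim_ob[OF C] i cinv_hom[OF i] ftor_ob[OF F] ftor_ob[OF F'] ftor_hom[OF F] ftor_hom[OF F']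
    cocone_hom[OF colim_cocone[OF C]] nat_hom[OF n] psh_act[OF P]
  show ?thesis
  proof (rule colimI)
    show "cocone A D F P C (\<lambda>a p. cmp D (fo F a) (fo F' a) C (c a p) (\<eta> a))"
      unfolding cocone_def
      by (simp add: cat_cmp cat_assoc nat_natural[OF n] cocone_nat[OF colim_cocone[OF C]])
    fix Q assume Q [simp]: "Q \<in> Ob D"
    {
      fix k assume k: "cocone A D F P Q k"
      note [simp] = cocone_hom[OF k]
      have inv_nat: "cmp D (fo F' a) (fo F' a') (fo F a') (cinv D (fo F a') (fo F' a') (\<eta> a')) (fa F' a a' f) =
         cmp D (fo F' a) (fo F a) (fo F a') (fa F a a' f) (cinv D (fo F a) (fo F' a) (\<eta> a))"
        if "a \<in> Ob A" "a' \<in> Ob A" "f \<in> Hom A a a'" for a a' f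
        using nat_natural[OF cinv_nat[OF D F F' n i], of a a' f] that by simp
      have "cocone A D F' P Q (\<lambda>a p. cmp D (fo F' a) (fo F a) Q (k a p) (cinv D (fo F a) (fo F' a) (\<eta> a)))"
        unfolding cocone_def by (simp add: cat_cmp cat_assoc inv_nat cocone_nat[OF k])
      then obtain m where m: "m \<in> Hom D C Q" "\<And>a p. a \<in> Ob A \<Longrightarrow> p \<in> fo P a \<Longrightarrow>
         cmp D (fo F' a) C Q m (c a p) = cmp D (fo F' a) (fo F a) Q (k a p) (cinv D (fo F a) (fo F' a) (\<eta> a))"
        using colim_ex[OF C Q] by blast
      then show "\<exists>m\<in>Hom D C Q. \<forall>a\<in>Ob A. \<forall>p\<in>fo P a.
          cmp D (fo F a) C Q m (cmp D (fo F a) (fo F' a) C (c a p) (\<eta> a)) = k a p"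
        by (intro bexI[of _ m]) (simp_all add: m(2)[THEN cat_reassoc] cat_assoc cinv_l cat_idr)
    next
      fix m m' assume m [simp]: "m \<in> Hom D C Q" "m' \<in> Hom D C Q"
        and e: "\<And>a p. a \<in> Ob A \<Longrightarrow> p \<in> fo P a \<Longrightarrow> cmp D (fo F a) C Q m (cmp D (fo F a) (fo F' a) C (c a p) (\<eta> a)) =
          cmp D (fo F a) C Q m' (cmp D (fo F a) (fo F' a) C (c a p) (\<eta> a))"
      show "m = m'"
      proof (rule colim_eq[OF C Q m])
        fix a p assume [simp]: "a \<in> Ob A" "p \<in> fo P a"
        show "cmp D (fo F' a) C Q m (c a p) = cmp D (fo F' a) C Q m' (c a p)"
          using e[of a p] by - (rule iso_cancel_r[OF D _ _ Q i[of a]], simp_all add: cat_cmp cat_assoc)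
      qed
    }
  qed simp
qed

subsection \<open>Existence in presheaf categories\<close>

text \<open>Presheaves take values in sets of elements of \<open>'u\<close>, so a quotient of
  \<open>S\<close> cannot be a set of classes. Instead \<open>\<kappa>\<close> sends an element to
  the code of a chosen representative of its class under the equivalence relation generated by
  \<open>r\<close>.\<close>

lemma quotient_map:
  fixes S :: "'x set"
  assumes S: "small TYPE('u) S" and r: "r \<subseteq> S \<times> S"
  obtains \<kappa> :: "'x \<Rightarrow> 'u" where "\<And>x y. x \<in> S \<Longrightarrow> y \<in> S \<Longrightarrow> \<kappa> x = \<kappa> y \<longleftrightarrow> (x, y) \<in> (r \<union> r\<inverse>)\<^sup>*"
proof -
  obtain e :: "'x \<Rightarrow> 'u" where e: "inj_on e S" using S by (rule small_code)
  let ?R = "(r \<union> r\<inverse>)\<^sup>*"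
  have sym: "sym ?R" by (intro sym_rtrancl sym_Un_converse)
  \<comment> \<open>Representatives of elements of \<open>S\<close> stay in \<open>S\<close>, where
    \<open>e\<close> is injective.\<close>
  have S_R: "y \<in> S" if "(x, y) \<in> ?R" "x \<in> S" for x y
    using that by (induction rule: rtrancl_induct) (use r in auto)
  let ?nf = "\<lambda>x. SOME y. (x, y) \<in> ?R"
  have nf: "(x, ?nf x) \<in> ?R" for x
    by (rule someI[of "\<lambda>y. (x, y) \<in> ?R" x]) simp
  have nf_eq: "?nf x = ?nf y \<longleftrightarrow> (x, y) \<in> ?R" for x y
  proof
    assume "?nf x = ?nf y"
    then show "(x, y) \<in> ?R" using nf[of x] symD[OF sym nf[of y]] by (simp add: rtrancl_trans[of x "?nf y"])
  next
    assume "(x, y) \<in> ?R"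
    then have "(x, z) \<in> ?R \<longleftrightarrow> (y, z) \<in> ?R" for z
      using sym by (meson rtrancl_trans symD)
    then show "?nf x = ?nf y" by simp
  qed
  have "e (?nf x) = e (?nf y) \<longleftrightarrow> (x, y) \<in> ?R" if "x \<in> S" "y \<in> S" for x y
    using inj_on_eq_iff[OF e S_R[OF nf that(1)] S_R[OF nf that(2)]] nf_eq by blast
  then show thesis by (rule that)
qed

lemma equiv_closure_respects:
  assumes "(x, y) \<in> (r \<union> r\<inverse>)\<^sup>*" and "\<And>x y. (x, y) \<in> r \<Longrightarrow> h x = h y"
  shows "h x = h y"
  using assms(1) by (induction rule: rtrancl_induct) (use assms(2) in auto)

text \<open>The colimit is a coend computed at each object \<open>b\<close>: triples
  \<open>(a, p, u)\<close> with \<open>p\<close> in \<open>P a\<close> and \<open>u\<close> in the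
  presheaf \<open>F a\<close> at \<open>b\<close>, modulo moving an arrow of \<open>A\<close>
  between \<open>p\<close> and \<open>u\<close>. The universe conditions ensure that these triples
  form a small set.\<close>

lemma colim_exists:
  fixes A :: "('a, 'u) category" and B :: "('b, 'u) category"
  assumes U: "universe TYPE('u)" and A: "category A" and sA: "small TYPE('u) (Ob A)" and B: "category B"
    and F: "F \<in> functors A (psh B)" and P: "P \<in> functors (op_cat A) SET"
  shows "\<exists>C c. colim A (psh B) F P C c"
proof -
  note Fo = ftor_ob[OF F, simplified] and Fh = ftor_hom[OF F, simplified]
  define S where "S b = (SIGMA a : Ob A. fo P a \<times> fo (fo F a) b)" for b
  \<comment> \<open>Only the generating identifications, one for each arrow \<open>f\<close>;
    \<open>\<kappa> b\<close> names the classes of the equivalence relation that they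
    generate.\<close>
  define r where "r b = {((a, fa P a' a f p, u), (a', p, fa F a a' f b u)) | a a' f p u.
    a \<in> Ob A \<and> a' \<in> Ob A \<and> f \<in> Hom A a a' \<and> p \<in> fo P a' \<and> u \<in> fo (fo F a) b}" for b
  have sS: "small TYPE('u) (S b)" if "b \<in> Ob B" for b
    unfolding S_def by (intro small_Sigma U sA psh_small[OF P] psh_small[OF Fo] that)
  have rS: "r b \<subseteq> S b \<times> S b" if "b \<in> Ob B" for b
    unfolding S_def r_def by (auto simp: that psh_act[OF P] pm_app[OF Fh])
  have "\<forall>b. \<exists>\<kappa>::'a \<times> 'u \<times> 'u \<Rightarrow> 'u. b \<in> Ob B \<longrightarrow>
      (\<forall>x\<in>S b. \<forall>y\<in>S b. \<kappa> x = \<kappa> y \<longleftrightarrow> (x, y) \<in> (r b \<union> (r b)\<inverse>)\<^sup>*)"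
    using quotient_map[OF sS rS] by metis
  then obtain \<kappa> :: "'b \<Rightarrow> 'a \<times> 'u \<times> 'u \<Rightarrow> 'u" where
    \<kappa>: "\<And>b x y. \<lbrakk>b \<in> Ob B; x \<in> S b; y \<in> S b\<rbrakk> \<Longrightarrow>
      \<kappa> b x = \<kappa> b y \<longleftrightarrow> (x, y) \<in> (r b \<union> (r b)\<inverse>)\<^sup>*"
    by metis
  have resp: "h x = h y" if "b \<in> Ob B" "x \<in> S b" "y \<in> S b" "\<kappa> b x = \<kappa> b y" "\<And>x y. (x, y) \<in> r b \<Longrightarrow> h x = h y"
    for b x y and h :: "'a \<times> 'u \<times> 'u \<Rightarrow> 'u"
    using equiv_closure_respects[of x y "r b" h] \<kappa>[of b x y] that by blast
  have \<kappa>r: "\<kappa> b x = \<kappa> b y" if "b \<in> Ob B" "(x, y) \<in> r b" for b x y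
    using \<kappa>[of b x y] that rS[of b] by blast
  have inv: "inv_into (S b) (\<kappa> b) (\<kappa> b x) \<in> S b" "\<kappa> b (inv_into (S b) (\<kappa> b) (\<kappa> b x)) = \<kappa> b x" if "x \<in> S b" for b x
    using inv_into_into[of "\<kappa> b x" "\<kappa> b" "S b"] f_inv_into_f[of "\<kappa> b x" "\<kappa> b" "S b"] that by auto
  \<comment> \<open>Maps out of the quotient are defined on representatives. A map that is constant
    along the generators does not see which representative was taken.\<close>
  have lift: "h (inv_into (S b) (\<kappa> b) (\<kappa> b x)) = h x" if "b \<in> Ob B" "x \<in> S b" "\<And>x y. (x, y) \<in> r b \<Longrightarrow> h x = h y"
    for b x and h :: "'a \<times> 'u \<times> 'u \<Rightarrow> 'u"
    by (rule resp[OF that(1) inv(1) that(2) inv(2) that(3)]) (use that(2) in simp_all)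
  define act where "act b b' g x = (case x of (a, p, u) \<Rightarrow> (a, p, fa (fo F a) b b' g u))"
    for b b' g and x :: "'a \<times> 'u \<times> 'u"
  have act_S: "act b b' g x \<in> S b'" if "x \<in> S b" "b \<in> Ob B" "b' \<in> Ob B" "g \<in> Hom B b' b" for b b' g x
    using that by (auto simp: S_def act_def psh_act[OF Fo])
  have act_r: "(act b b' g x, act b b' g y) \<in> r b'" if "(x, y) \<in> r b" "b \<in> Ob B" "b' \<in> Ob B" "g \<in> Hom B b' b" for b b' g x y
  proof -
    from that(1) obtain a a' f p u where xy: "x = (a, fa P a' a f p, u)" "y = (a', p, fa F a a' f b u)" and
      h: "a \<in> Ob A" "a' \<in> Ob A" "f \<in> Hom A a a'" "p \<in> fo P a'" "u \<in> fo (fo F a) b"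
      unfolding r_def by blast
    then show ?thesis using that(2-)
      unfolding r_def mem_Collect_eq
      by (intro exI[of _ a] exI[of _ a'] exI[of _ f] exI[of _ p] exI[of _ "fa (fo F a) b b' g u"])
        (auto simp: act_def psh_act[OF Fo] pm_nat[OF Fh])
  qed
  define C where "C = mk_ftor (op_cat B) (\<lambda>b. \<kappa> b ` S b)
    (\<lambda>b b' g. \<lambda>z\<in>\<kappa> b ` S b. \<kappa> b' (act b b' g (inv_into (S b) (\<kappa> b) z)))"
  have act_inv: "\<kappa> b' (act b b' g (inv_into (S b) (\<kappa> b) (\<kappa> b x))) = \<kappa> b' (act b b' g x)"
    if "b \<in> Ob B" "b' \<in> Ob B" "g \<in> Hom B b' b" "x \<in> S b" for b b' g x
    by (rule lift) (use that \<kappa>r act_r in auto)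
  have C: "C \<in> functors (op_cat B) SET"
    unfolding C_def
  proof (rule mk_psh[OF B])
    fix b assume b: "b \<in> Ob B"
    show "small TYPE('u) (\<kappa> b ` S b)" by (intro small_image sS b)
    fix z assume "z \<in> \<kappa> b ` S b"
    then obtain x where x: "x \<in> S b" "z = \<kappa> b x" by blast
    have "act b b (idn B b) x = x"
      using x(1) b by (auto simp: S_def act_def psh_id[OF Fo])
    then show "\<kappa> b (act b b (idn B b) (inv_into (S b) (\<kappa> b) z)) = z"
      using x b B by (simp add: act_inv cat_id)
    fix b' g assume b': "b' \<in> Ob B" "g \<in> Hom B b' b"
    then show "\<kappa> b' (act b b' g (inv_into (S b) (\<kappa> b) z)) \<in> \<kappa> b' ` S b'"
      using x b by (simp add: act_inv act_S)
    fix b'' g' assume b'': "b'' \<in> Ob B" "g' \<in> Hom B b'' b'"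
    have "act b b'' (cmp B b'' b' b g g') x = act b' b'' g' (act b b' g x)"
      using x(1) b b' b'' by (auto simp: S_def act_def psh_cmp[OF Fo])
    then show "\<kappa> b'' (act b b'' (cmp B b'' b' b g g') (inv_into (S b) (\<kappa> b) z)) =
       \<kappa> b'' (act b' b'' g' (inv_into (S b') (\<kappa> b') (\<kappa> b' (act b b' g (inv_into (S b) (\<kappa> b) z)))))"
      using x b b' b'' B by (simp add: act_inv act_S cat_cmp)
  qed
  have C_ob [simp]: "fo C b = \<kappa> b ` S b" if "b \<in> Ob B" for b
    using that by (simp add: C_def)
  have C_act: "fa C b b' g (\<kappa> b x) = \<kappa> b' (act b b' g x)"
    if "b \<in> Ob B" "b' \<in> Ob B" "g \<in> Hom B b' b" "x \<in> S b" for b b' g x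
    using that by (simp add: C_def act_inv)
  define c where "c a p = (\<lambda>b\<in>Ob B. \<lambda>u\<in>fo (fo F a) b. \<kappa> b (a, p, u))" for a p
  have c_app: "c a p b u = \<kappa> b (a, p, u)" if "b \<in> Ob B" "u \<in> fo (fo F a) b" for a p b u
    using that by (simp add: c_def)
  have S_I: "(a, p, u) \<in> S b" if "a \<in> Ob A" "p \<in> fo P a" "u \<in> fo (fo F a) b" for a p u b
    using that by (simp add: S_def)
  have c_hom: "c a p \<in> nats (op_cat B) SET (fo F a) C" if "a \<in> Ob A" "p \<in> fo P a" for a p
    by (rule pmI[OF Fo C])
      (use that in \<open>simp_all add: c_app C_act S_I psh_act[OF Fo] act_def, simp_all add: c_def\<close>)
  have "colim A (psh B) F P C c"
  proof (rule colimI)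
    show "cocone A (psh B) F P C c"
      unfolding cocone_def
    proof (intro conjI ballI)
      fix a a' f p assume h: "a \<in> Ob A" "a' \<in> Ob A" "f \<in> Hom A a a'" "p \<in> fo P a'"
      show "c a (fa P a' a f p) = cmp (psh B) (fo F a) (fo F a') C (c a' p) (fa F a a' f)"
      proof (rule pm_eqI[OF c_hom cat_cmp[OF category_psh, simplified]])
        fix b u assume "b \<in> Ob B" "u \<in> fo (fo F a) b"
        then show "c a (fa P a' a f p) b u = cmp (psh B) (fo F a) (fo F a') C (c a' p) (fa F a a' f) b u"
          using h by (auto simp: c_app pm_app[OF Fh] r_def intro!: \<kappa>r)
      qed (use h C in \<open>simp_all add: psh_act[OF P] Fo Fh c_hom\<close>)
    qed (simp add: c_hom)
  next
    fix Q k assume Q: "Q \<in> Ob (psh B)" and k: "cocone A (psh B) F P Q k"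
    then have Q': "Q \<in> functors (op_cat B) SET" by simp
    note kh = cocone_hom[OF k, simplified]
    define kk where "kk b x = (case x of (a, p, u) \<Rightarrow> k a p b u)" for b and x :: "'a \<times> 'u \<times> 'u"
    define m where "m = (\<lambda>b\<in>Ob B. \<lambda>z\<in>\<kappa> b ` S b. kk b (inv_into (S b) (\<kappa> b) z))"
    have kk_r: "kk b x = kk b y" if b: "b \<in> Ob B" and "(x, y) \<in> r b" for b x y
      using that cocone_nat[OF k] by (auto simp: r_def kk_def)
    have m_app: "m b (\<kappa> b x) = kk b x" if b: "b \<in> Ob B" and "x \<in> S b" for b x
      using that lift[of b x "kk b"] kk_r by (simp add: m_def)
    have m: "m \<in> nats (op_cat B) SET C Q"
    proof (rule pmI[OF C Q'])
      fix b z assume b: "b \<in> Ob B" "z \<in> fo C b"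
      then obtain x where x: "x \<in> S b" "z = \<kappa> b x" by auto
      then show "m b z \<in> fo Q b"
        using b by (auto simp: m_app kk_def S_def intro!: pm_app[OF kh])
      fix b' g assume b': "b' \<in> Ob B" "g \<in> Hom B b' b"
      have "kk b' (act b b' g x) = fa Q b b' g (kk b x)"
        using x(1) b b' by (auto simp: S_def kk_def act_def pm_nat[OF kh])
      then show "m b' (fa C b b' g z) = fa Q b b' g (m b z)"
        using x b b' by (simp add: m_app C_act act_S)
    qed (simp_all add: m_def)
    show "\<exists>m\<in>Hom (psh B) C Q. \<forall>a\<in>Ob A. \<forall>p\<in>fo P a. cmp (psh B) (fo F a) C Q m (c a p) = k a p"
    proof (intro bexI ballI)
      fix a p assume h: "a \<in> Ob A" "p \<in> fo P a"
      show "cmp (psh B) (fo F a) C Q m (c a p) = k a p"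
      proof (rule pm_eqI[OF cat_cmp[OF category_psh, simplified] kh])
        fix b u assume "b \<in> Ob B" "u \<in> fo (fo F a) b"
        then show "cmp (psh B) (fo F a) C Q m (c a p) b u = k a p b u"
          using h by (simp add: c_app m_app S_I kk_def)
      qed (use h C Q' m in \<open>simp_all add: Fo c_hom\<close>)
    qed (simp add: m)
  next
    fix Q m m' assume Q: "Q \<in> Ob (psh B)" and m: "m \<in> Hom (psh B) C Q" "m' \<in> Hom (psh B) C Q"
      and e: "\<And>a p. a \<in> Ob A \<Longrightarrow> p \<in> fo P a \<Longrightarrow>
        cmp (psh B) (fo F a) C Q m (c a p) = cmp (psh B) (fo F a) C Q m' (c a p)"
    show "m = m'"
    proof (rule pm_eqI[OF m[simplified]])
      fix b z assume b: "b \<in> Ob B" "z \<in> fo C b"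
      then obtain a p u where x: "a \<in> Ob A" "p \<in> fo P a" "u \<in> fo (fo F a) b" "z = \<kappa> b (a, p, u)" by (auto simp: S_def)
      then show "m b z = m' b z"
        using e[of a p, THEN fun_cong, of b, THEN fun_cong, of u] b(1) by (simp add: c_app)
    qed
  qed (simp add: C)
  then show ?thesis by blast
qed

subsection \<open>Pointwise Kan extensions along the Yoneda embedding\<close>

text \<open>A leg \<open>k a p\<close> starts at a representable, so it is determined by its value
  at the identity. These values form the mediating map; uniqueness follows by evaluating the legs at
  identities.\<close>

lemma yoneda_density:
  assumes A: "category A" and lA: "locally_small TYPE('u) (A :: ('a, 'u) category)" and P: "P \<in> functors (op_cat A) SET"
  shows "colim A (psh A) (yoneda A) P P (hat A P)"
proof (rule colimI)
  show "P \<in> Ob (psh A)" using P by simp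
  show "cocone A (psh A) (yoneda A) P P (hat A P)"
    by (simp add: cocone_def hat_in[OF A lA P] hat_act[OF A lA P])
next
  fix Q k assume Q: "Q \<in> Ob (psh A)" and k: "cocone A (psh A) (yoneda A) P Q k"
  then have Q': "Q \<in> functors (op_cat A) SET" by simp
  note [simp] = A lA cat_id[OF A] yoneda_psh[OF A lA]
  note kh = cocone_hom[OF k, simplified]
  note yh = ftor_hom[OF yoneda_functor[OF A lA], simplified]
  define m where "m = (\<lambda>a\<in>Ob A. \<lambda>p\<in>fo P a. k a p a (idn A a))"
  have m: "m \<in> nats (op_cat A) SET P Q"
  proof (rule pmI[OF P Q'])
    fix a b f p assume h: "a \<in> Ob A" "b \<in> Ob A" "f \<in> Hom A b a" "p \<in> fo P a"
    have "k b (fa P a b f p) b (idn A b) = k a p b (cmp A b b a f (idn A b))"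
      using h cocone_nat[OF k, of b a f p] by simp
    also have "\<dots> = k a p b (cmp A b a a (idn A a) f)" using h by (simp add: cat_idl cat_idr)
    also have "\<dots> = fa Q a b f (k a p a (idn A a))"
      using h pm_nat[OF kh, of a p a b f "idn A a"] by simp
    finally show "m b (fa P a b f p) = fa Q a b f (m a p)"
      using h by (simp add: m_def psh_act[OF P])
  next
    fix a p assume "a \<in> Ob A" "p \<in> fo P a"
    then show "m a p \<in> fo Q a" using pm_app[OF kh, of a p a "idn A a"] by (simp add: m_def)
  qed (simp_all add: m_def)
  show "\<exists>m\<in>Hom (psh A) P Q. \<forall>a\<in>Ob A. \<forall>p\<in>fo P a. cmp (psh A) (fo (yoneda A) a) P Q m (hat A P a p) = k a p"
  proof (intro bexI[of _ m] ballI)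
    fix a p assume "a \<in> Ob A" "p \<in> fo P a"
    then show "cmp (psh A) (fo (yoneda A) a) P Q m (hat A P a p) = k a p"
      by (subst hat_cmp[OF A lA P Q' _ _ m]) (simp_all add: m_def hat_eq[OF A lA Q' _ kh])
  qed (use m in simp)
next
  fix Q m m' assume Q: "Q \<in> Ob (psh A)" and m: "m \<in> Hom (psh A) P Q" "m' \<in> Hom (psh A) P Q"
    and e: "\<And>a p. a \<in> Ob A \<Longrightarrow> p \<in> fo P a \<Longrightarrow>
      cmp (psh A) (fo (yoneda A) a) P Q m (hat A P a p) = cmp (psh A) (fo (yoneda A) a) P Q m' (hat A P a p)"
  show "m = m'"
  proof (rule pm_eqI[OF m[simplified]])
    fix a p assume ap: "a \<in> Ob A" "p \<in> fo P a"
    then have "m a (hat A P a p a (idn A a)) = m' a (hat A P a p a (idn A a))"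
      using e[OF ap, THEN fun_cong, of a, THEN fun_cong, of "idn A a"] A lA by (simp add: cat_id)
    then show "m a p = m' a p" using ap by (simp add: hat_id[OF A lA P] del: hat_app)
  qed
qed

text \<open>The category of elements of a representable has the terminal object given by
  \<open>b\<close> and its identity, so the colimit is the value of \<open>F\<close> there and the
  mediating map is the leg \<open>k b (idn A b)\<close>.\<close>

lemma yoneda_colim:
  assumes A: "category A" and lA: "locally_small TYPE('u) (A :: ('a, 'u) category)"
    and D: "category D" and F: "F \<in> functors A D" and b: "b \<in> Ob A"
  shows "colim A D F (fo (yoneda A) b) (fo F b) (\<lambda>a f. fa F a b f)"
proof -
  note [simp] = A lA D b ftor_rules[OF F] cat_id
  show ?thesis
  proof (rule colimI)
    fix Q k assume [simp]: "Q \<in> Ob D" and k: "cocone A D F (fo (yoneda A) b) Q k"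
    show "\<exists>m\<in>Hom D (fo F b) Q. \<forall>a\<in>Ob A. \<forall>f\<in>fo (fo (yoneda A) b) a. cmp D (fo F a) (fo F b) Q m (fa F a b f) = k a f"
    proof (intro bexI[of _ "k b (idn A b)"] ballI)
      fix a f assume "a \<in> Ob A" "f \<in> fo (fo (yoneda A) b) a"
      then show "cmp D (fo F a) (fo F b) Q (k b (idn A b)) (fa F a b f) = k a f"
        using cocone_nat[OF k, of a b f "idn A b"] by (simp add: cat_idl)
    qed (use cocone_hom[OF k, of b "idn A b"] in simp)
  next
    fix Q m m' assume [simp]: "Q \<in> Ob D" "m \<in> Hom D (fo F b) Q" "m' \<in> Hom D (fo F b) Q"
      and e: "\<And>a f. a \<in> Ob A \<Longrightarrow> f \<in> fo (fo (yoneda A) b) a \<Longrightarrow>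
        cmp D (fo F a) (fo F b) Q m (fa F a b f) = cmp D (fo F a) (fo F b) Q m' (fa F a b f)"
    show "m = m'"
      using e[of b "idn A b"] by (simp add: ftor_id[OF F] cat_idr)
  qed (auto simp: cocone_def ftor_cmp[OF F])
qed

text \<open>The colimit formula for left Kan extensions along the Yoneda embedding. By the Yoneda
  lemma, the comma category of representables over \<open>P\<close> is the category of elements of
  \<open>P\<close>, which is why \<open>P\<close> itself is the weight.\<close>

definition ptwise ::
  "('a, 'u) category \<Rightarrow> ('p, 'n) category \<Rightarrow> ('a, 'u, 'p, 'n) ftor
    \<Rightarrow> (('a, 'u) presheaf, ('a, 'u) presheaf_mor, 'p, 'n) ftor \<Rightarrow> ('a \<Rightarrow> 'n) \<Rightarrow> bool" where
  "ptwise A D F G \<eta> \<longleftrightarrow> G \<in> functors (psh A) D \<and> \<eta> \<in> nats A D F (ftor_comp A G (yoneda A)) \<and>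
    (\<forall>P\<in>Ob (psh A). colim A D F P (fo G P)
      (\<lambda>a p. cmp D (fo F a) (fo G (fo (yoneda A) a)) (fo G P) (fa G (fo (yoneda A) a) P (hat A P a p)) (\<eta> a)))"

text \<open>Preservation of just those colimits that present a presheaf by representables, which is
  the form in which Kan extensions provide it. For locally small \<open>A\<close> and
  \<open>D\<close> it implies preservation of the other colimits weighted by presheaves
  (\<open>cocont_preserves_colim\<close>).\<close>

definition cocont ::
  "('a, 'u) category \<Rightarrow> ('p, 'n) category \<Rightarrow> (('a, 'u) presheaf, ('a, 'u) presheaf_mor, 'p, 'n) ftor \<Rightarrow> bool" where
  "cocont A D G \<longleftrightarrow> G \<in> functors (psh A) D \<and>
    (\<forall>P\<in>Ob (psh A). colim A D (ftor_comp A G (yoneda A)) P (fo G P) (\<lambda>a p. fa G (fo (yoneda A) a) P (hat A P a p)))"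

lemma cocont_ftor: "cocont A D G \<Longrightarrow> G \<in> functors (psh A) D"
  by (simp add: cocont_def)

lemma cocont_colim: "cocont A D G \<Longrightarrow> P \<in> Ob (psh A) \<Longrightarrow>
  colim A D (ftor_comp A G (yoneda A)) P (fo G P) (\<lambda>a p. fa G (fo (yoneda A) a) P (hat A P a p))"
  by (simp add: cocont_def)

lemma hat_hom: "\<lbrakk>category A; locally_small TYPE('u) A; P \<in> Ob (psh (A :: ('a, 'u) category));
      a \<in> Ob A; p \<in> fo P a\<rbrakk> \<Longrightarrow>
      hat A P a p \<in> Hom (psh A) (fo (yoneda A) a) P"
  using hat_in[of A P a p] by simp

lemma hat_comp: "\<lbrakk>category A; locally_small TYPE('u) A; P \<in> Ob (psh (A :: ('a, 'u) category));
      Q \<in> Ob (psh A); a \<in> Ob A; p \<in> fo P a; m \<in> Hom (psh A) P Q\<rbrakk> \<Longrightarrow>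
      cmp (psh A) (fo (yoneda A) a) P Q m (hat A P a p) = hat A Q a (m a p)"
  using hat_cmp[of A P Q a p m] by simp

context
  fixes A :: "('a, 'u) category" and D :: "('p, 'n) category"
  assumes A: "category A" and lA: "locally_small TYPE('u) A" and D: "category D"
begin

private lemmas yA = yoneda_functor[OF A lA] and yo = ftor_ob[OF yoneda_functor[OF A lA]] and yh = ftor_hom[OF yoneda_functor[OF A lA]]

private lemma Gy: "G \<in> functors (psh A) D \<Longrightarrow> ftor_comp A G (yoneda A) \<in> functors A D"
  by (rule ftor_comp_in[OF A yA])

lemma Gy_nat_hom: "\<eta> \<in> nats A D F (ftor_comp A G (yoneda A)) \<Longrightarrow> a \<in> Ob A \<Longrightarrow>
  \<eta> a \<in> Hom D (fo F a) (fo G (fo (yoneda A) a))"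
  using nat_hom[of \<eta> A D F "ftor_comp A G (yoneda A)" a] by simp

text \<open>\<open>F a\<close> and \<open>G (y a)\<close> are both colimits of \<open>F\<close>
  weighted by the representable at \<open>a\<close>, and the unit is the comparison between
  them.\<close>

lemma ptwise_iso:
  assumes F: "F \<in> functors A D" and p: "ptwise A D F G \<eta>" and a: "a \<in> Ob A"
  shows "is_iso D (fo F a) (fo G (fo (yoneda A) a)) (\<eta> a)"
proof -
  have G: "G \<in> functors (psh A) D" and n: "\<eta> \<in> nats A D F (ftor_comp A G (yoneda A))"
    using p by (simp_all add: ptwise_def)
  have c: "colim A D F (fo (yoneda A) a) (fo G (fo (yoneda A) a))
      (\<lambda>b f. cmp D (fo F b) (fo G (fo (yoneda A) b)) (fo G (fo (yoneda A) a))
         (fa G (fo (yoneda A) b) (fo (yoneda A) a) (hat A (fo (yoneda A) a) b f)) (\<eta> b))"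
    using p yo[OF a] by (simp add: ptwise_def)
  show ?thesis
    by (rule colim_iso[OF D F yoneda_colim[OF A lA D F a] c])
      (use a nat_hom[OF n a] nat_natural[OF n] A lA in \<open>simp_all add: hat_yoneda\<close>)
qed

text \<open>A cocontinuous \<open>G\<close> is the pointwise extension of its own restriction to
  representables, and \<open>\<eta>\<close> identifies \<open>F\<close> with that
  restriction.\<close>

lemma cocont_ptwise:
  assumes F: "F \<in> functors A D" and G: "cocont A D G" and n: "\<eta> \<in> nats A D F (ftor_comp A G (yoneda A))"
    and i: "\<And>a. a \<in> Ob A \<Longrightarrow> is_iso D (fo F a) (fo G (fo (yoneda A) a)) (\<eta> a)"
  shows "ptwise A D F G \<eta>"
  unfolding ptwise_def
proof (intro conjI ballI)
  fix P assume P: "P \<in> Ob (psh A)"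
  then have P': "P \<in> functors (op_cat A) SET" by simp
  show "colim A D F P (fo G P)
      (\<lambda>a p. cmp D (fo F a) (fo G (fo (yoneda A) a)) (fo G P) (fa G (fo (yoneda A) a) P (hat A P a p)) (\<eta> a))"
    by (rule colim_cong[OF colim_reindex[OF D A F Gy[OF cocont_ftor[OF G]] P' cocont_colim[OF G P] n] _ P'])
      (use i in simp_all)
qed (use n cocont_ftor[OF G] in simp_all)

text \<open>By \<open>ptwise_iso\<close> the unit is invertible, so \<open>F\<close> can be replaced
  by the restriction of \<open>G\<close> in the colimit formula.\<close>

lemma ptwise_cocont:
  assumes F: "F \<in> functors A D" and p: "ptwise A D F G \<eta>"
  shows "cocont A D G"
proof -
  have G: "G \<in> functors (psh A) D" and n: "\<eta> \<in> nats A D F (ftor_comp A G (yoneda A))"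
    using p by (simp_all add: ptwise_def)
  note i = ptwise_iso[OF F p]
  have i': "is_iso D (fo F a) (fo (ftor_comp A G (yoneda A)) a) (\<eta> a)" if "a \<in> Ob A" for a
    using i that by simp
  note [simp] = D A lA ftor_ob[OF F] ftor_rules[OF G] yo cinv_hom[OF i] i hat_hom[OF A lA] Gy_nat_hom[OF n]
    iso_hom[OF i]
  show ?thesis
    unfolding cocont_def
  proof (intro conjI ballI G)
    fix P assume P: "P \<in> Ob (psh A)"
    then have P': "P \<in> functors (op_cat A) SET" by simp
    have c: "colim A D F P (fo G P)
      (\<lambda>a p. cmp D (fo F a) (fo G (fo (yoneda A) a)) (fo G P) (fa G (fo (yoneda A) a) P (hat A P a p)) (\<eta> a))"
      using p P by (simp add: ptwise_def)
    have n': "(\<lambda>a\<in>Ob A. cinv D (fo F a) (fo (ftor_comp A G (yoneda A)) a) (\<eta> a)) \<in> nats A D (ftor_comp A G (yoneda A)) F"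
      by (rule cinv_nat[OF D F Gy[OF G] n i'])
    show "colim A D (ftor_comp A G (yoneda A)) P (fo G P) (\<lambda>a p. fa G (fo (yoneda A) a) P (hat A P a p))"
      by (rule colim_cong[OF colim_reindex[OF D A Gy[OF G] F P' c n'] _ P'])
        (use P cinv_iso[OF i] in \<open>simp_all add: cat_assoc cinv_r cat_idr del: psh_simps\<close>)
  qed
qed

text \<open>The component at \<open>P\<close> of the induced transformation is the map out of the
  colimit \<open>G P\<close> whose legs are those of \<open>H P\<close> composed with
  \<open>\<theta>\<close>. Naturality and uniqueness are checked on legs.\<close>

lemma ptwise_is_lan:
  assumes F: "F \<in> functors A D" and p: "ptwise A D F G \<eta>"
  shows "is_lan A (psh A) D (yoneda A) F G \<eta>"
  unfolding is_lan_def
proof (intro conjI ballI)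
  show G: "G \<in> functors (psh A) D" and n: "\<eta> \<in> nats A D F (ftor_comp A G (yoneda A))"
    using p by (simp_all add: ptwise_def)
  fix H \<theta> assume H: "H \<in> functors (psh A) D" and t: "\<theta> \<in> nats A D F (ftor_comp A H (yoneda A))"
  note [simp] = D A lA ftor_ob[OF F] ftor_rules[OF G] ftor_rules[OF H] ftor_hom[OF F]
     yo hat_hom[OF A lA] Gy_nat_hom[OF n] Gy_nat_hom[OF t] category_psh yh
  note [simp del] = psh_simps
  let ?y = "fo (yoneda A)"
  let ?c = "\<lambda>P a p. cmp D (fo F a) (fo G (?y a)) (fo G P) (fa G (?y a) P (hat A P a p)) (\<eta> a)"
  let ?k = "\<lambda>P a p. cmp D (fo F a) (fo H (?y a)) (fo H P) (fa H (?y a) P (hat A P a p)) (\<theta> a)"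
  have C: "colim A D F P (fo G P) (?c P)" if "P \<in> Ob (psh A)" for P
    using p that by (simp add: ptwise_def)
  have act: "fa P a' a f p \<in> fo P a" if "P \<in> Ob (psh A)" "a \<in> Ob A" "a' \<in> Ob A" "f \<in> Hom A a a'" "p \<in> fo P a'" for P a a' f p
    using that by (intro psh_act) (simp_all add: psh_simps)
  have hact: "hat A P a (fa P a' a f p) = cmp (psh A) (?y a) (?y a') P (hat A P a' p) (fa (yoneda A) a a' f)"
    if "P \<in> Ob (psh A)" "a \<in> Ob A" "a' \<in> Ob A" "f \<in> Hom A a a'" "p \<in> fo P a'" for P a a' f p
    using that by (intro hat_act[OF A lA]) (simp_all add: psh_simps)
  have k: "cocone A D F P (fo H P) (?k P)" if "P \<in> Ob (psh A)" for P
    unfolding cocone_def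
    using that nat_natural[OF t] by (simp add: cat_cmp hact ftor_cmp[OF H] cat_assoc)
  have "\<exists>s. s \<in> Hom D (fo G P) (fo H P) \<and> (\<forall>a\<in>Ob A. \<forall>p\<in>fo P a. cmp D (fo F a) (fo G P) (fo H P) s (?c P a p) = ?k P a p)"
    if P: "P \<in> Ob (psh A)" for P
    by (rule colim_ex[OF C[OF P] ftor_ob[OF H P] k[OF P]]) blast
  note * = someI_ex[OF this]
  define s where "s P = (SOME s. s \<in> Hom D (fo G P) (fo H P) \<and>
    (\<forall>a\<in>Ob A. \<forall>p\<in>fo P a. cmp D (fo F a) (fo G P) (fo H P) s (?c P a p) = ?k P a p))" for P
  have s [simp]: "s P \<in> Hom D (fo G P) (fo H P)"
    and sc: "a \<in> Ob A \<Longrightarrow> p \<in> fo P a \<Longrightarrow> cmp D (fo F a) (fo G P) (fo H P) (s P) (?c P a p) = ?k P a p"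
    if "P \<in> Ob (psh A)" for P a p
    using *[OF that] unfolding s_def by blast+
  let ?s = "\<lambda>P\<in>Ob (psh A). s P"
  have mp: "m a p \<in> fo Q a" if "m \<in> Hom (psh A) P Q" "a \<in> Ob A" "p \<in> fo P a" for m P Q a p
    using that pm_app by (simp add: psh_simps)
  have sn: "?s \<in> nats (psh A) D G H"
  proof (rule natsI)
    fix P Q m assume PQ [simp]: "P \<in> Ob (psh A)" "Q \<in> Ob (psh A)" and m [simp]: "m \<in> Hom (psh A) P Q"
    have "cmp D (fo G P) (fo G Q) (fo H Q) (s Q) (fa G P Q m) = cmp D (fo G P) (fo H P) (fo H Q) (fa H P Q m) (s P)"
    proof (rule colim_eq[OF C[OF PQ(1)] ftor_ob[OF H PQ(2)]])
      fix a p assume [simp]: "a \<in> Ob A" "p \<in> fo P a"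
      \<comment> \<open>By \<open>hat_comp\<close>, \<open>G m\<close> sends the leg at
        \<open>p\<close> to the leg at \<open>m a p\<close>. So both sides of the naturality square
        restrict to \<open>?k Q a (m a p)\<close>.\<close>
      have "cmp D (fo F a) (fo G P) (fo G Q) (fa G P Q m) (?c P a p) = ?c Q a (m a p)"
        by (simp add: ftor_cmp[OF G, symmetric] hat_comp[OF A lA] cat_assoc[symmetric])
      then have "cmp D (fo F a) (fo G P) (fo H Q) (cmp D (fo G P) (fo G Q) (fo H Q) (s Q) (fa G P Q m)) (?c P a p) = ?k Q a (m a p)"
        by (simp add: cat_assoc cat_cmp sc mp[OF m])
      moreover have "cmp D (fo F a) (fo G P) (fo H Q) (cmp D (fo G P) (fo H P) (fo H Q) (fa H P Q m) (s P)) (?c P a p) = ?k Q a (m a p)"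
        by (simp add: cat_assoc cat_cmp sc) (simp add: ftor_cmp[OF H, symmetric] hat_comp[OF A lA] cat_assoc[symmetric])
      ultimately show "cmp D (fo F a) (fo G P) (fo H Q) (cmp D (fo G P) (fo G Q) (fo H Q) (s Q) (fa G P Q m)) (?c P a p) =
         cmp D (fo F a) (fo G P) (fo H Q) (cmp D (fo G P) (fo H P) (fo H Q) (fa H P Q m) (s P)) (?c P a p)" by simp
    qed (simp_all add: cat_cmp)
    then show "cmp D (fo G P) (fo G Q) (fo H Q) (?s Q) (fa G P Q m) = cmp D (fo G P) (fo H P) (fo H Q) (fa H P Q m) (?s P)"
      by simp
  qed simp_all
  \<comment> \<open>The identity of \<open>a\<close> is the universal element of \<open>y a\<close>,
    and the leg there is the unit itself. This is how the Kan equation at \<open>a\<close> comes out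
    of the colimit equations.\<close>
  have hid: "hat A (?y a) a (idn A a) = idn (psh A) (?y a)" if "a \<in> Ob A" for a
    using that by (simp add: hat_yoneda cat_id ftor_id[OF yA])
  have c1: "?c (?y a) a (idn A a) = \<eta> a" and k1: "?k (?y a) a (idn A a) = \<theta> a" if "a \<in> Ob A" for a
    using that by (simp_all add: hid ftor_id[OF G] ftor_id[OF H] cat_idl)
  show "\<exists>!\<sigma>. \<sigma> \<in> nats (psh A) D G H \<and>
     (\<forall>a\<in>Ob A. cmp D (fo F a) (fo G (?y a)) (fo H (?y a)) (\<sigma> (?y a)) (\<eta> a) = \<theta> a)"
  proof (rule ex1I[of _ ?s], intro conjI ballI)
    fix a assume a: "a \<in> Ob A"
    show "cmp D (fo F a) (fo G (?y a)) (fo H (?y a)) (?s (?y a)) (\<eta> a) = \<theta> a"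
      using sc[of "?y a" a "idn A a"] a by (simp add: c1 k1 cat_id)
  next
    fix \<sigma> assume h: "\<sigma> \<in> nats (psh A) D G H \<and>
     (\<forall>a\<in>Ob A. cmp D (fo F a) (fo G (?y a)) (fo H (?y a)) (\<sigma> (?y a)) (\<eta> a) = \<theta> a)"
    then have \<sigma>: "\<sigma> \<in> nats (psh A) D G H" by blast
    note [simp] = nat_hom[OF \<sigma>]
    show "\<sigma> = ?s"
    proof (rule nat_eqI[OF \<sigma> sn])
      fix P assume P [simp]: "P \<in> Ob (psh A)"
      have "\<sigma> P = s P"
      proof (rule colim_eq[OF C[OF P] ftor_ob[OF H P]])
        fix a p assume [simp]: "a \<in> Ob A" "p \<in> fo P a"
        have "cmp D (fo F a) (fo G P) (fo H P) (\<sigma> P) (?c P a p) = ?k P a p"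
          using h by (simp add: cat_assoc nat_natural[OF \<sigma>, THEN cat_reassoc])
        then show "cmp D (fo F a) (fo G P) (fo H P) (\<sigma> P) (?c P a p) = cmp D (fo F a) (fo G P) (fo H P) (s P) (?c P a p)"
          by (simp only: sc[OF P \<open>a \<in> Ob A\<close> \<open>p \<in> fo P a\<close>])
      qed simp_all
      then show "\<sigma> P = ?s P" by simp
    qed
  qed (rule sn)
qed

lemma ptwise_exists:
  assumes F: "F \<in> functors A D" and ex: "\<And>P. P \<in> Ob (psh A) \<Longrightarrow> \<exists>C c. colim A D F P C c"
  shows "\<exists>G \<eta>. ptwise A D F G \<eta>"
proof -
  let ?y = "fo (yoneda A)"
  define C where "C P = fst (SOME x. colim A D F P (fst x) (snd x))" for P
  define c where "c P = snd (SOME x. colim A D F P (fst x) (snd x))" for P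
  have C: "colim A D F P (C P) (c P)" if "P \<in> Ob (psh A)" for P
    using ex[OF that] someI_ex[of "\<lambda>x. colim A D F P (fst x) (snd x)"] unfolding C_def c_def by auto
  note Co = colim_ob[OF C] and cc = colim_cocone[OF C]
  note [simp] = D A lA ftor_rules[OF F] Co cocone_hom[OF cc] yo hat_hom[OF A lA] category_psh yh cat_id[OF category_psh] cat_id[OF A]
  note [simp del] = psh_simps
  have mp: "m a p \<in> fo Q a" if "m \<in> Hom (psh A) P Q" "a \<in> Ob A" "p \<in> fo P a" for m P Q a p
    using that pm_app by (simp add: psh_simps)
  have act: "fa P a' a f p \<in> fo P a" if "P \<in> Ob (psh A)" "a \<in> Ob A" "a' \<in> Ob A" "f \<in> Hom A a a'" "p \<in> fo P a'" for P a a' f p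
    using that by (intro psh_act) (simp_all add: psh_simps)
  have nat: "m a (fa P a' a f p) = fa Q a' a f (m a' p)" if "m \<in> Hom (psh A) P Q" "a \<in> Ob A" "a' \<in> Ob A" "f \<in> Hom A a a'" "p \<in> fo P a'" for P Q m a a' f p
    using that pm_nat by (simp add: psh_simps)
  have k: "cocone A D F P (C Q) (\<lambda>a p. c Q a (m a p))" if "P \<in> Ob (psh A)" "Q \<in> Ob (psh A)" "m \<in> Hom (psh A) P Q" for P Q m
    unfolding cocone_def using that by (simp add: mp[OF that(3)] nat[OF that(3)] cocone_nat[OF cc])
  have "\<exists>n. n \<in> Hom D (C P) (C Q) \<and> (\<forall>a\<in>Ob A. \<forall>p\<in>fo P a. cmp D (fo F a) (C P) (C Q) n (c P a p) = c Q a (m a p))"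
    if "P \<in> Ob (psh A)" "Q \<in> Ob (psh A)" "m \<in> Hom (psh A) P Q" for P Q m
    by (rule colim_ex[OF C[OF that(1)] Co[OF that(2)] k[OF that]]) blast
  note * = someI_ex[OF this]
  define M where "M P Q m = (SOME n. n \<in> Hom D (C P) (C Q) \<and>
    (\<forall>a\<in>Ob A. \<forall>p\<in>fo P a. cmp D (fo F a) (C P) (C Q) n (c P a p) = c Q a (m a p)))" for P Q m
  have M [simp]: "M P Q m \<in> Hom D (C P) (C Q)"
    and Mc: "a \<in> Ob A \<Longrightarrow> p \<in> fo P a \<Longrightarrow> cmp D (fo F a) (C P) (C Q) (M P Q m) (c P a p) = c Q a (m a p)"
    if "P \<in> Ob (psh A)" "Q \<in> Ob (psh A)" "m \<in> Hom (psh A) P Q" for P Q m a p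
    using *[OF that] unfolding M_def by blast+
  define G where "G = mk_ftor (psh A) C M"
  have G: "G \<in> functors (psh A) D"
    unfolding G_def
  proof (rule mk_ftor_in_functors[OF category_psh])
    fix P assume P [simp]: "P \<in> Ob (psh A)"
    show "M P P (idn (psh A) P) = idn D (C P)"
      by (rule colim_eq[OF C[OF P] Co[OF P]]) (simp_all add: cat_id Mc cat_idl)
  next
    fix P Q R m n assume PQR [simp]: "P \<in> Ob (psh A)" "Q \<in> Ob (psh A)" "R \<in> Ob (psh A)"
      and mn [simp]: "m \<in> Hom (psh A) P Q" "n \<in> Hom (psh A) Q R"
    show "M P R (cmp (psh A) P Q R n m) = cmp D (C P) (C Q) (C R) (M Q R n) (M P Q m)"
      by (rule colim_eq[OF C[OF PQR(1)] Co[OF PQR(3)]]) (simp_all add: cat_cmp cat_assoc Mc mp[OF mn(1)])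
  qed simp_all
  have [simp]: "P \<in> Ob (psh A) \<Longrightarrow> fo G P = C P"
    "\<lbrakk>P \<in> Ob (psh A); Q \<in> Ob (psh A); m \<in> Hom (psh A) P Q\<rbrakk> \<Longrightarrow>
      fa G P Q m = M P Q m" for P Q m
    by (simp_all add: G_def)
  \<comment> \<open>The unit is the leg at the universal element of \<open>y a\<close>; all other
    legs are recovered from it by applying \<open>G\<close> to \<open>hat A P a p\<close>.\<close>
  let ?n = "\<lambda>a\<in>Ob A. c (?y a) a (idn A a)"
  have n: "?n \<in> nats A D F (ftor_comp A G (yoneda A))"
  proof (rule natsI)
    fix a b f assume [simp]: "a \<in> Ob A" "b \<in> Ob A" "f \<in> Hom A a b"
    show "cmp D (fo F a) (fo F b) (fo (ftor_comp A G (yoneda A)) b) (?n b) (fa F a b f) =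
      cmp D (fo F a) (fo (ftor_comp A G (yoneda A)) a) (fo (ftor_comp A G (yoneda A)) b)
        (fa (ftor_comp A G (yoneda A)) a b f) (?n a)"
      using cocone_nat[OF cc[of "?y b"], of a b f "idn A b"] by (simp add: Mc cat_idl cat_idr)
  qed simp_all
  have "ptwise A D F G ?n"
    unfolding ptwise_def
  proof (intro conjI ballI G n)
    fix P assume P: "P \<in> Ob (psh A)"
    show "colim A D F P (fo G P)
      (\<lambda>a p. cmp D (fo F a) (fo G (?y a)) (fo G P) (fa G (?y a) P (hat A P a p)) (?n a))"
    proof (rule colim_cong)
      show P': "P \<in> functors (op_cat A) SET" using P by (simp add: psh_simps)
      show "colim A D F P (fo G P) (c P)" using C P by simp
      show "c P a p = cmp D (fo F a) (fo G (?y a)) (fo G P) (fa G (?y a) P (hat A P a p)) (?n a)"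
        if "a \<in> Ob A" "p \<in> fo P a" for a p
        using that P psh_id[OF P'] by (simp add: Mc)
    qed
  qed
  then show ?thesis by blast
qed

text \<open>The universal property alone gives no colimit formula. But a pointwise extension exists
  here and is a Kan extension too, so it is isomorphic to \<open>G\<close> compatibly with the
  units, and its colimit cocones can be transported.\<close>

lemma is_lan_ptwise:
  assumes F: "F \<in> functors A D" and ex: "\<And>P. P \<in> Ob (psh A) \<Longrightarrow> \<exists>C c. colim A D F P C c"
    and lan: "is_lan A (psh A) D (yoneda A) F G \<eta>"
  shows "ptwise A D F G \<eta>"
proof -
  let ?y = "fo (yoneda A)"
  obtain G0 \<eta>0 where p: "ptwise A D F G0 \<eta>0" using ptwise_exists[OF F ex] by blast
  have lan0: "is_lan A (psh A) D (yoneda A) F G0 \<eta>0" by (rule ptwise_is_lan[OF F p])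
  have G: "G \<in> functors (psh A) D" and n: "\<eta> \<in> nats A D F (ftor_comp A G (yoneda A))"
    and G0: "G0 \<in> functors (psh A) D" and n0: "\<eta>0 \<in> nats A D F (ftor_comp A G0 (yoneda A))"
    using lan lan0 by (simp_all add: is_lan_def)
  note [simp] = D A lA ftor_rules[OF F] ftor_rules[OF G] ftor_rules[OF G0]
    Gy_nat_hom[OF n] Gy_nat_hom[OF n0] yo hat_hom[OF A lA] category_psh
  note [simp del] = psh_simps
  have ex1: "\<exists>\<sigma>\<in>nats (psh A) D K H. \<forall>a\<in>Ob A. cmp D (fo F a) (fo K (?y a)) (fo H (?y a)) (\<sigma> (?y a)) (\<kappa> a) = \<theta> a"
    and eq1: "\<And>\<sigma> \<sigma>'. \<lbrakk>\<sigma> \<in> nats (psh A) D K H; \<sigma>' \<in> nats (psh A) D K H;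
      (\<And>a. a \<in> Ob A \<Longrightarrow> cmp D (fo F a) (fo K (?y a)) (fo H (?y a)) (\<sigma> (?y a)) (\<kappa> a) = \<theta> a);
      (\<And>a. a \<in> Ob A \<Longrightarrow> cmp D (fo F a) (fo K (?y a)) (fo H (?y a)) (\<sigma>' (?y a)) (\<kappa> a) = \<theta> a)\<rbrakk> \<Longrightarrow>
      \<sigma> = \<sigma>'"
    if "is_lan A (psh A) D (yoneda A) F K \<kappa>" "H \<in> functors (psh A) D" "\<theta> \<in> nats A D F (ftor_comp A H (yoneda A))" for K \<kappa> H \<theta>
    using that unfolding is_lan_def by blast+
  obtain e where e: "e \<in> nats (psh A) D G0 G"
    and ee: "\<And>a. a \<in> Ob A \<Longrightarrow> cmp D (fo F a) (fo G0 (?y a)) (fo G (?y a)) (e (?y a)) (\<eta>0 a) = \<eta> a"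
    using ex1[OF lan0 G n] by blast
  obtain s where s: "s \<in> nats (psh A) D G G0"
    and se: "\<And>a. a \<in> Ob A \<Longrightarrow> cmp D (fo F a) (fo G (?y a)) (fo G0 (?y a)) (s (?y a)) (\<eta> a) = \<eta>0 a"
    using ex1[OF lan G0 n0] by blast
  note [simp] = nat_hom[OF e] nat_hom[OF s]
  let ?FC = "functor_category (psh A) D"
  have "cmp ?FC G0 G G0 s e = idn ?FC G0"
    by (rule eq1[OF lan0 G0 n0]) (use e s G G0 in \<open>simp_all add: cmp_nat idn_nat cat_assoc ee se cat_idl\<close>)
  moreover have "cmp ?FC G G0 G e s = idn ?FC G"
    by (rule eq1[OF lan G n]) (use e s G G0 in \<open>simp_all add: cmp_nat idn_nat cat_assoc ee se cat_idl\<close>)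
  ultimately have "is_iso ?FC G0 G e" using e s by (intro is_isoI) simp_all
  then have ei: "is_iso D (fo G0 P) (fo G P) (e P)" if "P \<in> Ob (psh A)" for P
    using nat_iso_iff[OF D G0 G] that by blast
  show ?thesis
    unfolding ptwise_def
  proof (intro conjI ballI G n)
    fix P assume P [simp]: "P \<in> Ob (psh A)"
    have c: "colim A D F P (fo G0 P)
      (\<lambda>a p. cmp D (fo F a) (fo G0 (?y a)) (fo G0 P) (fa G0 (?y a) P (hat A P a p)) (\<eta>0 a))"
      using p P by (simp add: ptwise_def)
    show "colim A D F P (fo G P)
      (\<lambda>a p. cmp D (fo F a) (fo G (?y a)) (fo G P) (fa G (?y a) P (hat A P a p)) (\<eta> a))"
    proof (rule colim_cong[OF colim_transport[OF D F c ftor_ob[OF G P] ei[OF P]]])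
      show "P \<in> functors (op_cat A) SET" using P by (simp add: psh_simps)
    qed (simp add: cat_assoc nat_natural[OF e, THEN cat_reassoc] ee)
  qed
qed

end

text \<open>A cocontinuous functor on presheaves has a right adjoint, \<open>Q \<mapsto> D(T(y-), Q)\<close>, up to a
  coding of the hom-sets of \<open>D\<close> in \<open>'u\<close>.\<close>

lemma cocont_adjoint:
  fixes B :: "('b, 'u) category" and D :: "('p, 'n) category"
  assumes B: "category B" and lB: "locally_small TYPE('u) B"
    and D: "category D" and lD: "locally_small TYPE('u) D"
    and T: "cocont B D T" and Q: "Q \<in> Ob D"
  obtains R \<phi> where "R \<in> Ob (psh B)"
    "\<And>C. C \<in> Ob (psh B) \<Longrightarrow> bij_betw (\<phi> C) (Hom D (fo T C) Q) (Hom (psh B) C R)"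
    "\<And>C C' m g. \<lbrakk>C \<in> Ob (psh B); C' \<in> Ob (psh B); m \<in> Hom (psh B) C C';
      g \<in> Hom D (fo T C') Q\<rbrakk> \<Longrightarrow>
      \<phi> C (cmp D (fo T C) (fo T C') Q g (fa T C C' m)) = cmp (psh B) C C' R (\<phi> C' g) m"
proof -
  note Tf = cocont_ftor[OF T] and yf = yoneda_functor[OF B lB]
  let ?y = "fo (yoneda B)"
  note [simp] = B lB D Q ftor_rules[OF Tf] ftor_rules[OF yf] category_psh
    hat_hom[OF B lB] cat_cmp[OF D]
  note [simp del] = psh_simps
  have hact: "hat B P b (fa P b' b f p) = cmp (psh B) (?y b) (?y b') P (hat B P b' p) (fa (yoneda B) b b' f)"
    if "P \<in> Ob (psh B)" "b \<in> Ob B" "b' \<in> Ob B" "f \<in> Hom B b b'" "p \<in> fo P b'" for P b b' f p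
    using that by (intro hat_act[OF B lB]) (simp_all add: psh_simps)
  let ?H = "\<lambda>b. Hom D (fo T (?y b)) Q"
  have "\<exists>e :: 'b \<Rightarrow> 'n \<Rightarrow> 'u. \<forall>b\<in>Ob B. inj_on (e b) (?H b)"
  proof (rule bchoice, rule ballI)
    fix b assume b: "b \<in> Ob B"
    have "small TYPE('u) (?H b)" using lD b by (simp add: locally_small_def)
    then show "\<exists>e :: 'n \<Rightarrow> 'u. inj_on e (?H b)" by (rule small_code) blast
  qed
  then obtain e :: "'b \<Rightarrow> 'n \<Rightarrow> 'u" where e: "\<And>b. b \<in> Ob B \<Longrightarrow> inj_on (e b) (?H b)" by blast
  define d where "d b = inv_into (?H b) (e b)" for b
  have de [simp]: "d b (e b g) = g" if "b \<in> Ob B" "g \<in> ?H b" for b g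
    using e that by (simp add: d_def)
  have d_hom: "d b z \<in> ?H b" and ed: "e b (d b z) = z" if "b \<in> Ob B" "z \<in> e b ` ?H b" for b z
    using that by auto
  define R where "R = mk_ftor (op_cat B) (\<lambda>b. e b ` ?H b)
    (\<lambda>b b' f. \<lambda>z\<in>e b ` ?H b. e b' (cmp D (fo T (?y b')) (fo T (?y b)) Q (d b z) (fa T (?y b') (?y b) (fa (yoneda B) b' b f))))"
  have R: "R \<in> functors (op_cat B) SET"
    unfolding R_def
  proof (rule mk_psh[OF B])
    show "small TYPE('u) (e b ` ?H b)" if "b \<in> Ob B" for b
      using that lD by (intro small_image) (simp add: locally_small_def)
  next
    fix b z assume "b \<in> Ob B" "z \<in> e b ` ?H b"
    then show "e b (cmp D (fo T (?y b)) (fo T (?y b)) Q (d b z) (fa T (?y b) (?y b) (fa (yoneda B) b b (idn B b)))) = z"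
      by (auto simp: ftor_id[OF yf] ftor_id[OF Tf] cat_idr)
  next
    fix b b' b'' f g z assume "b \<in> Ob B" "b' \<in> Ob B" "b'' \<in> Ob B" "f \<in> Hom B b' b" "g \<in> Hom B b'' b'" "z \<in> e b ` ?H b"
    then show "e b'' (cmp D (fo T (?y b'')) (fo T (?y b)) Q (d b z) (fa T (?y b'') (?y b) (fa (yoneda B) b'' b (cmp B b'' b' b f g)))) =
       e b'' (cmp D (fo T (?y b'')) (fo T (?y b')) Q
         (d b' (e b' (cmp D (fo T (?y b')) (fo T (?y b)) Q (d b z) (fa T (?y b') (?y b) (fa (yoneda B) b' b f)))))
         (fa T (?y b'') (?y b') (fa (yoneda B) b'' b' g)))"
      by (auto simp: ftor_cmp[OF yf] ftor_cmp[OF Tf] cat_assoc)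
  qed auto
  have Rob: "fo R b = e b ` ?H b" if "b \<in> Ob B" for b
    using that by (simp add: R_def)
  have Ract: "fa R b b' f z = e b' (cmp D (fo T (?y b')) (fo T (?y b)) Q (d b z) (fa T (?y b') (?y b) (fa (yoneda B) b' b f)))"
    if "b \<in> Ob B" "b' \<in> Ob B" "f \<in> Hom B b' b" "z \<in> e b ` ?H b" for b b' f z
    using that by (simp add: R_def)
  \<comment> \<open>A map \<open>g\<close> out of \<open>T C\<close> is recorded by its composites
    with the maps that \<open>T\<close> assigns to the elements of \<open>C\<close>. As
    \<open>T C\<close> is the colimit of the \<open>T (y b)\<close>, these composites determine
    \<open>g\<close> and can be prescribed on any cocone.\<close>
  define \<phi> where "\<phi> C g = (\<lambda>b\<in>Ob B. \<lambda>q\<in>fo C b. e b (cmp D (fo T (?y b)) (fo T C) Q g (fa T (?y b) C (hat B C b q))))" for C g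
  have \<phi>_app: "\<phi> C g b q = e b (cmp D (fo T (?y b)) (fo T C) Q g (fa T (?y b) C (hat B C b q)))" if "b \<in> Ob B" "q \<in> fo C b" for C g b q
    using that by (simp add: \<phi>_def)
  have \<phi>: "\<phi> C g \<in> nats (op_cat B) SET C R" if [simp]: "C \<in> Ob (psh B)" "g \<in> Hom D (fo T C) Q" for C g
  proof (rule pmI[OF _ R])
    show C: "C \<in> functors (op_cat B) SET" using that by (simp add: psh_simps)
    fix b b' f q assume "b \<in> Ob B" "b' \<in> Ob B" "f \<in> Hom B b' b" "q \<in> fo C b"
    then show "\<phi> C g b' (fa C b b' f q) = fa R b b' f (\<phi> C g b q)"
      using psh_act[OF C] by (simp add: \<phi>_app Ract hact ftor_cmp[OF Tf] cat_assoc)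
  qed (simp_all add: \<phi>_app Rob, simp_all add: \<phi>_def)
  show thesis
  proof (rule that[of R \<phi>])
    show "R \<in> Ob (psh B)" using R by (simp add: psh_simps)
  next
    fix C assume C [simp]: "C \<in> Ob (psh B)"
    note col = cocont_colim[OF T C]
    show "bij_betw (\<phi> C) (Hom D (fo T C) Q) (Hom (psh B) C R)"
      unfolding bij_betw_def
    proof (intro conjI inj_onI equalityI subsetI)
      fix g g' assume g [simp]: "g \<in> Hom D (fo T C) Q" "g' \<in> Hom D (fo T C) Q" and eq: "\<phi> C g = \<phi> C g'"
      show "g = g'"
      proof (rule colim_eq[OF col Q g])
        fix b q assume [simp]: "b \<in> Ob B" "q \<in> fo C b"
        have "e b (cmp D (fo T (?y b)) (fo T C) Q g (fa T (?y b) C (hat B C b q))) =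
          e b (cmp D (fo T (?y b)) (fo T C) Q g' (fa T (?y b) C (hat B C b q)))"
          using eq[THEN fun_cong, of b, THEN fun_cong, of q] by (simp add: \<phi>_app)
        from inj_onD[OF e this]
        show "cmp D (fo (ftor_comp B T (yoneda B)) b) (fo T C) Q g (fa T (?y b) C (hat B C b q)) =
          cmp D (fo (ftor_comp B T (yoneda B)) b) (fo T C) Q g' (fa T (?y b) C (hat B C b q))" by simp
      qed
    next
      fix m assume "m \<in> Hom (psh B) C R"
      then have m: "m \<in> nats (op_cat B) SET C R" by (simp add: psh_simps)
      have mH: "m b q \<in> e b ` ?H b" if "b \<in> Ob B" "q \<in> fo C b" for b q
        using pm_app[OF m that] Rob that by simp
      have "cocone B D (ftor_comp B T (yoneda B)) C Q (\<lambda>b q. d b (m b q))"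
        unfolding cocone_def
      proof (intro conjI ballI)
        fix b b' f q assume h: "b \<in> Ob B" "b' \<in> Ob B" "f \<in> Hom B b b'" "q \<in> fo C b'"
        then show "d b (m b (fa C b' b f q)) =
          cmp D (fo (ftor_comp B T (yoneda B)) b) (fo (ftor_comp B T (yoneda B)) b') Q (d b' (m b' q)) (fa (ftor_comp B T (yoneda B)) b b' f)"
          by (simp add: pm_nat[OF m] Ract mH d_hom)
      qed (simp add: mH d_hom)
      then obtain g where g: "g \<in> Hom D (fo T C) Q"
        and ge: "\<And>b q. b \<in> Ob B \<Longrightarrow> q \<in> fo C b \<Longrightarrow>
          cmp D (fo (ftor_comp B T (yoneda B)) b) (fo T C) Q g (fa T (?y b) C (hat B C b q)) = d b (m b q)"
        by (rule colim_ex[OF col Q]) (rule that)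
      have "\<phi> C g = m"
      proof (rule pm_eqI[OF \<phi>[OF C g] m])
        fix b q assume h: "b \<in> Ob B" "q \<in> fo C b"
        then show "\<phi> C g b q = m b q"
          using ge[OF h] by (simp add: \<phi>_app ed mH)
      qed
      then show "m \<in> \<phi> C ` Hom D (fo T C) Q" using g by blast
    qed (use \<phi>[OF C] in \<open>auto simp: psh_simps\<close>)
  next
    fix C C' m g assume [simp]: "C \<in> Ob (psh B)" "C' \<in> Ob (psh B)" and m [simp]: "m \<in> Hom (psh B) C C'" and g [simp]: "g \<in> Hom D (fo T C') Q"
    have m': "m \<in> nats (op_cat B) SET C C'" using m by (simp add: psh_simps)
    show "\<phi> C (cmp D (fo T C) (fo T C') Q g (fa T C C' m)) = cmp (psh B) C C' R (\<phi> C' g) m"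
    proof (rule pm_eqI[OF \<phi> cat_cmp[OF category_psh, unfolded psh_simps]])
      fix b q assume "b \<in> Ob B" "q \<in> fo C b"
      then show "\<phi> C (cmp D (fo T C) (fo T C') Q g (fa T C C' m)) b q = cmp (psh B) C C' R (\<phi> C' g) m b q"
        using pm_app[OF m'] by (simp add: \<phi>_app cat_assoc ftor_cmp[OF Tf, symmetric] hat_comp[OF B lB])
    qed (use R m' \<phi>[of C' g] in \<open>simp_all add: psh_simps[symmetric]\<close>)
  qed
qed

text \<open>The argument that left adjoints preserve colimits: cocones on \<open>T \<circ> F\<close>
  with vertex \<open>Q\<close> correspond through \<open>\<phi>\<close> to cocones on
  \<open>F\<close> with vertex \<open>R\<close>. Each \<open>Q\<close> is treated separately, so
  representability of \<open>D(T(-), Q)\<close> suffices and no functoriality in \<open>Q\<close> is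
  asked for.\<close>

lemma cocont_preserves_colim:
  fixes A :: "('a, 'u) category" and B :: "('b, 'u) category" and D :: "('p, 'n) category"
  assumes B: "category B" and lB: "locally_small TYPE('u) B"
    and D: "category D" and lD: "locally_small TYPE('u) D" and A: "category A"
    and T: "cocont B D T" and F: "F \<in> functors A (psh B)" and P: "P \<in> functors (op_cat A) SET"
    and C: "colim A (psh B) F P C c"
  shows "colim A D (ftor_comp A T F) P (fo T C) (\<lambda>a p. fa T (fo F a) C (c a p))"
proof -
  note Tf = cocont_ftor[OF T]
  note [simp] = B lB D A ftor_rules[OF Tf] ftor_rules[OF F] category_psh
    colim_ob[OF C] cocone_hom[OF colim_cocone[OF C]] psh_act[OF P]
  note [simp del] = psh_simps
  have TF: "ftor_comp A T F \<in> functors A D" by (rule ftor_comp_in[OF A F Tf])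
  show ?thesis
  proof (rule colimI)
    show "cocone A D (ftor_comp A T F) P (fo T C) (\<lambda>a p. fa T (fo F a) C (c a p))"
      by (simp add: cocone_def cocone_nat[OF colim_cocone[OF C]] ftor_cmp[OF Tf])
  next
    fix Q k assume Q [simp]: "Q \<in> Ob D" and k: "cocone A D (ftor_comp A T F) P Q k"
    obtain R \<phi> where R: "R \<in> Ob (psh B)"
      and b: "\<And>C. C \<in> Ob (psh B) \<Longrightarrow> bij_betw (\<phi> C) (Hom D (fo T C) Q) (Hom (psh B) C R)"
      and n: "\<And>C C' m g. \<lbrakk>C \<in> Ob (psh B); C' \<in> Ob (psh B); m \<in> Hom (psh B) C C';
      g \<in> Hom D (fo T C') Q\<rbrakk> \<Longrightarrow>
      \<phi> C (cmp D (fo T C) (fo T C') Q g (fa T C C' m)) = cmp (psh B) C C' R (\<phi> C' g) m"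
      using cocont_adjoint[OF B lB D lD T Q] by metis
    have kh: "k a p \<in> Hom D (fo T (fo F a)) Q" if "a \<in> Ob A" "p \<in> fo P a" for a p
      using cocone_hom[OF k that] that by simp
    have \<phi>h: "\<phi> C g \<in> Hom (psh B) C R" if "C \<in> Ob (psh B)" "g \<in> Hom D (fo T C) Q" for C g
      using b[OF that(1)] that(2) by (rule bij_betwE[THEN bspec])
    have "cocone A (psh B) F P R (\<lambda>a p. \<phi> (fo F a) (k a p))"
      unfolding cocone_def
      using cocone_nat[OF k] by (simp add: kh \<phi>h n[symmetric])
    then obtain m where m: "m \<in> Hom (psh B) C R"
      and mc: "\<And>a p. a \<in> Ob A \<Longrightarrow> p \<in> fo P a \<Longrightarrow> cmp (psh B) (fo F a) C R m (c a p) = \<phi> (fo F a) (k a p)"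
      by (rule colim_ex[OF C R]) (rule that)
    obtain g where g: "g \<in> Hom D (fo T C) Q" "\<phi> C g = m"
      using m bij_betw_imp_surj_on[OF b[OF colim_ob[OF C]]] by (metis imageE)
    have "cmp D (fo T (fo F a)) (fo T C) Q g (fa T (fo F a) C (c a p)) = k a p" if [simp]: "a \<in> Ob A" "p \<in> fo P a" for a p
      by (rule inj_onD[OF bij_betw_imp_inj_on[OF b[of "fo F a"]]]) (use g in \<open>simp_all add: kh n mc cat_cmp\<close>)
    then show "\<exists>m\<in>Hom D (fo T C) Q. \<forall>a\<in>Ob A. \<forall>p\<in>fo P a.
      cmp D (fo (ftor_comp A T F) a) (fo T C) Q m (fa T (fo F a) C (c a p)) = k a p"
      using g by (intro bexI[of _ g]) simp_all
  next
    fix Q g g' assume Q: "Q \<in> Ob D" and g [simp]: "g \<in> Hom D (fo T C) Q" "g' \<in> Hom D (fo T C) Q"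
      and e: "\<And>a p. a \<in> Ob A \<Longrightarrow> p \<in> fo P a \<Longrightarrow>
       cmp D (fo (ftor_comp A T F) a) (fo T C) Q g (fa T (fo F a) C (c a p)) =
       cmp D (fo (ftor_comp A T F) a) (fo T C) Q g' (fa T (fo F a) C (c a p))"
    obtain R \<phi> where R: "R \<in> Ob (psh B)"
      and b: "\<And>C. C \<in> Ob (psh B) \<Longrightarrow> bij_betw (\<phi> C) (Hom D (fo T C) Q) (Hom (psh B) C R)"
      and n: "\<And>C C' m g. \<lbrakk>C \<in> Ob (psh B); C' \<in> Ob (psh B); m \<in> Hom (psh B) C C';
      g \<in> Hom D (fo T C') Q\<rbrakk> \<Longrightarrow>
      \<phi> C (cmp D (fo T C) (fo T C') Q g (fa T C C' m)) = cmp (psh B) C C' R (\<phi> C' g) m"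
      using cocont_adjoint[OF B lB D lD T Q] by metis
    have \<phi>h: "\<phi> C g \<in> Hom (psh B) C R" if "C \<in> Ob (psh B)" "g \<in> Hom D (fo T C) Q" for C g
      using b[OF that(1)] that(2) by (rule bij_betwE[THEN bspec])
    have e': "cmp D (fo T (fo F a)) (fo T C) Q g (fa T (fo F a) C (c a p)) =
      cmp D (fo T (fo F a)) (fo T C) Q g' (fa T (fo F a) C (c a p))" if "a \<in> Ob A" "p \<in> fo P a" for a p
      using e[OF that] that by simp
    have "\<phi> C g = \<phi> C g'"
      by (rule colim_eq[OF C R]) (simp_all add: \<phi>h n[symmetric] e')
    from inj_onD[OF bij_betw_imp_inj_on[OF b[of C]] this] show "g = g'" by simp
  qed simp
qed

section \<open>Closure properties of cocontinuity\<close>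

lemma cocont_id:
  fixes A :: "('a, 'u) category"
  assumes A: "category A" and lA: "locally_small TYPE('u) A"
  shows "cocont A (psh A) (id_ftor (psh A))"
  unfolding cocont_def
proof (intro conjI ballI id_ftor_in category_psh)
  fix P assume P: "P \<in> Ob (psh A)"
  show "colim A (psh A) (ftor_comp A (id_ftor (psh A)) (yoneda A)) P (fo (id_ftor (psh A)) P)
     (\<lambda>a p. fa (id_ftor (psh A)) (fo (yoneda A) a) P (hat A P a p))"
  proof (rule colim_cong)
    show P': "P \<in> functors (op_cat A) SET" using P by simp
    show "colim A (psh A) (ftor_comp A (id_ftor (psh A)) (yoneda A)) P (fo (id_ftor (psh A)) P) (hat A P)"
      using yoneda_density[OF A lA P'] P by (simp add: ftor_comp_idl[OF yoneda_functor[OF A lA]] del: psh_simps)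
  qed (use P A lA hat_hom[OF A lA P] ftor_ob[OF yoneda_functor[OF A lA]] in \<open>simp del: psh_simps\<close>)
qed

text \<open>The diagram that \<open>T\<close> meets is \<open>G \<circ> y\<close>, whose values need
  not be representable; so the definition of \<open>cocont\<close> for \<open>T\<close> is not
  enough and \<open>cocont_preserves_colim\<close> is applied.\<close>

lemma cocont_comp:
  fixes A :: "('a, 'u) category" and B :: "('b, 'u) category" and D :: "('p, 'n) category"
  assumes A: "category A" and lA: "locally_small TYPE('u) A" and B: "category B" and lB: "locally_small TYPE('u) B"
    and D: "category D" and lD: "locally_small TYPE('u) D" and G: "cocont A (psh B) G" and T: "cocont B D T"
  shows "cocont A D (ftor_comp (psh A) T G)"
proof -
  note Gf = cocont_ftor[OF G] and Tf = cocont_ftor[OF T]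
    and yA = yoneda_functor[OF A lA]
  show ?thesis
    unfolding cocont_def
  proof (intro conjI ballI)
    show "ftor_comp (psh A) T G \<in> functors (psh A) D" by (rule ftor_comp_in[OF category_psh Gf Tf])
    fix P assume P: "P \<in> Ob (psh A)"
    then have P': "P \<in> functors (op_cat A) SET" by simp
    have "colim A D (ftor_comp A T (ftor_comp A G (yoneda A))) P (fo T (fo G P))
      (\<lambda>a p. fa T (fo (ftor_comp A G (yoneda A)) a) (fo G P) (fa G (fo (yoneda A) a) P (hat A P a p)))"
      by (rule cocont_preserves_colim[OF B lB D lD A T ftor_comp_in[OF A yA Gf] P' cocont_colim[OF G P]])
    then show "colim A D (ftor_comp A (ftor_comp (psh A) T G) (yoneda A)) P (fo (ftor_comp (psh A) T G) P)
      (\<lambda>a p. fa (ftor_comp (psh A) T G) (fo (yoneda A) a) P (hat A P a p))"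
      by (subst ftor_comp_assoc[OF yA], subst fo_ftor_comp[OF P], rule colim_cong[OF _ _ P'])
        (use P hat_hom[OF A lA P] ftor_ob[OF yA] in \<open>simp_all del: psh_simps\<close>)
  qed
qed

text \<open>The comparison from the pointwise Kan extension of \<open>G \<circ> y\<close> to \<open>G\<close> becomes invertible under
  every \<open>\<pi>\<close>, as both \<open>\<pi>\<close> and \<open>\<pi> \<circ> G\<close> are cocontinuous.\<close>

lemma cocont_reflect:
  fixes A :: "('a, 'u) category" and B :: "('b, 'u) category" and D :: "'i \<Rightarrow> ('p, 'n) category"
  assumes U: "universe TYPE('u)" and A: "small_category TYPE('u) A" and B: "small_category TYPE('u) B"
    and D: "\<And>i. i \<in> K \<Longrightarrow> category (D i)" and lD: "\<And>i. i \<in> K \<Longrightarrow> locally_small TYPE('u) (D i)"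
    and G: "G \<in> functors (psh A) (psh B)"
    and pi: "\<And>i. i \<in> K \<Longrightarrow> cocont B (D i) (\<pi> i)"
    and piG: "\<And>i. i \<in> K \<Longrightarrow> cocont A (D i) (ftor_comp (psh A) (\<pi> i) G)"
    and cons: "\<And>P Q m. \<lbrakk>P \<in> Ob (psh B); Q \<in> Ob (psh B); m \<in> Hom (psh B) P Q;
      (\<And>i. i \<in> K \<Longrightarrow> is_iso (D i) (fo (\<pi> i) P) (fo (\<pi> i) Q) (fa (\<pi> i) P Q m))\<rbrakk> \<Longrightarrow>
      is_iso (psh B) P Q m"
  shows "cocont A (psh B) G"
  unfolding cocont_def
proof (intro conjI ballI G)
  have cA: "category A" and sA: "small TYPE('u) (Ob A)" and lA: "locally_small TYPE('u) A"
    and cB: "category B" and lB: "locally_small TYPE('u) B"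
    using A B by (simp_all add: small_category_def)
  note yA = yoneda_functor[OF cA lA]
  let ?F = "ftor_comp A G (yoneda A)"
  have F: "?F \<in> functors A (psh B)" by (rule ftor_comp_in[OF cA yA G])
  fix P assume P: "P \<in> Ob (psh A)"
  then have P': "P \<in> functors (op_cat A) SET" by simp
  note [simp] = P cA lA ftor_ob[OF yA] ftor_rules[OF G] hat_hom[OF cA lA P] category_psh psh_act[OF P'] ftor_hom[OF yA]
  note [simp del] = psh_simps
  let ?k = "\<lambda>a p. fa G (fo (yoneda A) a) P (hat A P a p)"
  \<comment> \<open>\<open>C\<close> is the value at \<open>P\<close> of the pointwise extension of
    \<open>G \<circ> y\<close>, and \<open>m\<close> below compares it with \<open>G P\<close>. Once
    \<open>m\<close> is invertible, its colimit cocone can be transported to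
    \<open>G P\<close>.\<close>
  obtain C c where C: "colim A (psh B) ?F P C c" using colim_exists[OF U cA sA cB F P'] by blast
  note [simp] = colim_ob[OF C] cocone_hom[OF colim_cocone[OF C]]
  have hact: "hat A P b (fa P b' b f p) = cmp (psh A) (fo (yoneda A) b) (fo (yoneda A) b') P (hat A P b' p) (fa (yoneda A) b b' f)"
    if "b \<in> Ob A" "b' \<in> Ob A" "f \<in> Hom A b b'" "p \<in> fo P b'" for b b' f p
    using that by (intro hat_act[OF cA lA P'])
  have "cocone A (psh B) ?F P (fo G P) ?k"
    by (simp add: cocone_def hact ftor_cmp[OF G])
  then obtain m where m: "m \<in> Hom (psh B) C (fo G P)"
    and mc: "\<And>a p. a \<in> Ob A \<Longrightarrow> p \<in> fo P a \<Longrightarrow> cmp (psh B) (fo ?F a) C (fo G P) m (c a p) = ?k a p"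
    by (rule colim_ex[OF C ftor_ob[OF G P]]) (rule that)
  have "is_iso (psh B) C (fo G P) m"
  proof (rule cons[OF _ _ m])
    fix i assume i: "i \<in> K"
    note pf = cocont_ftor[OF pi[OF i]]
    let ?F' = "ftor_comp A (\<pi> i) ?F"
    have F': "?F' \<in> functors A (D i)" by (rule ftor_comp_in[OF cA F pf])
    have c1: "colim A (D i) ?F' P (fo (\<pi> i) C) (\<lambda>a p. fa (\<pi> i) (fo ?F a) C (c a p))"
      by (rule cocont_preserves_colim[OF cB lB D[OF i] lD[OF i] cA pi[OF i] F P' C])
    have c2: "colim A (D i) ?F' P (fo (\<pi> i) (fo G P)) (\<lambda>a p. fa (ftor_comp (psh A) (\<pi> i) G) (fo (yoneda A) a) P (hat A P a p))"
      using cocont_colim[OF piG[OF i] P] by (simp add: ftor_comp_assoc[OF yA])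
    show "is_iso (D i) (fo (\<pi> i) C) (fo (\<pi> i) (fo G P)) (fa (\<pi> i) C (fo G P) m)"
    proof (rule colim_iso[OF D[OF i] F' c1 c2])
      show "fa (\<pi> i) C (fo G P) m \<in> Hom (D i) (fo (\<pi> i) C) (fo (\<pi> i) (fo G P))"
        using m by (simp add: ftor_hom[OF pf])
      fix a p assume h: "a \<in> Ob A" "p \<in> fo P a"
      have "c a p \<in> Hom (psh B) (fo ?F a) C" by (rule cocone_hom[OF colim_cocone[OF C] h])
      then show "cmp (D i) (fo ?F' a) (fo (\<pi> i) C) (fo (\<pi> i) (fo G P)) (fa (\<pi> i) C (fo G P) m) (fa (\<pi> i) (fo ?F a) C (c a p)) =
         fa (ftor_comp (psh A) (\<pi> i) G) (fo (yoneda A) a) P (hat A P a p)"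
        using m mc[OF h] h by (simp add: ftor_cmp[OF pf, symmetric])
    qed
  qed simp_all
  from colim_transport[OF category_psh F C ftor_ob[OF G P] this]
  show "colim A (psh B) ?F P (fo G P) ?k"
    by (rule colim_cong[OF _ _ P']) (use mc in simp)
qed

section \<open>Categories with arities\<close>

lemma nerve_of_simps [simp]:
  "adom (nerve_of X) = amb X" "acod (nerve_of X) = psh (ari X)" "afun (nerve_of X) = nerve (ari X) (amb X) (inc X)"
  by (simp_all add: nerve_of_def)

lemma cwaD:
  assumes "is_cwa (X :: ('a, 'o, 'u) cwa)"
  shows cwa_amb: "category (amb X)" and cwa_amb_ls: "locally_small TYPE('u) (amb X)"
    and cwa_small: "small_category TYPE('u) (ari X)"
    and cwa_ari: "category (ari X)" and cwa_ari_ls: "locally_small TYPE('u) (ari X)"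
    and cwa_ari_ob: "small TYPE('u) (Ob (ari X))"
    and cwa_inc: "inc X \<in> functors (ari X) (amb X)"
    and cwa_ff: "full_faithful (ari X) (amb X) (inc X)"
  using assms by (simp_all add: is_cwa_def small_category_def)

lemma cwa_nerve: "is_cwa X \<Longrightarrow> nerve (ari X) (amb X) (inc X) \<in> functors (amb X) (psh (ari X))"
  by (intro nerve_functor cwaD)

lemma nerve_of_ok: "is_cwa X \<Longrightarrow> arrow_ok (nerve_of X)"
  by (simp add: arrow_ok_def cwa_amb category_psh cwa_nerve)

lemma nerve_of_in_CAT2:
  assumes "universe TYPE('u)" "is_cwa (X :: ('a, 'o, 'u) cwa)"
  shows "nerve_of X \<in> Ob0 (CAT2 TYPE('u))"
  using assms locally_small_psh[OF assms(1) cwa_ari_ob[OF assms(2)]]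
  by (simp add: Ob0_CAT2 nerve_of_ok cwa_amb_ls)

abbreviation nerve_cwa :: "('a, 'o, 'u) cwa \<Rightarrow> ('o, 'u, ('a, 'u) presheaf, ('a, 'u) presheaf_mor) ftor" where
  "nerve_cwa X \<equiv> nerve (ari X) (amb X) (inc X)"

context
  fixes X :: "('a, 'o, 'u) cwa"
  assumes X: "is_cwa X"
begin

text \<open>The isomorphism \<open>y a \<cong> N (I a)\<close> induced by \<open>I\<close>.\<close>

definition yoneda_nerve :: "'a \<Rightarrow> ('a, 'u) presheaf_mor" where
  "yoneda_nerve a = hat (ari X) (fo (nerve_cwa X) (fo (inc X) a)) a (idn (amb X) (fo (inc X) a))"

private lemmas A' = cwa_ari[OF X] and E' = cwa_amb[OF X] and lE' = cwa_amb_ls[OF X] and lA' = cwa_ari_ls[OF X] and I' = cwa_inc[OF X]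
private lemmas N' = cwa_nerve[OF X]

lemma yoneda_nerve_hom: "a \<in> Ob (ari X) \<Longrightarrow> yoneda_nerve a \<in> Hom (psh (ari X)) (fo (yoneda (ari X)) a) (fo (nerve_cwa X) (fo (inc X) a))"
  unfolding yoneda_nerve_def
  by (rule hat_hom[OF A' lA' ftor_ob[OF N']])
    (simp_all add: ftor_ob[OF I'] nerve_ob[OF A' E' lE' I'] cat_id[OF E'])

text \<open>An element at \<open>a\<close> of the nerve of \<open>e\<close> is an arrow
  \<open>g\<close> out of \<open>I a\<close>. Its \<open>hat\<close> factors through the nerve of
  \<open>g\<close>, so that facts about nerves and facts about representables can be
  exchanged.\<close>

lemma hat_nerve:
  assumes a: "a \<in> Ob (ari X)" and e: "e \<in> Ob (amb X)" and g: "g \<in> Hom (amb X) (fo (inc X) a) e"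
  shows "cmp (psh (ari X)) (fo (yoneda (ari X)) a) (fo (nerve_cwa X) (fo (inc X) a)) (fo (nerve_cwa X) e) (fa (nerve_cwa X) (fo (inc X) a) e g) (yoneda_nerve a) =
    hat (ari X) (fo (nerve_cwa X) e) a g"
  unfolding yoneda_nerve_def
  by (subst hat_comp[OF A' lA' ftor_ob[OF N'] ftor_ob[OF N']])
    (use assms ftor_hom[OF N' _ e g] in \<open>simp_all add: ftor_ob[OF I'] cat_id[OF E'] cat_idr[OF E']
      nerve_ob[OF A' E' lE' I'] nerve_ar[OF A' E' lE' I']\<close>)

text \<open>Both sides correspond under Yoneda to the arrow \<open>I f\<close>, seen as an element
  at \<open>a\<close> of the nerve of \<open>I b\<close>.\<close>

lemma yoneda_nerve_natural:
  assumes a: "a \<in> Ob (ari X)" and b: "b \<in> Ob (ari X)" and f: "f \<in> Hom (ari X) a b"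
  shows "cmp (psh (ari X)) (fo (yoneda (ari X)) a) (fo (yoneda (ari X)) b) (fo (nerve_cwa X) (fo (inc X) b)) (yoneda_nerve b) (fa (yoneda (ari X)) a b f) =
    cmp (psh (ari X)) (fo (yoneda (ari X)) a) (fo (nerve_cwa X) (fo (inc X) a)) (fo (nerve_cwa X) (fo (inc X) b))
      (fa (nerve_cwa X) (fo (inc X) a) (fo (inc X) b) (fa (inc X) a b f)) (yoneda_nerve a)"
proof -
  note [simp] = assms ftor_rules[OF I'] A' E' cat_id nerve_ob[OF A' E' lE' I'] nerve_act[OF A' E' lE' I']
  have 1: "fo (nerve_cwa X) (fo (inc X) b) \<in> functors (op_cat (ari X)) SET"
    using ftor_ob[OF N', of "fo (inc X) b"] by simp
  have "hat (ari X) (fo (nerve_cwa X) (fo (inc X) b)) a (fa (fo (nerve_cwa X) (fo (inc X) b)) b a f (idn (amb X) (fo (inc X) b))) =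
    cmp (psh (ari X)) (fo (yoneda (ari X)) a) (fo (yoneda (ari X)) b) (fo (nerve_cwa X) (fo (inc X) b)) (yoneda_nerve b) (fa (yoneda (ari X)) a b f)"
    unfolding yoneda_nerve_def by (rule hat_act[OF A' lA' 1]) simp_all
  then show ?thesis
    by (simp add: hat_nerve cat_idl)
qed

text \<open>The component at \<open>b\<close> is the action of the inclusion on arrows from
  \<open>b\<close> to \<open>a\<close>, a bijection by full faithfulness.\<close>

lemma yoneda_nerve_iso:
  assumes a: "a \<in> Ob (ari X)"
  shows "is_iso (psh (ari X)) (fo (yoneda (ari X)) a) (fo (nerve_cwa X) (fo (inc X) a)) (yoneda_nerve a)"
proof (rule pm_isoI)
  note [simp] = a ftor_rules[OF I'] A' E' cat_id nerve_ob[OF A' E' lE' I'] nerve_act[OF A' E' lE' I']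
    yoneda_ob[OF A' lA']
  show "fo (yoneda (ari X)) a \<in> functors (op_cat (ari X)) SET" by (rule yoneda_psh[OF A' lA' a])
  show "fo (nerve_cwa X) (fo (inc X) a) \<in> functors (op_cat (ari X)) SET" by (rule nerve_psh[OF A' E' lE' I']) simp
  show "yoneda_nerve a \<in> nats (op_cat (ari X)) SET (fo (yoneda (ari X)) a) (fo (nerve_cwa X) (fo (inc X) a))"
    using yoneda_nerve_hom[OF a] by simp
  fix b assume b [simp]: "b \<in> Ob (ari X)"
  have "bij_betw (fa (inc X) b a) (Hom (ari X) b a) (Hom (amb X) (fo (inc X) b) (fo (inc X) a))"
    using cwa_ff[OF X] by (simp add: full_faithful_def)
  then show "bij_betw (yoneda_nerve a b) (fo (fo (yoneda (ari X)) a) b) (fo (fo (nerve_cwa X) (fo (inc X) a)) b)"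
    by (subst bij_betw_cong[of _ _ "fa (inc X) b a"]) (simp_all add: yoneda_nerve_def hat_app[OF A' lA'] cat_idl)
qed

end

section \<open>Arity squares and their 2-cells\<close>

context
  fixes X Y :: "('a, 'o, 'u) cwa"
  assumes U: "universe TYPE('u)" and X: "is_cwa X" and Y: "is_cwa Y"
begin

private lemmas XA = cwa_ari[OF X] and XlA = cwa_ari_ls[OF X] and XN = cwa_nerve[OF X] and XI = cwa_inc[OF X] and XE = cwa_amb[OF X]
  and Xy = yoneda_functor[OF cwa_ari[OF X] cwa_ari_ls[OF X]] and YN = cwa_nerve[OF Y] and YE = cwa_amb[OF Y]
private lemmas okX = nerve_of_ok[OF X] and okY = nerve_of_ok[OF Y]

text \<open>The filler at \<open>I a\<close> together with \<open>yoneda_nerve\<close> identifies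
  \<open>sc s\<close> on representables with the functor whose Kan extension the definition
  requires. So the condition is about \<open>sc s\<close> alone, in a form that is stable under
  composition and can be tested after projecting. From left to right it uses that colimits exist in
  presheaf categories.\<close>

lemma arity_squares_iff:
  "s \<in> arity_squares X Y \<longleftrightarrow> s \<in> squares (nerve_of X) (nerve_of Y) \<and> cocont (ari X) (psh (ari Y)) (sc s)"
proof (cases "s \<in> squares (nerve_of X) (nerve_of Y)")
  case s: True
  let ?F = "ftor_comp (ari X) (nerve (ari Y) (amb Y) (inc Y)) (ftor_comp (ari X) (sd s) (inc X))"
  let ?N = "nerve (ari X) (amb X) (inc X)" and ?M = "nerve (ari Y) (amb Y) (inc Y)" and ?y = "fo (yoneda (ari X))"
  note sd = sq_sd[OF okX okY s, simplified nerve_of_simps] and sc = sq_sc[OF okX okY s, simplified nerve_of_simps]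
    and iso = sq_iso[OF okX okY s, simplified nerve_of_simps]
  have F: "?F \<in> functors (ari X) (psh (ari Y))"
    by (intro ftor_comp_in[OF XA _ YN] ftor_comp_in[OF XA XI sd])
  have "\<exists>\<eta>. is_lan (ari X) (psh (ari X)) (psh (ari Y)) (yoneda (ari X)) ?F (sc s) \<eta>"
    if "cocont (ari X) (psh (ari Y)) (sc s)"
  proof -
    note [simp] = category_psh XA ftor_rules[OF sd] ftor_rules[OF sc] ftor_rules[OF XI]
      ftor_rules[OF Xy] ftor_rules[OF XN] ftor_rules[OF YN] iso iso_hom[OF iso]
      yoneda_nerve_hom[OF X]
    note [simp del] = psh_simps
    let ?i = "yoneda_nerve X"
    \<comment> \<open>From \<open>sc s (y a)\<close> to \<open>sc s\<close> at the nerve of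
      \<open>I a\<close>, and by the filler on to the nerve of \<open>sd s (I a)\<close>. The unit
      of the Kan extension is the inverse of this isomorphism.\<close>
    let ?k = "\<lambda>a\<in>Ob (ari X). cmp (psh (ari Y)) (fo (sc s) (?y a)) (fo (sc s) (fo ?N (fo (inc X) a))) (fo ?M (fo (sd s) (fo (inc X) a)))
      (si s (fo (inc X) a)) (fa (sc s) (?y a) (fo ?N (fo (inc X) a)) (?i a))"
    let ?Gy = "ftor_comp (ari X) (sc s) (yoneda (ari X))"
    have k: "?k \<in> nats (ari X) (psh (ari Y)) ?Gy ?F"
    proof (rule natsI)
      fix a b f assume [simp]: "a \<in> Ob (ari X)" "b \<in> Ob (ari X)" "f \<in> Hom (ari X) a b"
      show "cmp (psh (ari Y)) (fo ?Gy a) (fo ?Gy b) (fo ?F b) (?k b) (fa ?Gy a b f) =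
        cmp (psh (ari Y)) (fo ?Gy a) (fo ?F a) (fo ?F b) (fa ?F a b f) (?k a)"
        using sq_natural[OF okX okY s, of "fo (inc X) a" "fo (inc X) b" "fa (inc X) a b f", THEN cat_reassoc]
        by (simp add: cat_assoc ftor_cmp[OF sc, symmetric] yoneda_nerve_natural[OF X])
          (simp add: cat_assoc ftor_cmp[OF sc])
    qed (simp_all add: cat_cmp)
    have ki: "is_iso (psh (ari Y)) (fo ?Gy a) (fo ?F a) (?k a)" if "a \<in> Ob (ari X)" for a
      using that ftor_iso[OF sc _ _ yoneda_nerve_iso[OF X that]] by (simp add: cmp_iso)
    have Gy: "?Gy \<in> functors (ari X) (psh (ari Y))" by (rule ftor_comp_in[OF XA Xy sc])
    have "ptwise (ari X) (psh (ari Y)) ?F (sc s) (\<lambda>a\<in>Ob (ari X). cinv (psh (ari Y)) (fo ?Gy a) (fo ?F a) (?k a))"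
      by (rule cocont_ptwise[OF XA XlA category_psh F that cinv_nat[OF category_psh Gy F k ki]])
        (use cinv_iso[OF ki] in simp_all)
    then show ?thesis using ptwise_is_lan[OF XA XlA category_psh F] by blast
  qed
  moreover have "cocont (ari X) (psh (ari Y)) (sc s)"
    if "is_lan (ari X) (psh (ari X)) (psh (ari Y)) (yoneda (ari X)) ?F (sc s) \<eta>" for \<eta>
  proof (rule ptwise_cocont[OF XA XlA category_psh F is_lan_ptwise[OF XA XlA category_psh F _ that]])
    show "\<exists>C c. colim (ari X) (psh (ari Y)) ?F P C c" if "P \<in> Ob (psh (ari X))" for P
      using colim_exists[OF U XA cwa_ari_ob[OF X] cwa_ari[OF Y] F] that by simp
  qed
  ultimately show ?thesis using s unfolding arity_squares_def by blast
qed (simp add: arity_squares_def)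

lemma arity_sq: "s \<in> arity_squares X Y \<Longrightarrow> s \<in> squares (nerve_of X) (nerve_of Y)"
  by (simp add: arity_squares_def)

text \<open>The restriction of the second component to representables is forced by \<open>\<alpha>\<close>, and the nerves
  are colimits of representables.\<close>

lemma square_2cell_ex1:
  assumes s: "s \<in> arity_squares X Y" and t: "t \<in> squares (nerve_of X) (nerve_of Y)"
    and \<alpha>: "\<alpha> \<in> nats (amb X) (amb Y) (sd s) (sd t)"
  shows "\<exists>!\<alpha>'. (\<alpha>, \<alpha>') \<in> square_2cells (nerve_of X) (nerve_of Y) s t"
proof -
  have s1: "s \<in> squares (nerve_of X) (nerve_of Y)" and G: "cocont (ari X) (psh (ari Y)) (sc s)"
    using s by (simp_all add: arity_squares_iff)
  let ?N = "nerve (ari X) (amb X) (inc X)" and ?M = "nerve (ari Y) (amb Y) (inc Y)" and ?y = "fo (yoneda (ari X))"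
  let ?i = "yoneda_nerve X" and ?D = "psh (ari Y)" and ?A = "ari X" and ?I = "fo (inc X)"
  note sds = sq_sd[OF okX okY s1, simplified nerve_of_simps] and sdt = sq_sd[OF okX okY t, simplified nerve_of_simps]
    and scs = sq_sc[OF okX okY s1, simplified nerve_of_simps] and sct = sq_sc[OF okX okY t, simplified nerve_of_simps]
    and isos = sq_iso[OF okX okY s1, simplified nerve_of_simps] and isot = sq_iso[OF okX okY t, simplified nerve_of_simps]
    and nats = sq_natural[OF okX okY s1, simplified nerve_of_simps] and natt = sq_natural[OF okX okY t, simplified nerve_of_simps]
  note [simp] = category_psh XA XE YE ftor_rules[OF sds] ftor_rules[OF scs]
      ftor_rules[OF sdt] ftor_rules[OF sct] ftor_rules[OF XI]
      ftor_rules[OF Xy] ftor_rules[OF XN] ftor_rules[OF YN]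
      isos iso_hom[OF isos] isot iso_hom[OF isot] cinv_hom[OF isot]
      yoneda_nerve_hom[OF X] yoneda_nerve_iso[OF X] nat_hom[OF \<alpha>] hat_hom[OF XA XlA]
  note [simp del] = psh_simps
  let ?S = "\<lambda>x. fo (sc s) (fo ?N x)" and ?T = "\<lambda>x. fo (sc t) (fo ?N x)"
  \<comment> \<open>The value that compatibility with \<open>\<alpha>\<close> forces on the second
    component at the nerve of \<open>x\<close>: its equation solved by inverting the filler of
    \<open>t\<close>.\<close>
  define \<beta> where "\<beta> x = cmp ?D (?S x) (fo ?M (fo (sd t) x)) (?T x) (cinv ?D (?T x) (fo ?M (fo (sd t) x)) (si t x))
    (cmp ?D (?S x) (fo ?M (fo (sd s) x)) (fo ?M (fo (sd t) x)) (fa ?M (fo (sd s) x) (fo (sd t) x) (\<alpha> x)) (si s x))" for x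
  have \<beta>h [simp]: "\<beta> x \<in> Hom ?D (?S x) (?T x)" if "x \<in> Ob (amb X)" for x
    using that by (simp add: \<beta>_def cat_cmp)
  have t\<beta>: "cmp ?D (?S x) (?T x) (fo ?M (fo (sd t) x)) (si t x) (\<beta> x) =
    cmp ?D (?S x) (fo ?M (fo (sd s) x)) (fo ?M (fo (sd t) x)) (fa ?M (fo (sd s) x) (fo (sd t) x) (\<alpha> x)) (si s x)"
    if "x \<in> Ob (amb X)" for x
    using that by (simp add: \<beta>_def cinv_r_cancel cat_cmp)
  have \<beta>I: "z = \<beta> x" if "x \<in> Ob (amb X)" "z \<in> Hom ?D (?S x) (?T x)"
    "cmp ?D (?S x) (?T x) (fo ?M (fo (sd t) x)) (si t x) z =
    cmp ?D (?S x) (fo ?M (fo (sd s) x)) (fo ?M (fo (sd t) x)) (fa ?M (fo (sd s) x) (fo (sd t) x) (\<alpha> x)) (si s x)" for x z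
    by (rule iso_cancel_l[OF category_psh _ _ _ isot[OF that(1)] that(2) \<beta>h[OF that(1)] trans[OF that(3) t\<beta>[OF that(1), symmetric]]])
      (use that(1) in simp_all)
  have \<beta>n: "cmp ?D (?S x) (?S x') (?T x') (\<beta> x') (fa (sc s) (fo ?N x) (fo ?N x') (fa ?N x x' f)) =
    cmp ?D (?S x) (?T x) (?T x') (fa (sc t) (fo ?N x) (fo ?N x') (fa ?N x x' f)) (\<beta> x)" (is "?l = ?r")
    if x [simp]: "x \<in> Ob (amb X)" "x' \<in> Ob (amb X)" and f [simp]: "f \<in> Hom (amb X) x x'" for x x' f
  proof -
    have "cmp ?D (?S x) (?T x') (fo ?M (fo (sd t) x')) (si t x') ?l =
      cmp ?D (?S x) (fo ?M (fo (sd s) x)) (fo ?M (fo (sd t) x'))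
        (fa ?M (fo (sd s) x) (fo (sd t) x') (cmp (amb Y) (fo (sd s) x) (fo (sd s) x') (fo (sd t) x') (\<alpha> x') (fa (sd s) x x' f))) (si s x)"
      by (simp add: t\<beta>[THEN cat_reassoc] cat_assoc nats ftor_cmp[OF YN])
    also have "\<dots> = cmp ?D (?S x) (?T x') (fo ?M (fo (sd t) x')) (si t x') ?r"
      by (simp add: nat_natural[OF \<alpha>] natt[THEN cat_reassoc] cat_assoc t\<beta> ftor_cmp[OF YN])
    finally show ?thesis
      by - (rule iso_cancel_l[OF category_psh _ _ _ isot[of x']], simp_all add: cat_cmp)
  qed
  let ?Sy = "\<lambda>a. fo (sc s) (?y a)" and ?Ty = "\<lambda>a. fo (sc t) (?y a)"
  let ?si = "\<lambda>a. fa (sc s) (?y a) (fo ?N (?I a)) (?i a)" and ?ti = "\<lambda>a. fa (sc t) (?y a) (fo ?N (?I a)) (?i a)"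
  have tii [simp]: "is_iso ?D (?Ty a) (?T (?I a)) (?ti a)" if "a \<in> Ob ?A" for a
    using that by (intro ftor_iso[OF sct]) simp_all
  note [simp] = cinv_hom[OF tii]
  \<comment> \<open>The value forced at the representable of \<open>a\<close>:
    \<open>\<beta> (I a)\<close> transported along \<open>yoneda_nerve\<close> on both
    sides.\<close>
  define \<gamma> where "\<gamma> = (\<lambda>a\<in>Ob ?A. cmp ?D (?Sy a) (?T (?I a)) (?Ty a) (cinv ?D (?Ty a) (?T (?I a)) (?ti a))
    (cmp ?D (?Sy a) (?S (?I a)) (?T (?I a)) (\<beta> (?I a)) (?si a)))"
  have \<gamma>h [simp]: "\<gamma> a \<in> Hom ?D (?Sy a) (?Ty a)" if "a \<in> Ob ?A" for a
    using that by (simp add: \<gamma>_def cat_cmp)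
  have t\<gamma>: "cmp ?D (?Sy a) (?Ty a) (?T (?I a)) (?ti a) (\<gamma> a) = cmp ?D (?Sy a) (?S (?I a)) (?T (?I a)) (\<beta> (?I a)) (?si a)"
    if "a \<in> Ob ?A" for a
    using that by (simp add: \<gamma>_def cinv_r_cancel cat_cmp)
  have \<gamma>I: "z = \<gamma> a" if "a \<in> Ob ?A" "z \<in> Hom ?D (?Sy a) (?Ty a)"
    "cmp ?D (?Sy a) (?Ty a) (?T (?I a)) (?ti a) z = cmp ?D (?Sy a) (?S (?I a)) (?T (?I a)) (\<beta> (?I a)) (?si a)" for a z
    by (rule iso_cancel_l[OF category_psh _ _ _ tii[OF that(1)] that(2) \<gamma>h[OF that(1)] trans[OF that(3) t\<gamma>[OF that(1), symmetric]]])
      (use that(1) in simp_all)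
  let ?Gy = "ftor_comp ?A (sc s) (yoneda ?A)" and ?Hy = "ftor_comp ?A (sc t) (yoneda ?A)"
  have Gy: "?Gy \<in> functors ?A ?D" by (rule ftor_comp_in[OF XA Xy scs])
  have \<gamma>n: "\<gamma> \<in> nats ?A ?D ?Gy ?Hy"
  proof (rule natsI)
    fix a b f assume ab [simp]: "a \<in> Ob ?A" "b \<in> Ob ?A" "f \<in> Hom ?A a b"
    have "cmp ?D (?Sy a) (?Ty b) (?T (?I b)) (?ti b) (cmp ?D (?Sy a) (?Sy b) (?Ty b) (\<gamma> b) (fa (sc s) (?y a) (?y b) (fa (yoneda ?A) a b f)))
      = cmp ?D (?Sy a) (?S (?I b)) (?T (?I b)) (\<beta> (?I b)) (fa (sc s) (?y a) (fo ?N (?I b))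
          (cmp (psh ?A) (?y a) (?y b) (fo ?N (?I b)) (?i b) (fa (yoneda ?A) a b f)))"
      by (simp add: t\<gamma>[THEN cat_reassoc] cat_assoc ftor_cmp[OF scs])
    also have "\<dots> = cmp ?D (?Sy a) (?T (?I a)) (?T (?I b)) (fa (sc t) (fo ?N (?I a)) (fo ?N (?I b)) (fa ?N (?I a) (?I b) (fa (inc X) a b f)))
      (cmp ?D (?Sy a) (?S (?I a)) (?T (?I a)) (\<beta> (?I a)) (?si a))"
      by (simp add: yoneda_nerve_natural[OF X] ftor_cmp[OF scs] \<beta>n[THEN cat_reassoc] cat_assoc)
    also have "\<dots> = cmp ?D (?Sy a) (?Ty a) (?T (?I b)) (fa (sc t) (?y a) (fo ?N (?I b))
          (cmp (psh ?A) (?y a) (fo ?N (?I a)) (fo ?N (?I b)) (fa ?N (?I a) (?I b) (fa (inc X) a b f)) (?i a))) (\<gamma> a)"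
      by (simp add: t\<gamma>[symmetric] ftor_cmp[OF sct] cat_assoc)
    also have "\<dots> = cmp ?D (?Sy a) (?Ty b) (?T (?I b)) (?ti b)
       (cmp ?D (?Sy a) (?Ty a) (?Ty b) (fa (sc t) (?y a) (?y b) (fa (yoneda ?A) a b f)) (\<gamma> a))"
      by (simp add: yoneda_nerve_natural[OF X, symmetric] ftor_cmp[OF sct] cat_assoc)
    finally have "cmp ?D (?Sy a) (?Sy b) (?Ty b) (\<gamma> b) (fa (sc s) (?y a) (?y b) (fa (yoneda ?A) a b f)) =
      cmp ?D (?Sy a) (?Ty a) (?Ty b) (fa (sc t) (?y a) (?y b) (fa (yoneda ?A) a b f)) (\<gamma> a)"
      by - (rule iso_cancel_l[OF category_psh _ _ _ tii[of b]], simp_all add: cat_cmp)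
    then show "cmp ?D (fo ?Gy a) (fo ?Gy b) (fo ?Hy b) (\<gamma> b) (fa ?Gy a b f) =
      cmp ?D (fo ?Gy a) (fo ?Hy a) (fo ?Hy b) (fa ?Hy a b f) (\<gamma> a)" by simp
  qed (simp_all, simp add: \<gamma>_def)
  \<comment> \<open>\<open>sc s\<close> is the Kan extension of its own restriction to
    representables, with identity unit. So transformations from \<open>sc s\<close> to
    \<open>sc t\<close> are the same as transformations between the restrictions, and
    \<open>\<gamma>\<close> is one.\<close>
  have "ptwise ?A ?D ?Gy (sc s) (idn (functor_category ?A ?D) ?Gy)"
    by (rule cocont_ptwise[OF XA XlA category_psh Gy G idn_nat[OF category_psh Gy]]) (simp add: idn_iso)
  from ptwise_is_lan[OF XA XlA category_psh Gy this]
  have ex1: "\<exists>!\<sigma>. \<sigma> \<in> nats (psh ?A) ?D (sc s) (sc t) \<and> (\<forall>a\<in>Ob ?A. cmp ?D (fo ?Gy a) (?Sy a) (?Ty a) (\<sigma> (?y a))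
      (idn (functor_category ?A ?D) ?Gy a) = \<gamma> a)"
    using sct \<gamma>n unfolding is_lan_def by blast
  have eq: "(\<alpha>, \<sigma>) \<in> square_2cells (nerve_of X) (nerve_of Y) s t \<longleftrightarrow>
     \<sigma> \<in> nats (psh ?A) ?D (sc s) (sc t) \<and> (\<forall>a\<in>Ob ?A. cmp ?D (fo ?Gy a) (?Sy a) (?Ty a) (\<sigma> (?y a))
      (idn (functor_category ?A ?D) ?Gy a) = \<gamma> a)" for \<sigma>
  proof (cases "\<sigma> \<in> nats (psh ?A) ?D (sc s) (sc t)")
    case \<sigma>: True
    note [simp] = nat_hom[OF \<sigma>]
    have l: "(\<alpha>, \<sigma>) \<in> square_2cells (nerve_of X) (nerve_of Y) s t \<longleftrightarrow> (\<forall>x\<in>Ob (amb X). \<sigma> (fo ?N x) = \<beta> x)"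
      using \<sigma> \<alpha> by (auto simp: square_2cells_iff t\<beta> intro: \<beta>I)
    have r: "(\<forall>a\<in>Ob ?A. cmp ?D (fo ?Gy a) (?Sy a) (?Ty a) (\<sigma> (?y a))
      (idn (functor_category ?A ?D) ?Gy a) = \<gamma> a) \<longleftrightarrow> (\<forall>a\<in>Ob ?A. \<sigma> (?y a) = \<gamma> a)"
      by (simp add: cat_idr)
    have "(\<forall>x\<in>Ob (amb X). \<sigma> (fo ?N x) = \<beta> x) \<longleftrightarrow> (\<forall>a\<in>Ob ?A. \<sigma> (?y a) = \<gamma> a)"
    proof (intro iffI ballI)
      fix a assume "\<forall>x\<in>Ob (amb X). \<sigma> (fo ?N x) = \<beta> x" and [simp]: "a \<in> Ob ?A"
      then show "\<sigma> (?y a) = \<gamma> a"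
        by (intro \<gamma>I) (simp_all add: nat_natural[OF \<sigma>, symmetric])
    next
      fix x assume h: "\<forall>a\<in>Ob ?A. \<sigma> (?y a) = \<gamma> a" and x [simp]: "x \<in> Ob (amb X)"
      \<comment> \<open>\<open>sc s\<close> preserves the presentation of the nerve of
        \<open>x\<close> by representables, so it suffices to compare on the legs. Each leg factors
        through the nerve of some \<open>I a\<close> by \<open>hat_nerve\<close>, where
        \<open>\<gamma>\<close> and \<open>\<beta>\<close> are related by construction.\<close>
      have Nx: "fo ?N x \<in> Ob (psh ?A)" by simp
      show "\<sigma> (fo ?N x) = \<beta> x"
      proof (rule colim_eq[OF cocont_colim[OF G Nx]])
        fix a g assume a [simp]: "a \<in> Ob ?A" and "g \<in> fo (fo ?N x) a"
        then have g [simp]: "g \<in> Hom (amb X) (?I a) x" by (simp add: nerve_ob[OF XA XE cwa_amb_ls[OF X] XI])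
        let ?h = "hat ?A (fo ?N x) a g"
        have hh: "?h = cmp (psh ?A) (?y a) (fo ?N (?I a)) (fo ?N x) (fa ?N (?I a) x g) (?i a)"
          by (simp add: hat_nerve[OF X])
        have "cmp ?D (?Sy a) (?S x) (?T x) (\<sigma> (fo ?N x)) (fa (sc s) (?y a) (fo ?N x) ?h) =
          cmp ?D (?Sy a) (?Ty a) (?T x) (fa (sc t) (?y a) (fo ?N x) ?h) (\<gamma> a)"
          using h by (subst nat_natural[OF \<sigma>]) (simp_all add: hh cat_cmp)
        also have "\<dots> = cmp ?D (?Sy a) (?T (?I a)) (?T x) (fa (sc t) (fo ?N (?I a)) (fo ?N x) (fa ?N (?I a) x g))
           (cmp ?D (?Sy a) (?S (?I a)) (?T (?I a)) (\<beta> (?I a)) (?si a))"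
          by (simp add: hh ftor_cmp[OF sct] cat_assoc t\<gamma>)
        also have "\<dots> = cmp ?D (?Sy a) (?S x) (?T x) (\<beta> x) (fa (sc s) (?y a) (fo ?N x) ?h)"
          by (simp add: hh ftor_cmp[OF scs] \<beta>n[THEN cat_reassoc] cat_assoc)
        finally show "cmp ?D (fo ?Gy a) (?S x) (?T x) (\<sigma> (fo ?N x)) (fa (sc s) (?y a) (fo ?N x) ?h) =
          cmp ?D (fo ?Gy a) (?S x) (?T x) (\<beta> x) (fa (sc s) (?y a) (fo ?N x) ?h)" by simp
      qed simp_all
    qed
    then show ?thesis unfolding l r using \<sigma> by blast
  qed (simp add: square_2cells_iff)
  show ?thesis unfolding eq by (rule ex1)
qed

text \<open>The uniqueness half of \<open>square_2cell_ex1\<close>. It gives fullness on 2-cells,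
  and equality of whiskered cells whose second components are hard to compare directly.\<close>

lemma square_2cells_eqI:
  assumes s: "s \<in> arity_squares X Y" and t: "t \<in> squares (nerve_of X) (nerve_of Y)"
    and p: "p \<in> square_2cells (nerve_of X) (nerve_of Y) s t" and q: "q \<in> square_2cells (nerve_of X) (nerve_of Y) s t"
    and "fst p = fst q"
  shows "p = q"
proof (rule prod_eqI)
  have "fst p \<in> nats (amb X) (amb Y) (sd s) (sd t)" using s2_fst[OF p] by simp
  from square_2cell_ex1[OF s t this] show "snd p = snd q"
    using p q assms(5) by (metis prod.collapse)
qed (rule assms)

end

section \<open>The 2-categories of categories with arities and the nerve 2-functor\<close>

lemma arity_square_id:
  assumes U: "universe TYPE('u)" and X: "is_cwa (X :: ('a, 'o, 'u) cwa)"
  shows "square_id (nerve_of X) \<in> arity_squares X X"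
  unfolding arity_squares_iff[OF U X X]
  using square_id_in[OF nerve_of_ok[OF X]] cocont_id[OF cwa_ari[OF X] cwa_ari_ls[OF X]] by simp

lemma arity_square_comp:
  assumes U: "universe TYPE('u)" and X: "is_cwa (X :: ('a, 'o, 'u) cwa)" and Y: "is_cwa Y" and Z: "is_cwa Z"
    and s: "s \<in> arity_squares X Y" and t: "t \<in> arity_squares Y Z"
  shows "square_comp (nerve_of X) (nerve_of Y) (nerve_of Z) t s \<in> arity_squares X Z"
  using s t square_comp_in[OF nerve_of_ok[OF X] nerve_of_ok[OF Y] nerve_of_ok[OF Z]]
    cocont_comp[OF cwa_ari[OF X] cwa_ari_ls[OF X] cwa_ari[OF Y] cwa_ari_ls[OF Y] category_psh
      locally_small_psh[OF U cwa_ari_ob[OF Z]]]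
  unfolding arity_squares_iff[OF U X Y] arity_squares_iff[OF U Y Z] arity_squares_iff[OF U X Z]
  by simp

lemma arity_sd: "\<lbrakk>is_cwa X; is_cwa Y; s \<in> arity_squares X Y\<rbrakk> \<Longrightarrow>
      sd s \<in> functors (amb X) (amb Y)"
  using sq_sd[OF nerve_of_ok nerve_of_ok, of X Y s] by (simp add: arity_squares_def)

lemma arities_respecting_iff:
  "is_cwa X \<Longrightarrow> is_cwa Y \<Longrightarrow> K \<in> arities_respecting X Y \<longleftrightarrow> (\<exists>s\<in>arity_squares X Y. sd s = K)"
  by (auto simp: arities_respecting_def intro: arity_sd)

lemma arities_respecting_functor: "K \<in> arities_respecting X Y \<Longrightarrow> K \<in> functors (amb X) (amb Y)"
  by (simp add: arities_respecting_def)

lemma CwAsq_simps [simp]: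
  "Ob0 CwAsq = {X. is_cwa X}" "cells1 CwAsq X Y = arity_squares X Y"
  "cells2 CwAsq X Y s t = nats (amb X) (amb Y) (sd s) (sd t)"
  "id2 CwAsq X Y s = idn (functor_category (amb X) (amb Y)) (sd s)"
  "cmp (HomC CwAsq X Y) s t r = cmp (functor_category (amb X) (amb Y)) (sd s) (sd t) (sd r)"
  "id1 CwAsq X = square_id (nerve_of X)"
  "comp1 CwAsq X Y Z t s = square_comp (nerve_of X) (nerve_of Y) (nerve_of Z) t s"
  "comp2 CwAsq X Y Z t t' s s' \<beta> \<alpha> = nat_hcomp (amb X) (amb Z) (sd t) (sd t') (sd s) (sd s') \<beta> \<alpha>"
  by (simp_all add: CwAsq_def)

lemma CwA_simps [simp]:
  "Ob0 CwA = {X. is_cwa X}" "cells1 CwA X Y = arities_respecting X Y"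
  "cells2 CwA X Y = nats (amb X) (amb Y)"
  "id2 CwA X Y = idn (functor_category (amb X) (amb Y))"
  "cmp (HomC CwA X Y) = cmp (functor_category (amb X) (amb Y))"
  "id1 CwA X = id_ftor (amb X)"
  "comp1 CwA X Y Z L K = ftor_comp (amb X) L K"
  "comp2 CwA X Y Z L L' K K' \<beta> \<alpha> = nat_hcomp (amb X) (amb Z) L L' K K' \<beta> \<alpha>"
  by (simp_all add: CwA_def)

lemma nerve_two_functor_fo [simp]: "s \<in> arity_squares X Y \<Longrightarrow> fo (FH nerve_two_functor X Y) s = s"
  by (simp add: nerve_two_functor_def)

lemma F0_nerve_two_functor [simp]: "F0 nerve_two_functor X = nerve_of X"
  by (simp add: nerve_two_functor_def)

context
  assumes U: "universe TYPE('u)"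
begin

lemma two_category_CwAsq: "two_category (CwAsq :: (('a, 'o, 'u) cwa, ('a, 'o, 'u) nerve_square, 'o \<Rightarrow> 'u) two_cat)"
proof (unfold two_category_def, intro conjI ballI, goal_cases)
  case (1 a b)
  then have a: "is_cwa a" and b: "is_cwa b" by simp_all
  have c: "category (functor_category (amb a) (amb b))" by (rule category_functor_category[OF cwa_amb[OF b]])
  note [simp] = arity_sd[OF a b]
  show ?case
  proof (rule categoryI)
  qed (simp_all add: cat_id[OF c, simplified] cat_cmp[OF c, simplified] cat_idl[OF c, simplified]
      cat_idr[OF c, simplified] cat_assoc[OF c, simplified])
next
  case (4 a b c f g)
  then have cw: "is_cwa a" "is_cwa b" "is_cwa c" by simp_all
  show ?case using 4 hcomp_idn[OF cwa_amb[OF cw(1)] cwa_amb[OF cw(3)] arity_sd[OF cw(1,2)] arity_sd[OF cw(2,3)]] by simp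
next
  case (5 a b c f f' g g' \<alpha> \<beta>)
  then have cw: "is_cwa a" "is_cwa b" "is_cwa c" by simp_all
  show ?case using 5 hcomp_nat[OF cwa_amb[OF cw(1)] cwa_amb[OF cw(3)] arity_sd[OF cw(1,2)] arity_sd[OF cw(1,2)]
    arity_sd[OF cw(2,3)] arity_sd[OF cw(2,3)]] by simp
next
  case (6 a b c f f' f'' g g' g'' \<alpha> \<alpha>' \<beta> \<beta>')
  then have cw: "is_cwa a" "is_cwa b" "is_cwa c" by simp_all
  show ?case using 6 hcomp_interchange[OF cwa_amb[OF cw(1)] cwa_amb[OF cw(2)] cwa_amb[OF cw(3)] arity_sd[OF cw(1,2)] arity_sd[OF cw(1,2)] arity_sd[OF cw(1,2)]
    arity_sd[OF cw(2,3)] arity_sd[OF cw(2,3)] arity_sd[OF cw(2,3)]] by simp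
next
  case (9 a b f f' \<alpha>)
  then have cw: "is_cwa a" "is_cwa b" by simp_all
  show ?case using 9 hcomp_idl[OF cwa_amb[OF cw(2)] arity_sd[OF cw] arity_sd[OF cw]] by simp
next
  case (10 a b f f' \<alpha>)
  then have cw: "is_cwa a" "is_cwa b" by simp_all
  show ?case using 10 hcomp_idr[OF cwa_amb[OF cw(1)] cwa_amb[OF cw(2)] arity_sd[OF cw] arity_sd[OF cw]] by simp
next
  case (12 a b c d f f' g g' h h' \<alpha> \<beta> \<gamma>)
  then have cw: "is_cwa a" "is_cwa b" "is_cwa c" "is_cwa d" by simp_all
  show ?case using 12 hcomp_assoc[OF cwa_amb[OF cw(1)] cwa_amb[OF cw(2)] cwa_amb[OF cw(3)] cwa_amb[OF cw(4)]
    arity_sd[OF cw(1,2)] arity_sd[OF cw(1,2)] arity_sd[OF cw(2,3)] arity_sd[OF cw(2,3)] arity_sd[OF cw(3,4)] arity_sd[OF cw(3,4)]] by simp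
qed (simp_all add: arity_square_id[OF U] arity_square_comp[OF U] square_comp_idl square_comp_idr square_comp_assoc
    nerve_of_ok arity_sq[OF U])

lemma arities_respecting_id: "is_cwa (X :: ('a, 'o, 'u) cwa) \<Longrightarrow> id_ftor (amb X) \<in> arities_respecting X X"
  using arity_square_id[OF U, of X] by (auto simp: arities_respecting_iff intro!: bexI[of _ "square_id (nerve_of X)"])

text \<open>No square is part of a 1-cell here; any squares that witness \<open>K\<close> and
  \<open>L\<close> are pasted.\<close>

lemma arities_respecting_comp:
  assumes X: "is_cwa (X :: ('a, 'o, 'u) cwa)" and Y: "is_cwa Y" and Z: "is_cwa Z"
    and K: "K \<in> arities_respecting X Y" and L: "L \<in> arities_respecting Y Z"
  shows "ftor_comp (amb X) L K \<in> arities_respecting X Z"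
proof -
  obtain s t where "s \<in> arity_squares X Y" "sd s = K" "t \<in> arity_squares Y Z" "sd t = L"
    using K L arities_respecting_iff[OF X Y] arities_respecting_iff[OF Y Z] by blast
  then show ?thesis
    using arity_square_comp[OF U X Y Z, of s t]
    by (auto simp: arities_respecting_iff[OF X Z] intro!: bexI[of _ "square_comp (nerve_of X) (nerve_of Y) (nerve_of Z) t s"])
qed

lemma two_category_CwA: "two_category (CwA :: (('a, 'o, 'u) cwa, ('o, 'u, 'o, 'u) ftor, 'o \<Rightarrow> 'u) two_cat)"
proof (unfold two_category_def, intro conjI ballI, goal_cases)
  case (1 a b)
  then have b: "is_cwa b" by simp
  have c: "category (functor_category (amb a) (amb b))" by (rule category_functor_category[OF cwa_amb[OF b]])
  note [simp] = arities_respecting_functor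
  show ?case
  proof (rule categoryI)
  qed (simp_all add: cat_id[OF c, simplified] cat_cmp[OF c, simplified] cat_idl[OF c, simplified]
      cat_idr[OF c, simplified] cat_assoc[OF c, simplified])
next
  case (4 a b c f g)
  then show ?case by (simp add: hcomp_idn[OF _ _ arities_respecting_functor arities_respecting_functor] cwa_amb)
next
  case (5 a b c f f' g g' \<alpha> \<beta>)
  then show ?case
    by (simp add: hcomp_nat[OF _ _ arities_respecting_functor arities_respecting_functor arities_respecting_functor arities_respecting_functor] cwa_amb)
next
  case (6 a b c f f' f'' g g' g'' \<alpha> \<alpha>' \<beta> \<beta>')
  then show ?case
    using hcomp_interchange[of "amb a" "amb b" "amb c" f f' f'' g g' g'' \<alpha> \<alpha>' \<beta> \<beta>']
    by (simp add: arities_respecting_functor cwa_amb)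
next
  case (9 a b f f' \<alpha>)
  then show ?case using hcomp_idl[of "amb b" f "amb a" f' \<alpha>] by (simp add: arities_respecting_functor cwa_amb)
next
  case (10 a b f f' \<alpha>)
  then show ?case using hcomp_idr[of "amb a" "amb b" f f' \<alpha>] by (simp add: arities_respecting_functor cwa_amb)
next
  case (12 a b c d f f' g g' h h' \<alpha> \<beta> \<gamma>)
  then show ?case
    using hcomp_assoc[of "amb a" "amb b" "amb c" "amb d" f f' g g' h h' \<alpha> \<beta> \<gamma>]
    by (simp add: arities_respecting_functor cwa_amb)
next
  case (11 a b c d f g h)
  then show ?case using ftor_comp_assoc[OF arities_respecting_functor[of f a b]] by simp
qed (simp_all add: arities_respecting_id arities_respecting_comp
    ftor_comp_idl[OF arities_respecting_functor] ftor_comp_idr[OF arities_respecting_functor])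

text \<open>Every compatible pair is the value at its own first component. The 2-functor laws on
  2-cells thus reduce to identities and to vertical and horizontal composites of compatible pairs
  being compatible.\<close>

lemma nerve_two_functor_fa:
  assumes X: "is_cwa (X :: ('a, 'o, 'u) cwa)" and Y: "is_cwa Y" and s: "s \<in> arity_squares X Y" and t: "t \<in> arity_squares X Y"
    and p: "p \<in> square_2cells (nerve_of X) (nerve_of Y) s t"
  shows "fa (FH nerve_two_functor X Y) s t (fst p) = p"
proof -
  have "fst p \<in> nats (amb X) (amb Y) (sd s) (sd t)" using s2_fst[OF p] by simp
  moreover from square_2cell_ex1[OF U X Y s arity_sq[OF U X Y t] this]
  have "(THE \<alpha>'. (fst p, \<alpha>') \<in> square_2cells (nerve_of X) (nerve_of Y) s t) = snd p"
    by (rule the1_equality) (simp add: p)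
  ultimately show ?thesis using s t by (simp add: nerve_two_functor_def)
qed

lemma nerve_two_functor_2cell:
  assumes X: "is_cwa (X :: ('a, 'o, 'u) cwa)" and Y: "is_cwa Y" and s: "s \<in> arity_squares X Y" and t: "t \<in> arity_squares X Y"
    and \<alpha>: "\<alpha> \<in> nats (amb X) (amb Y) (sd s) (sd t)"
  shows "fa (FH nerve_two_functor X Y) s t \<alpha> \<in> square_2cells (nerve_of X) (nerve_of Y) s t"
    and "fst (fa (FH nerve_two_functor X Y) s t \<alpha>) = \<alpha>"
proof -
  obtain \<alpha>' where p: "(\<alpha>, \<alpha>') \<in> square_2cells (nerve_of X) (nerve_of Y) s t"
    using square_2cell_ex1[OF U X Y s arity_sq[OF U X Y t] \<alpha>] by blast
  from nerve_two_functor_fa[OF X Y s t this] p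
  show "fa (FH nerve_two_functor X Y) s t \<alpha> \<in> square_2cells (nerve_of X) (nerve_of Y) s t"
    "fst (fa (FH nerve_two_functor X Y) s t \<alpha>) = \<alpha>" by simp_all
qed

lemma two_functor_nerve:
  "two_functor CwAsq (CAT2 TYPE('u)) (nerve_two_functor ::
     (('a, 'o, 'u) cwa, ('a, 'o, 'u) nerve_square, 'o \<Rightarrow> 'u, ('a, 'o, 'u) nerve_arrow,
          ('a, 'o, 'u) nerve_square, ('o \<Rightarrow> 'u) \<times> (('a, 'u) presheaf \<Rightarrow> ('a, 'u) presheaf_mor)) two_ftor)"
proof (unfold two_functor_def, intro conjI ballI, goal_cases)
  case (1 a)
  then show ?case using nerve_of_in_CAT2[OF U] by simp
next
  case (2 a b)
  then have a: "is_cwa a" and b: "is_cwa b" by simp_all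
  note oa = nerve_of_ok[OF a] and ob = nerve_of_ok[OF b] and q = arity_sq[OF U a b]
  note cat = tc_cat[OF two_category_CwAsq, of a b]
  let ?F = "FH nerve_two_functor a b"
  note fa = nerve_two_functor_2cell[OF a b]
  have "?F = mk_ftor (HomC CwAsq a b) (fo ?F) (fa ?F)" by (simp add: nerve_two_functor_def)
  also have "\<dots> \<in> functors (HomC CwAsq a b) (HomC (CAT2 TYPE('u)) (nerve_of a) (nerve_of b))"
  proof (rule mk_ftor_in_functors)
    show "category (HomC CwAsq a b)" using cat 2 by simp
  next
    fix s assume "s \<in> Ob (HomC CwAsq a b)"
    then have s: "s \<in> arity_squares a b" by simp
    show "fa ?F s s (idn (HomC CwAsq a b) s) = idn (HomC (CAT2 TYPE('u)) (nerve_of a) (nerve_of b)) (fo ?F s)"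
      using nerve_two_functor_fa[OF a b s s square_2cells_idn[OF oa ob q[OF s]]] s by simp
  next
    fix s t r \<alpha> \<beta> assume "s \<in> Ob (HomC CwAsq a b)" "t \<in> Ob (HomC CwAsq a b)" "r \<in> Ob (HomC CwAsq a b)"
      and "\<alpha> \<in> Hom (HomC CwAsq a b) s t" "\<beta> \<in> Hom (HomC CwAsq a b) t r"
    then have h: "s \<in> arity_squares a b" "t \<in> arity_squares a b" "r \<in> arity_squares a b"
      "\<alpha> \<in> nats (amb a) (amb b) (sd s) (sd t)" "\<beta> \<in> nats (amb a) (amb b) (sd t) (sd r)" by simp_all
    show "fa ?F s r (cmp (HomC CwAsq a b) s t r \<beta> \<alpha>) =
      cmp (HomC (CAT2 TYPE('u)) (nerve_of a) (nerve_of b)) (fo ?F s) (fo ?F t) (fo ?F r) (fa ?F t r \<beta>) (fa ?F s t \<alpha>)"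
      using nerve_two_functor_fa[OF a b h(1,3) square_2cells_cmp[OF oa ob q[OF h(1)] q[OF h(2)] q[OF h(3)]
            fa(1)[OF h(1,2,4)] fa(1)[OF h(2,3,5)]]]
        fa(2)[OF h(1,2,4)] fa(2)[OF h(2,3,5)] h by simp
  qed (simp_all add: q fa(1))
  finally show ?case by simp
next
  case (3 a)
  then show ?case by (simp add: arity_square_id[OF U])
next
  case (4 a b c f g)
  then show ?case by (simp add: arity_square_comp[OF U])
next
  case (5 a b c f f' g g' \<alpha> \<beta>)
  then have cw: "is_cwa a" "is_cwa b" "is_cwa c" by simp_all
  have h: "f \<in> arity_squares a b" "f' \<in> arity_squares a b" "g \<in> arity_squares b c" "g' \<in> arity_squares b c"
    "\<alpha> \<in> nats (amb a) (amb b) (sd f) (sd f')" "\<beta> \<in> nats (amb b) (amb c) (sd g) (sd g')" using 5 by simp_all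
  note fa = nerve_two_functor_2cell[OF cw(1,2) h(1,2,5)] nerve_two_functor_2cell[OF cw(2,3) h(3,4,6)]
  show ?case
    using nerve_two_functor_fa[OF cw(1,3) arity_square_comp[OF U cw h(1,3)] arity_square_comp[OF U cw h(2,4)]
      square_2cells_hcomp[OF nerve_of_ok[OF cw(1)] nerve_of_ok[OF cw(2)] nerve_of_ok[OF cw(3)]
        arity_sq[OF U cw(1,2) h(1)] arity_sq[OF U cw(1,2) h(2)] arity_sq[OF U cw(2,3) h(3)] arity_sq[OF U cw(2,3) h(4)]
        fa(1) fa(3)]] fa(2,4) h by simp
qed

text \<open>Stated for an abstract hom-category \<open>H\<close> so as to serve both
  \<open>CwAsq\<close> and an arbitrary choice of squares on \<open>CwA\<close>. Injectivity is read
  off the first component; fullness is \<open>square_2cells_eqI\<close>.\<close>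

lemma nerve_local_ff:
  assumes X: "is_cwa (X :: ('a, 'o, 'u) cwa)" and Y: "is_cwa Y"
    and S: "\<And>K. K \<in> Ob H \<Longrightarrow> fo F K \<in> arity_squares X Y"
    and H: "\<And>K L. K \<in> Ob H \<Longrightarrow> L \<in> Ob H \<Longrightarrow> Hom H K L = nats (amb X) (amb Y) (sd (fo F K)) (sd (fo F L))"
    and F: "\<And>K L \<alpha>. \<lbrakk>K \<in> Ob H; L \<in> Ob H; \<alpha> \<in> Hom H K L\<rbrakk> \<Longrightarrow>
      fa F K L \<alpha> \<in> square_2cells (nerve_of X) (nerve_of Y) (fo F K) (fo F L) \<and> fst (fa F K L \<alpha>) = \<alpha>"
  shows "full_faithful H (HomC (CAT2 TYPE('u)) (nerve_of X) (nerve_of Y)) F"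
  unfolding full_faithful_def
proof (intro ballI bij_betw_imageI)
  fix K L assume K: "K \<in> Ob H" and L: "L \<in> Ob H"
  show "inj_on (fa F K L) (Hom H K L)"
    by (rule inj_on_inverseI[of _ fst]) (use F[OF K L] in simp)
  show "fa F K L ` Hom H K L = Hom (HomC (CAT2 TYPE('u)) (nerve_of X) (nerve_of Y)) (fo F K) (fo F L)"
  proof (intro equalityI subsetI)
    fix p assume "p \<in> Hom (HomC (CAT2 TYPE('u)) (nerve_of X) (nerve_of Y)) (fo F K) (fo F L)"
    then have p: "p \<in> square_2cells (nerve_of X) (nerve_of Y) (fo F K) (fo F L)" by simp
    have f: "fst p \<in> Hom H K L" using s2_fst[OF p] H[OF K L] by simp
    have "fa F K L (fst p) = p"
      using square_2cells_eqI[OF U X Y S[OF K] arity_sq[OF U X Y S[OF L]] _ p] F[OF K L f] by blast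
    then show "p \<in> fa F K L ` Hom H K L" using f by (metis imageI)
  qed (use F[OF K L] in auto)
qed

end

subsection \<open>Projections of limits of nerves\<close>

text \<open>Squares from the arrow \<open>0 \<rightarrow> 1\<close> to \<open>b\<close> are objects of the codomain of \<open>b\<close>.\<close>

definition empty_cat :: "('o, 'm) category" where
  "empty_cat = \<lparr>Ob = {}, Hom = (\<lambda>_ _. {}), idn = (\<lambda>_. undefined), cmp = (\<lambda>_ _ _ _ _. undefined)\<rparr>"

text \<open>The category is needed at arbitrary types, and \<open>undefined\<close> is an element
  available in each of them.\<close>

definition one_cat :: "('p, 'n) category" where
  "one_cat = \<lparr>Ob = {undefined}, Hom = (\<lambda>_ _. {undefined}), idn = (\<lambda>_. undefined),
     cmp = (\<lambda>_ _ _ _ _. undefined)\<rparr>"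

definition pt_arrow :: "('o, 'm, 'p, 'n) arrow" where
  "pt_arrow = \<lparr>adom = empty_cat, acod = one_cat, afun = mk_ftor empty_cat (\<lambda>_. undefined) (\<lambda>_ _ _. undefined)\<rparr>"

definition pt_square :: "('o, 'm, 'p, 'n) arrow \<Rightarrow> 'p \<Rightarrow> ('o, 'm, 'p, 'n) square" where
  "pt_square b P = \<lparr>
     sd = mk_ftor empty_cat (\<lambda>_. undefined) (\<lambda>_ _ _. undefined),
     sc = mk_ftor one_cat (\<lambda>_. P) (\<lambda>_ _ _. idn (acod b) P),
     si = (\<lambda>_. undefined)\<rparr>"

text \<open>The first component is the only transformation between functors out of the empty
  category: an extensional function on the empty set is constantly \<open>undefined\<close>.\<close>

definition pt_cell :: "'n \<Rightarrow> ('o \<Rightarrow> 'm) \<times> ('p \<Rightarrow> 'n)" where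
  "pt_cell m = ((\<lambda>_. undefined), (\<lambda>x\<in>{undefined}. m))"

lemma pt_arrow_simps [simp]:
  "Ob empty_cat = {}" "Ob one_cat = {undefined}" "Hom one_cat x y = {undefined}"
  "idn one_cat x = undefined" "cmp one_cat x y z g f = undefined"
  "adom pt_arrow = empty_cat" "acod pt_arrow = one_cat"
  by (simp_all add: pt_arrow_def empty_cat_def one_cat_def)

lemma category_empty: "category empty_cat" and category_one: "category one_cat"
  by (auto intro!: categoryI)

lemma pt_arrow_ok: "arrow_ok pt_arrow"
  using category_empty category_one by (auto simp: arrow_ok_def functors_def pt_arrow_def)

lemma small_singleton: "universe U \<Longrightarrow> small U {x}"
  unfolding small_def universe_def
  by (meson card_of_Well_order card_of_ordLeq_finite finite.emptyI finite.insertI not_ordLeq_iff_ordLess)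

lemma pt_arrow_in_CAT2: "universe U \<Longrightarrow> pt_arrow \<in> Ob0 (CAT2 U)"
  by (simp add: Ob0_CAT2 pt_arrow_ok locally_small_def small_singleton)

lemma mk_ftor_empty: "Ob C = {} \<Longrightarrow> mk_ftor C F M = mk_ftor C F' M'"
  by (rule mk_ftor_cong) simp_all

lemma pt_square_simps [simp]:
  "fo (sc (pt_square b P)) undefined = P"
  "fa (sc (pt_square b P)) undefined undefined undefined = idn (acod b) P"
  by (simp_all add: pt_square_def)

lemma pt_square_in:
  assumes b: "arrow_ok b" and P: "P \<in> Ob (acod b)"
  shows "pt_square b P \<in> squares pt_arrow b"
proof (rule squaresI[OF pt_arrow_ok b], unfold pt_arrow_simps)
  show "sd (pt_square b P) \<in> functors empty_cat (adom b)"
    unfolding pt_square_def square.simps by (rule mk_ftor_in_functors[OF category_empty]) simp_all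
  show "sc (pt_square b P) \<in> functors one_cat (acod b)"
    unfolding pt_square_def square.simps
    by (rule mk_ftor_in_functors[OF category_one]) (use b P in \<open>simp_all add: arrow_ok_def cat_id cat_idl\<close>)
qed (simp_all add: pt_square_def)

lemma pt_cell_in:
  assumes b: "arrow_ok b" and P: "P \<in> Ob (acod b)" and Q: "Q \<in> Ob (acod b)" and m: "m \<in> Hom (acod b) P Q"
  shows "pt_cell m \<in> square_2cells pt_arrow b (pt_square b P) (pt_square b Q)"
  using b P Q m
  by (auto simp: square_2cells_iff pt_cell_def arrow_ok_def cat_idl cat_idr intro!: natsI)

lemma pt_cell_cmp:
  "cmp (HomC (CAT2 U) pt_arrow b) (pt_square b P) (pt_square b Q) (pt_square b R) (pt_cell n) (pt_cell m) =
     pt_cell (cmp (acod b) P Q R n m)"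
  by (auto simp: pt_cell_def functor_category_def restrict_def fun_eq_iff)

lemma pt_cell_idn: "idn (HomC (CAT2 U) pt_arrow b) (pt_square b P) = pt_cell (idn (acod b) P)"
  by (auto simp: pt_cell_def functor_category_def restrict_def fun_eq_iff)

lemma pt_cell_inj: "pt_cell m = pt_cell n \<Longrightarrow> m = n"
  by (auto simp: pt_cell_def dest!: fun_cong[of _ _ undefined])

lemma pt_cell_iso:
  assumes b: "arrow_ok b" and P: "P \<in> Ob (acod b)" and Q: "Q \<in> Ob (acod b)" and m: "m \<in> Hom (acod b) P Q"
  shows "is_iso (HomC (CAT2 U) pt_arrow b) (pt_square b P) (pt_square b Q) (pt_cell m) \<longleftrightarrow> is_iso (acod b) P Q m"
proof
  assume i: "is_iso (acod b) P Q m"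
  show "is_iso (HomC (CAT2 U) pt_arrow b) (pt_square b P) (pt_square b Q) (pt_cell m)"
  proof (rule is_isoI[of _ _ _ _ "pt_cell (cinv (acod b) P Q m)"])
    show "pt_cell m \<in> cells2 (CAT2 U) pt_arrow b (pt_square b P) (pt_square b Q)"
      "pt_cell (cinv (acod b) P Q m) \<in> cells2 (CAT2 U) pt_arrow b (pt_square b Q) (pt_square b P)"
      using pt_cell_in[OF b P Q m] pt_cell_in[OF b Q P cinv_hom[OF i]] by simp_all
  qed (simp_all only: pt_cell_cmp pt_cell_idn cinv_l[OF i] cinv_r[OF i])
next
  let ?K = "HomC (CAT2 U) pt_arrow b"
  assume i: "is_iso ?K (pt_square b P) (pt_square b Q) (pt_cell m)"
  obtain q where q: "q \<in> square_2cells pt_arrow b (pt_square b Q) (pt_square b P)"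
    "cmp ?K (pt_square b P) (pt_square b Q) (pt_square b P) q (pt_cell m) = pt_cell (idn (acod b) P)"
    "cmp ?K (pt_square b Q) (pt_square b P) (pt_square b Q) (pt_cell m) q = pt_cell (idn (acod b) Q)"
    using i unfolding is_iso_def pt_cell_idn by auto
  let ?n = "snd q undefined"
  \<comment> \<open>Extensionality leaves \<open>q\<close> only its single component, so the inverse
    is again of the form \<open>pt_cell ?n\<close>.\<close>
  have "fst q = (\<lambda>_. undefined)" "snd q = (\<lambda>x\<in>{undefined}. ?n)"
    using nat_ext[OF s2_fst[OF q(1)]] nat_ext[OF s2_snd[OF q(1)]]
    by (auto simp: extensional_def restrict_def fun_eq_iff)
  then have e: "q = pt_cell ?n" by (simp add: pt_cell_def prod_eq_iff)
  show "is_iso (acod b) P Q m"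
  proof (rule is_isoI[OF m])
    show "?n \<in> Hom (acod b) Q P" using nat_hom[OF s2_snd[OF q(1)], of undefined] by simp
    show "cmp (acod b) P Q P ?n m = idn (acod b) P" "cmp (acod b) Q P Q m ?n = idn (acod b) Q"
      using q(2,3) e pt_cell_cmp pt_cell_inj by metis+
  qed
qed

text \<open>Under the identification of squares out of \<open>pt_arrow\<close> with objects of the
  codomain, composing with \<open>s\<close> is applying \<open>sc s\<close>.
  \<open>pt_cell_whisker\<close> is the same for arrows.\<close>

lemma pt_square_comp:
  assumes b: "arrow_ok b" and c: "arrow_ok c" and s: "s \<in> squares b c" and P: "P \<in> Ob (acod b)"
  shows "square_comp pt_arrow b c s (pt_square b P) = pt_square c (fo (sc s) P)"
proof -
  have "mk_ftor one_cat (\<lambda>x. fo (sc s) (fo (sc (pt_square b P)) x))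
      (\<lambda>x y f. fa (sc s) (fo (sc (pt_square b P)) x) (fo (sc (pt_square b P)) y) (fa (sc (pt_square b P)) x y f)) =
    mk_ftor one_cat (\<lambda>_. fo (sc s) P) (\<lambda>_ _ _. idn (acod c) (fo (sc s) P))"
    by (rule mk_ftor_cong) (use P in \<open>simp_all add: ftor_id[OF sq_sc[OF b c s]]\<close>)
  then show ?thesis
    by (simp add: square_comp_def pt_square_def[of c] ftor_comp_def restrict_def mk_ftor_empty)
qed

lemma pt_cell_whisker:
  assumes b: "arrow_ok b" and c: "arrow_ok c" and s: "s \<in> squares b c" and P: "P \<in> Ob (acod b)" and Q: "Q \<in> Ob (acod b)"
    and m: "m \<in> Hom (acod b) P Q"
  shows "comp2 (CAT2 U) pt_arrow b c s s (pt_square b P) (pt_square b Q) (id2 (CAT2 U) b c s) (pt_cell m) =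
    pt_cell (fa (sc s) P Q m)"
  using assms
  by (auto simp: pt_cell_def nat_hcomp_def restrict_def fun_eq_iff arrow_ok_def cat_idl
    ftor_rules[OF sq_sc[OF b c s]])

context weight
begin

text \<open>\<open>limit_reflects_iso\<close> at the test object \<open>pt_arrow\<close>. Its empty
  domain makes first components and fillers trivial, so every arrow of \<open>acod l\<close> occurs
  as a 2-cell to be tested.\<close>

lemma limit_of_nerves_conservative:
  assumes V: "universe TYPE('u)" and Y: "two_functor J (CAT2 TYPE('u)) Y"
    and lim: "is_weighted_limit J W (CAT2 TYPE('u)) Y l M"
    and P: "P \<in> Ob (acod l)" and Q: "Q \<in> Ob (acod l)" and m: "m \<in> Hom (acod l) P Q"
    and iso: "\<And>j w. j \<in> Ob0 J \<Longrightarrow> w \<in> Ob (F0 W j) \<Longrightarrow>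
      is_iso (acod (F0 Y j)) (fo (sc (fo (M j) w)) P) (fo (sc (fo (M j) w)) Q) (fa (sc (fo (M j) w)) P Q m)"
  shows "is_iso (acod l) P Q m"
proof -
  have l: "l \<in> Ob0 (CAT2 TYPE('u))" and M: "M \<in> two_nats J W (rep_ftor J (CAT2 TYPE('u)) Y l)"
    using lim by (simp_all add: is_weighted_limit_def)
  then have ok: "arrow_ok l" by (simp add: Ob0_CAT2)
  have "is_iso (HomC (CAT2 TYPE('u)) pt_arrow l) (pt_square l P) (pt_square l Q) (pt_cell m)"
  proof (rule limit_reflects_iso[OF two_category_CAT2 Y lim pt_arrow_in_CAT2[OF V]])
    fix j w assume jw: "j \<in> Ob0 J" "w \<in> Ob (F0 W j)"
    have okj: "arrow_ok (F0 Y j)" using tf_ob[OF Y jw(1)] by (simp add: Ob0_CAT2)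
    have s: "fo (M j) w \<in> squares l (F0 Y j)"
      using ftor_ob[OF cone_ftor[OF two_category_CAT2 Y l M jw(1)] jw(2)] by simp
    note sc = sq_sc[OF ok okj s]
    show "is_iso (HomC (CAT2 TYPE('u)) pt_arrow (F0 Y j))
       (comp1 (CAT2 TYPE('u)) pt_arrow l (F0 Y j) (fo (M j) w) (pt_square l P))
       (comp1 (CAT2 TYPE('u)) pt_arrow l (F0 Y j) (fo (M j) w) (pt_square l Q))
       (comp2 (CAT2 TYPE('u)) pt_arrow l (F0 Y j) (fo (M j) w) (fo (M j) w) (pt_square l P) (pt_square l Q)
         (id2 (CAT2 TYPE('u)) l (F0 Y j) (fo (M j) w)) (pt_cell m))"
      unfolding CAT2_simps(3) pt_square_comp[OF ok okj s P] pt_square_comp[OF ok okj s Q]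
        pt_cell_whisker[OF ok okj s P Q m] pt_cell_iso[OF okj ftor_ob[OF sc P] ftor_ob[OF sc Q] ftor_hom[OF sc P Q m]]
      by (rule iso[OF jw])
  qed (use pt_square_in[OF ok] pt_cell_in[OF ok P Q m] P Q in simp_all)
  then show ?thesis unfolding pt_cell_iso[OF ok P Q m] .
qed

text \<open>A weighted cone has a projection for each \<open>j\<close> and each object
  \<open>w\<close> of the weight at \<open>j\<close>; hence \<open>cocont_reflect\<close> is applied
  to a family indexed by pairs.\<close>

lemma limit_of_nerves_arity:
  fixes l :: "('a, 'o, 'u) cwa"
  assumes V: "universe TYPE('u)" and Y: "two_functor J (CAT2 TYPE('u)) Y"
    and lim: "is_weighted_limit J W (CAT2 TYPE('u)) Y (nerve_of l) M"
    and l: "is_cwa l" and d: "is_cwa d"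
    and Z: "\<And>j. j \<in> Ob0 J \<Longrightarrow> is_cwa (Z j)" "\<And>j. j \<in> Ob0 J \<Longrightarrow> F0 Y j = nerve_of (Z j)"
    and M: "\<And>j w. j \<in> Ob0 J \<Longrightarrow> w \<in> Ob (F0 W j) \<Longrightarrow> fo (M j) w \<in> arity_squares l (Z j)"
    and h: "h \<in> squares (nerve_of d) (nerve_of l)"
    and Mh: "\<And>j w. j \<in> Ob0 J \<Longrightarrow> w \<in> Ob (F0 W j) \<Longrightarrow>
      square_comp (nerve_of d) (nerve_of l) (nerve_of (Z j)) (fo (M j) w) h \<in> arity_squares d (Z j)"
  shows "h \<in> arity_squares d l"
  unfolding arity_squares_iff[OF V d l]
proof (intro conjI h cocont_reflect[OF V cwa_small[OF d] cwa_small[OF l], of "Sigma (Ob0 J) (\<lambda>j. Ob (F0 W j))"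
      "\<lambda>i. psh (ari (Z (fst i)))" _ "\<lambda>i. sc (fo (M (fst i)) (snd i))"])
  show "sc h \<in> functors (psh (ari d)) (psh (ari l))"
    using sq_sc[OF nerve_of_ok[OF d] nerve_of_ok[OF l] h] by simp
next
  fix i assume "i \<in> Sigma (Ob0 J) (\<lambda>j. Ob (F0 W j))"
  then have i: "fst i \<in> Ob0 J" "snd i \<in> Ob (F0 W (fst i))" by auto
  show "category (psh (ari (Z (fst i))))" by (rule category_psh)
  show "locally_small TYPE('u) (psh (ari (Z (fst i))))" by (rule locally_small_psh[OF V cwa_ari_ob[OF Z(1)[OF i(1)]]])
  show "cocont (ari l) (psh (ari (Z (fst i)))) (sc (fo (M (fst i)) (snd i)))"
    using M[OF i] unfolding arity_squares_iff[OF V l Z(1)[OF i(1)]] by blast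
  show "cocont (ari d) (psh (ari (Z (fst i)))) (ftor_comp (psh (ari d)) (sc (fo (M (fst i)) (snd i))) (sc h))"
    using Mh[OF i] unfolding arity_squares_iff[OF V d Z(1)[OF i(1)]] by simp
next
  fix P Q m assume PQ: "P \<in> Ob (psh (ari l))" "Q \<in> Ob (psh (ari l))" "m \<in> Hom (psh (ari l)) P Q"
    and i: "\<And>i. i \<in> Sigma (Ob0 J) (\<lambda>j. Ob (F0 W j)) \<Longrightarrow> is_iso (psh (ari (Z (fst i)))) (fo (sc (fo (M (fst i)) (snd i))) P)
       (fo (sc (fo (M (fst i)) (snd i))) Q) (fa (sc (fo (M (fst i)) (snd i))) P Q m)"
  show "is_iso (psh (ari l)) P Q m"
    using limit_of_nerves_conservative[OF V Y lim, of P Q m] PQ i[OF SigmaI] by (simp add: Z(2))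
qed

end

section \<open>Reflection for both forms of the nerve 2-functor\<close>

context weight
begin

text \<open>Squares are the 1-cells here and the 2-functor fixes them, so lifting \<open>h\<close>
  means no more than \<open>h\<close> being an arity square.\<close>

lemma reflects_CwAsq:
  assumes V: "universe TYPE('u)"
  shows "reflects_weighted_limits J W CwAsq (CAT2 TYPE('u))
       (nerve_two_functor ::
         (('a, 'o, 'u) cwa, ('a, 'o, 'u) nerve_square, 'o \<Rightarrow> 'u, ('a, 'o, 'u) nerve_arrow,
          ('a, 'o, 'u) nerve_square,
          ('o \<Rightarrow> 'u) \<times> (('a, 'u) presheaf \<Rightarrow> ('a, 'u) presheaf_mor)) two_ftor)"
    (is "reflects_weighted_limits J W CwAsq _ ?\<Phi>")
  unfolding reflects_weighted_limits_def
proof (intro allI impI, elim conjE)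
  fix X and l :: "('a, 'o, 'u) cwa" and L
  assume X: "two_functor J CwAsq X" and l: "l \<in> Ob0 CwAsq" and "L \<in> Ob (cones J W CwAsq X l)"
    and lim: "is_weighted_limit J W (CAT2 TYPE('u)) (two_ftor_comp J ?\<Phi> X) (F0 ?\<Phi> l) (cone_image J W X ?\<Phi> l L)"
  then have L: "L \<in> two_nats J W (rep_ftor J CwAsq X l)" by simp
  note C = two_category_CwAsq[OF V] and D = two_category_CAT2 and P = two_functor_nerve[OF V]
  have ff: "full_faithful (HomC CwAsq a b) (HomC (CAT2 TYPE('u)) (F0 ?\<Phi> a) (F0 ?\<Phi> b)) (FH ?\<Phi> a b)"
    if "a \<in> Ob0 CwAsq" "b \<in> Ob0 CwAsq" for a b
  proof -
    have ab: "is_cwa a" "is_cwa b" using that by simp_all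
    show ?thesis
      unfolding F0_nerve_two_functor
      by (rule nerve_local_ff[OF V ab]) (simp_all add: nerve_two_functor_2cell[OF V ab])
  qed
  have inj: "inj_on (fo (FH ?\<Phi> a b)) (cells1 CwAsq a b)" for a b
    by (rule inj_onI) simp
  have Xj: "is_cwa (F0 X j)" if "j \<in> Ob0 J" for j using tf_ob[OF X that] by simp
  have Ljw: "fo (L j) w \<in> arity_squares l (F0 X j)" if "j \<in> Ob0 J" "w \<in> Ob (F0 W j)" for j w
    using ftor_ob[OF cone_ftor[OF C X l L that(1)] that(2)] by simp
  show "is_weighted_limit J W CwAsq X l L"
  proof (rule reflects_limit[OF C D P X ff inj l L lim])
    fix d h assume d: "d \<in> Ob0 CwAsq" and h: "h \<in> cells1 (CAT2 TYPE('u)) (F0 ?\<Phi> d) (F0 ?\<Phi> l)"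
      and i: "\<And>j w. j \<in> Ob0 J \<Longrightarrow> w \<in> Ob (F0 W j) \<Longrightarrow>
        comp1 (CAT2 TYPE('u)) (F0 ?\<Phi> d) (F0 ?\<Phi> l) (F0 ?\<Phi> (F0 X j)) (fo (FH ?\<Phi> l (F0 X j)) (fo (L j) w)) h
          \<in> fo (FH ?\<Phi> d (F0 X j)) ` cells1 CwAsq d (F0 X j)"
    have "h \<in> arity_squares d l"
    proof (rule limit_of_nerves_arity[OF V two_functor_comp[OF J X P] lim[unfolded F0_nerve_two_functor]])
      fix j w assume jw: "j \<in> Ob0 J" "w \<in> Ob (F0 W j)"
      have e: "fo (cone_image J W X ?\<Phi> l L j) w = fo (L j) w"
        using jw Ljw[OF jw] by (simp add: cone_image_def)
      show "fo (cone_image J W X ?\<Phi> l L j) w \<in> arity_squares l (F0 X j)"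
        unfolding e by (rule Ljw[OF jw])
      show "square_comp (nerve_of d) (nerve_of l) (nerve_of (F0 X j)) (fo (cone_image J W X ?\<Phi> l L j) w) h \<in> arity_squares d (F0 X j)"
        unfolding e using i[OF jw] Ljw[OF jw] by auto
    qed (use l d h Xj in \<open>simp_all add: two_ftor_comp_def\<close>)
    then show "h \<in> fo (FH ?\<Phi> d l) ` cells1 CwAsq d l" by force
  qed
qed

text \<open>Lifting \<open>h\<close> asks for more than an arity square: \<open>h\<close> has to be
  the very square that \<open>\<Phi>\<close> assigns to \<open>sd h\<close>. Both induce the same
  cone over the image diagram, and the comparison of the limit in \<open>CAT2\<close> is injective
  on 1-cells, so they coincide.\<close>

lemma reflects_CwA:
  fixes \<Phi> :: "(('a, 'o, 'u) cwa, ('o, 'u, 'o, 'u) ftor, 'o \<Rightarrow> 'u, ('a, 'o, 'u) nerve_arrow,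
             ('a, 'o, 'u) nerve_square,
             ('o \<Rightarrow> 'u) \<times> (('a, 'u) presheaf \<Rightarrow> ('a, 'u) presheaf_mor)) two_ftor"
  assumes V: "universe TYPE('u)" and \<Phi>: "is_nerve_two_functor \<Phi>"
  shows "reflects_weighted_limits J W CwA (CAT2 TYPE('u)) \<Phi>"
  unfolding reflects_weighted_limits_def
proof (intro allI impI, elim conjE)
  fix X and l :: "('a, 'o, 'u) cwa" and L
  assume X: "two_functor J CwA X" and l: "l \<in> Ob0 CwA" and "L \<in> Ob (cones J W CwA X l)"
    and lim: "is_weighted_limit J W (CAT2 TYPE('u)) (two_ftor_comp J \<Phi> X) (F0 \<Phi> l) (cone_image J W X \<Phi> l L)"
  then have L: "L \<in> two_nats J W (rep_ftor J CwA X l)" by simp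
  note C = two_category_CwA[OF V] and D = two_category_CAT2
  have P: "two_functor CwA (CAT2 TYPE('u)) \<Phi>" and P0: "\<And>X. is_cwa X \<Longrightarrow> F0 \<Phi> X = nerve_of X"
    and P1: "\<And>X Y K. \<lbrakk>is_cwa X; is_cwa Y; K \<in> arities_respecting X Y\<rbrakk> \<Longrightarrow>
      fo (FH \<Phi> X Y) K \<in> arity_squares X Y \<and> sd (fo (FH \<Phi> X Y) K) = K"
    and P2: "\<And>X Y K L \<alpha>. \<lbrakk>is_cwa X; is_cwa Y; K \<in> arities_respecting X Y; L \<in> arities_respecting X Y;
      \<alpha> \<in> nats (amb X) (amb Y) K L\<rbrakk> \<Longrightarrow>
      fst (fa (FH \<Phi> X Y) K L \<alpha>) = \<alpha>"
    using \<Phi> unfolding is_nerve_two_functor_def by simp_all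
  have P2': "fa (FH \<Phi> X Y) K L \<alpha> \<in> square_2cells (nerve_of X) (nerve_of Y) (fo (FH \<Phi> X Y) K) (fo (FH \<Phi> X Y) L)"
    if "is_cwa X" "is_cwa Y" "K \<in> arities_respecting X Y" "L \<in> arities_respecting X Y" "\<alpha> \<in> nats (amb X) (amb Y) K L" for X Y K L \<alpha>
    using ftor_hom[OF tf_ftor[OF P], of X Y K L \<alpha>] that by (simp add: P0)
  have ff: "full_faithful (HomC CwA a b) (HomC (CAT2 TYPE('u)) (F0 \<Phi> a) (F0 \<Phi> b)) (FH \<Phi> a b)"
    if "a \<in> Ob0 CwA" "b \<in> Ob0 CwA" for a b
  proof -
    have ab: "is_cwa a" "is_cwa b" using that by simp_all
    show ?thesis
      unfolding P0[OF ab(1)] P0[OF ab(2)]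
      by (rule nerve_local_ff[OF V ab]) (simp_all add: P1[OF ab] P2[OF ab] P2'[OF ab])
  qed
  have inj: "inj_on (fo (FH \<Phi> a b)) (cells1 CwA a b)" if "a \<in> Ob0 CwA" "b \<in> Ob0 CwA" for a b
    by (rule inj_on_inverseI[of _ sd]) (use P1 that in simp)
  have lc: "is_cwa l" using l by simp
  have Xj: "is_cwa (F0 X j)" if "j \<in> Ob0 J" for j using tf_ob[OF X that] by simp
  note Lf = cone_ftor[OF C X l L]
  have Ljw: "fo (L j) w \<in> arities_respecting l (F0 X j)" if "j \<in> Ob0 J" "w \<in> Ob (F0 W j)" for j w
    using ftor_ob[OF Lf[OF that(1)] that(2)] by simp
  have Lv: "fa (L j) w w' v \<in> nats (amb l) (amb (F0 X j)) (fo (L j) w) (fo (L j) w')"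
    if "j \<in> Ob0 J" "w \<in> Ob (F0 W j)" "w' \<in> Ob (F0 W j)" "v \<in> Hom (F0 W j) w w'" for j w w' v
    using ftor_hom[OF Lf[OF that(1)] that(2-4)] by simp
  let ?L = "cone_image J W X \<Phi> l L"
  have Lo: "fo (?L j) w = fo (FH \<Phi> l (F0 X j)) (fo (L j) w)" if "j \<in> Ob0 J" "w \<in> Ob (F0 W j)" for j w
    using that by (simp add: cone_image_def)
  have La: "fa (?L j) w w' v = fa (FH \<Phi> l (F0 X j)) (fo (L j) w) (fo (L j) w') (fa (L j) w w' v)"
    if "j \<in> Ob0 J" "w \<in> Ob (F0 W j)" "w' \<in> Ob (F0 W j)" "v \<in> Hom (F0 W j) w w'" for j w w' v
    using that by (simp add: cone_image_def)
  show "is_weighted_limit J W CwA X l L"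
  proof (rule reflects_limit[OF C D P X ff inj l L lim])
    fix d h assume d: "d \<in> Ob0 CwA" and h: "h \<in> cells1 (CAT2 TYPE('u)) (F0 \<Phi> d) (F0 \<Phi> l)"
      and i: "\<And>j w. j \<in> Ob0 J \<Longrightarrow> w \<in> Ob (F0 W j) \<Longrightarrow>
        comp1 (CAT2 TYPE('u)) (F0 \<Phi> d) (F0 \<Phi> l) (F0 \<Phi> (F0 X j)) (fo (FH \<Phi> l (F0 X j)) (fo (L j) w)) h
          \<in> fo (FH \<Phi> d (F0 X j)) ` cells1 CwA d (F0 X j)"
    have dc: "is_cwa d" using d by simp
    have hs: "h \<in> squares (nerve_of d) (nerve_of l)" using h by (simp add: P0 dc lc)
    have Mh: "\<exists>M\<in>arities_respecting d (F0 X j).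
        square_comp (nerve_of d) (nerve_of l) (nerve_of (F0 X j)) (fo (FH \<Phi> l (F0 X j)) (fo (L j) w)) h = fo (FH \<Phi> d (F0 X j)) M"
      if jw: "j \<in> Ob0 J" "w \<in> Ob (F0 W j)" for j w
      using i[OF jw] by (auto simp: P0 dc lc Xj[OF jw(1)])
    have ha: "h \<in> arity_squares d l"
    proof (rule limit_of_nerves_arity[OF V two_functor_comp[OF J X P] lim[unfolded P0[OF lc]] lc dc])
      fix j w assume jw: "j \<in> Ob0 J" "w \<in> Ob (F0 W j)"
      show "fo (?L j) w \<in> arity_squares l (F0 X j)"
        using P1[OF lc Xj[OF jw(1)] Ljw[OF jw]] by (simp add: Lo[OF jw])
      show "square_comp (nerve_of d) (nerve_of l) (nerve_of (F0 X j)) (fo (?L j) w) h \<in> arity_squares d (F0 X j)"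
        using Mh[OF jw] P1[OF dc Xj[OF jw(1)]] by (auto simp: Lo[OF jw])
    qed (use hs Xj P0 in \<open>simp_all add: two_ftor_comp_def\<close>)
    let ?K = "sd h" and ?h = "fo (FH \<Phi> d l) (sd h)"
    have K: "?K \<in> arities_respecting d l" using ha by (auto simp: arities_respecting_iff[OF dc lc])
    note PK = P1[OF dc lc K]
    have hK: "?h \<in> squares (nerve_of d) (nerve_of l)" using PK arity_sq[OF V dc lc] by blast
    text \<open>The squares \<open>h\<close> and \<open>\<Phi> K\<close> have the same first component, and so do their composites with
      the limit cone, which lie in the image of \<open>\<Phi>\<close>.\<close>
    have c1: "square_comp (nerve_of d) (nerve_of l) (nerve_of (F0 X j)) (fo (FH \<Phi> l (F0 X j)) (fo (L j) w)) ?h =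
        square_comp (nerve_of d) (nerve_of l) (nerve_of (F0 X j)) (fo (FH \<Phi> l (F0 X j)) (fo (L j) w)) h" (is "?a = ?b")
      if jw: "j \<in> Ob0 J" "w \<in> Ob (F0 W j)" for j w
    proof -
      obtain M where M: "M \<in> arities_respecting d (F0 X j)" "?b = fo (FH \<Phi> d (F0 X j)) M"
        using Mh[OF jw] by blast
      \<comment> \<open>A square in the image of \<open>\<Phi>\<close> is the one assigned to its
        own first component. For \<open>?b\<close> this component is the composite of
        \<open>fo (L j) w\<close> with \<open>sd h\<close>, and \<open>\<Phi>\<close> preserves
        composites.\<close>
      have "M = sd ?b" using P1[OF dc Xj[OF jw(1)] M(1)] M(2) by simp
      also have "\<dots> = ftor_comp (amb d) (fo (L j) w) ?K"
        using P1[OF lc Xj[OF jw(1)] Ljw[OF jw]] by simp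
      finally have "?b = fo (FH \<Phi> d (F0 X j)) (ftor_comp (amb d) (fo (L j) w) ?K)" using M(2) by simp
      then show ?thesis
        using tf_comp1[OF P d l, of "F0 X j" ?K "fo (L j) w"] K Ljw[OF jw] by (simp add: P0 dc lc Xj[OF jw(1)])
    qed
    let ?T = "cone_comparison J W (CAT2 TYPE('u)) (two_ftor_comp J \<Phi> X) (F0 \<Phi> l) ?L (F0 \<Phi> d)"
    have "fo ?T ?h = fo ?T h"
    proof (rule extensionalityI[of _ "Ob0 J"])
      fix j assume j: "j \<in> Ob0 J"
      let ?n = "nerve_of (F0 X j)"
      note Xc = Xj[OF j]
      \<comment> \<open>Equality of the legs at the arrows of the weight. The squares
        \<open>?h\<close> and \<open>h\<close> are not yet known to be equal, but by
        \<open>c1\<close> both whiskered cells have the same source and target, and their first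
        components see the squares only through the common \<open>sd h\<close>.\<close>
      have "comp2 (CAT2 TYPE('u)) (nerve_of d) (nerve_of l) ?n (fo (?L j) w) (fo (?L j) w') ?h ?h (fa (?L j) w w' v) (id2 (CAT2 TYPE('u)) (nerve_of d) (nerve_of l) ?h) =
        comp2 (CAT2 TYPE('u)) (nerve_of d) (nerve_of l) ?n (fo (?L j) w) (fo (?L j) w') h h (fa (?L j) w w' v) (id2 (CAT2 TYPE('u)) (nerve_of d) (nerve_of l) h)"
        (is "?p = ?q") if w: "w \<in> Ob (F0 W j)" "w' \<in> Ob (F0 W j)" "v \<in> Hom (F0 W j) w w'" for w w' v
      proof (rule square_2cells_eqI[OF V dc Xc])
        let ?Lw = "fo (FH \<Phi> l (F0 X j)) (fo (L j) w)" and ?Lw' = "fo (FH \<Phi> l (F0 X j)) (fo (L j) w')"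
        note a = P1[OF lc Xc Ljw[OF j w(1)], THEN conjunct1] P1[OF lc Xc Ljw[OF j w(2)], THEN conjunct1]
        have sL: "?Lw \<in> squares (nerve_of l) ?n" "?Lw' \<in> squares (nerve_of l) ?n"
          using a arity_sq[OF V lc Xc] by blast+
        have v2: "fa (?L j) w w' v \<in> square_2cells (nerve_of l) ?n ?Lw ?Lw'"
          unfolding La[OF j w] by (rule P2'[OF lc Xc Ljw[OF j w(1)] Ljw[OF j w(2)] Lv[OF j w]])
        note ok = nerve_of_ok[OF dc] nerve_of_ok[OF lc] nerve_of_ok[OF Xc]
        show "square_comp (nerve_of d) (nerve_of l) ?n ?Lw h \<in> arity_squares d (F0 X j)"
          by (rule arity_square_comp[OF V dc lc Xc ha a(1)])
        show "square_comp (nerve_of d) (nerve_of l) ?n ?Lw' h \<in> squares (nerve_of d) ?n"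
          by (rule square_comp_in[OF ok hs sL(2)])
        show "?q \<in> square_2cells (nerve_of d) ?n (square_comp (nerve_of d) (nerve_of l) ?n ?Lw h) (square_comp (nerve_of d) (nerve_of l) ?n ?Lw' h)"
          using square_2cells_hcomp[OF ok hs hs sL square_2cells_idn[OF ok(1,2) hs] v2]
          by (simp add: Lo[OF j w(1)] Lo[OF j w(2)])
        show "?p \<in> square_2cells (nerve_of d) ?n (square_comp (nerve_of d) (nerve_of l) ?n ?Lw h) (square_comp (nerve_of d) (nerve_of l) ?n ?Lw' h)"
          using square_2cells_hcomp[OF ok hK hK sL square_2cells_idn[OF ok(1,2) hK] v2]
          by (simp add: Lo[OF j w(1)] Lo[OF j w(2)] c1[OF j w(1)] c1[OF j w(2)])
        show "fst ?p = fst ?q" using PK by simp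
      qed
      then show "fo ?T ?h j = fo ?T h j"
        using hs hK j by (simp add: P0 dc lc Xc c1 Lo two_ftor_comp_def cong: mk_ftor_cong)
    qed (use hs hK in \<open>simp_all add: P0 dc lc\<close>)
    moreover have "inj_on (fo ?T) (cells1 (CAT2 TYPE('u)) (F0 \<Phi> d) (F0 \<Phi> l))"
      using lim tf_ob[OF P d] by (auto simp: is_weighted_limit_def iso_of_categories_def bij_betw_def)
    ultimately have "?h = h"
      using hs hK by (auto simp: P0 dc lc dest: inj_onD)
    then show "h \<in> fo (FH \<Phi> d l) ` cells1 CwA d l"
      using K by (metis CwA_simps(2) imageI)
  qed
qed

end

theorem proposition12p1:
  fixes J :: "('j, 'k, 'i) two_cat"
    and W :: "('j, 'k, 'i, ('w, 'v) category, ('w, 'v, 'w, 'v) ftor, 'w \<Rightarrow> 'v) two_ftor"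
  assumes "universe TYPE('u)"
    and "two_category J"
    and "two_functor J (Cat TYPE('u)) W"
  shows
    "two_functor CwAsq (CAT2 TYPE('u))
       (nerve_two_functor ::
         (('a, 'o, 'u) cwa, ('a, 'o, 'u) nerve_square, 'o \<Rightarrow> 'u, ('a, 'o, 'u) nerve_arrow,
          ('a, 'o, 'u) nerve_square,
          ('o \<Rightarrow> 'u) \<times> (('a, 'u) presheaf \<Rightarrow> ('a, 'u) presheaf_mor)) two_ftor) \<and>
     reflects_weighted_limits J W CwAsq (CAT2 TYPE('u))
       (nerve_two_functor ::
         (('a, 'o, 'u) cwa, ('a, 'o, 'u) nerve_square, 'o \<Rightarrow> 'u, ('a, 'o, 'u) nerve_arrow,
          ('a, 'o, 'u) nerve_square,
          ('o \<Rightarrow> 'u) \<times> (('a, 'u) presheaf \<Rightarrow> ('a, 'u) presheaf_mor)) two_ftor) \<and>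
     (\<forall>\<Phi> :: (('a, 'o, 'u) cwa, ('o, 'u, 'o, 'u) ftor, 'o \<Rightarrow> 'u, ('a, 'o, 'u) nerve_arrow,
             ('a, 'o, 'u) nerve_square,
             ('o \<Rightarrow> 'u) \<times> (('a, 'u) presheaf \<Rightarrow> ('a, 'u) presheaf_mor)) two_ftor.
        is_nerve_two_functor \<Phi> \<longrightarrow> reflects_weighted_limits J W CwA (CAT2 TYPE('u)) \<Phi>)"
proof -
  interpret weight J W "TYPE('u)" using assms(2,3) by unfold_locales
  show ?thesis
    using two_functor_nerve[OF assms(1)] reflects_CwAsq[OF assms(1)] reflects_CwA[OF assms(1)] by blast
qed

end
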